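(* Let $(M,\mathcal B,m)$ be a measure space, endowed with some metric $d$, and let $f:M\to M$ be a measurable map with $f_*m\ll m$. Let $f^R:\Delta_0\to\Delta_0$ be an aperiodic induced weak Gibbs Markov (WGM) expanding map for $f$ with a coprime block and with $R\in L^1(m)$, and let $\mu$ be the unique ergodic $f$-invariant probability measure such that $\mu\ll m$ and $\mu(\Delta_0)>0$. Below, observables $\varphi$ are bounded and measurable, and the estimates hold for all integers $n\ge1$. (1) Suppose $m\{R>n\}\le Cn^{-a}$ for some $C>0$ and $a>1$. Given $\kappa>0$ there is $0<\zeta<1$ such that for all $\epsilon>0$ and all $\varphi\in(R4,\tau)$ with $\frac2\zeta<\tau\ne\frac{a+1}\zeta$ and $\mathcal R_\infty(\varphi)<\kappa$, there is some $C'=C'(\epsilon,\varphi)>0$ such that $$LD_\mu(\varphi,\epsilon,n)\le C'\max\{n^{-a+1},n^{2-\zeta\tau}\}.$$ (2) Suppose $m\{R>n\}\le Ce^{-cn}$ for some $C,c>0$. Then: (i) for all $\epsilon>0$ and $\varphi\in(R1,\tau)$ there are $C'=C'(\epsilon,\varphi)>0$ and $c'=c'(c,\varphi,\epsilon,\tau)>0$ such that $LD_\mu(\varphi,\epsilon,n)\le C'e^{-c'n^{1/3}}$; (ii) for all $\epsilon>0$ and $\varphi\in(R2,\tau)$ there is $c'=c'(\varphi,\epsilon)>0$ such that for every $0<\tau'<\tau$ there is $C'>0$ (depending on $\epsilon,\varphi,\tau'$) with $LD_\mu(\varphi,\epsilon,n)\le C'e^{-c'n^{\frac{\tau'}{\tau'+2}}}$;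 (iii) given $\kappa>0$ there is $0<\zeta<1$ such that for all $\epsilon>0$ and all $\varphi\in(R4,\tau)$ with $\tau>\frac1\zeta$ and $\mathcal R_\infty(\varphi)<\kappa$, there is some $C'=C'(\epsilon,\varphi)>0$ such that $LD_\mu(\varphi,\epsilon,n)\le C'n^{1-\zeta\tau}$.
   Context: **WGM maps.** Let $(\Delta_0,\mathcal A,m)$ be a finite measure space with $m(\Delta_0)>0$, $F:\Delta_0\to\Delta_0$ measurable, and $\mathcal P_0$ a finite or countable ($m$ mod 0) partition of $\Delta_0$ into invertibility domains of $F$ ($F$ is a bijection from each $\omega\in\mathcal P_0$ to $F(\omega)$ with measurable inverse). Put $\mathcal P_0^n=\bigvee_{i=0}^{n-1}F^{-i}(\mathcal P_0)$ and $\mathcal P_0^\infty=\bigvee_{i=0}^\infty F^{-i}(\mathcal P_0)$. The map $F$ is a weak Gibbs Markov (WGM) map with respect to $\mathcal P_0$ if: - (Markov) $F$ maps each $\omega\in\mathcal P_0$ bijectively to an ($m$ mod 0) union of elements of $\mathcal P_0$; - (Separability) $(\mathcal P_0^n)_n$ generates $\mathcal A$ ($m$ mod 0) and $\mathcal P_0^\infty$ is the partition into single points; - (Nonsingular) there is a strictly positive measurable function $J_F$ on $\Delta_0$ such that $m(F(A))=\int_A J_F\,dm$ for each (measurable) $A\subset\omega\in\mathcal P_0$; - (Gibbs) there are $C_F>0$ and $0<\beta<1$ such that $\log\frac{J_F(x)}{J_F(y)}\le C_F\beta^{s(F(x),F(y))}$ for all $\omega\in\mathcal P_0$, $x,y\in\omega$,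 where $s(x,y)=\min\{n\ge0: F^n(x),F^n(y)\text{ lie in distinct elements of }\mathcal P_0\}$; - (Long branches) there is $\delta_0>0$ with $m(F(\omega))\ge\delta_0$ for all $\omega\in\mathcal P_0$. **Induced maps.** Let $\Delta_0\subset M$ with $m(\Delta_0)>0$; the restriction of $m$ to $\Delta_0$ is also denoted $m$. $F:\Delta_0\to\Delta_0$ is an induced map for $f$, written $F=f^R$, if there are a countable ($m$ mod 0) partition $\mathcal P_0$ of $\Delta_0$ and a measurable $R:\Delta_0\to\mathbb N$, constant on each element of $\mathcal P_0$, with $F|_\omega=f^{R(\omega)}|_\omega$ for each $\omega\in\mathcal P_0$. It is: - aperiodic if for all $\omega_1,\omega_2\in\mathcal P_0$ there is $k_0\in\mathbb N$ with $m(\omega_1\cap(f^R)^{-n}(\omega_2))>0$ for all $n\ge k_0$; - with a coprime block if there are $N\ge2$ and $\omega_1,\dots,\omega_N\in\mathcal P_0$ with $\gcd\{R(\omega_i)\}_i=1$ and $f^R(\omega_i)\supseteq\omega_1\cup\dots\cup\omega_N$ ($m$ mod 0) for all $i=1,\dots,N$; - expanding (with respect to $d$) if there are $0<\beta<1$ and $C>0$ such that for all $\omega\in\mathcal P_0$ and $x,y\in\omega$: $d(f^R(x),f^R(y))\le C\beta^{s(x,y)}$, and $d(f^j(x),f^j(y))\le C\,d(f^R(x),f^R(y))$ for all $0\le j\le R$. **Observables.** For $\varphi:M\to\mathbb R$ and $\epsilon>0$, $\mathcal R_\epsilon(\varphi)=\sup\{|\varphi(x)-\varphi(y)|:d(x,y)\le\epsilon\}$,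 and $\mathcal R_\infty(\varphi)=\sup_{x,y\in M}|\varphi(x)-\varphi(y)|$. With $\mathcal O$ understood as $\epsilon\to0$: - $(R1,\tau)=\{\varphi:\mathcal R_\epsilon(\varphi)=\mathcal O(\epsilon^\tau)\}$, $\tau\in(0,1)$; - $(R2,\tau)=\{\varphi:\mathcal R_\epsilon(\varphi)=\mathcal O(\exp\{-|\log\epsilon|^\tau\})\}$, $\tau\in(0,1)$; - $(R4,\tau)=\{\varphi:\mathcal R_\epsilon(\varphi)=\mathcal O(|\log\epsilon|^{-\tau})\}$, $\tau>1$. **Large deviation.** For $\epsilon>0$ and an observable $\varphi:M\to\mathbb R$, the large deviation at time $n$ is $$LD_\mu(\varphi,\epsilon,n)=\mu\left(\left|\frac1n\sum_{i=0}^{n-1}\varphi\circ f^i-\int\varphi\,d\mu\right|>\epsilon\right).$$ *)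

theory Defs
  imports "HOL-Probability.Probability"
begin

text \<open>A partition mod 0: the members are genuinely disjoint, but they may miss a null set.\<close>

definition mod0_partition :: "'a measure \<Rightarrow> 'a set set \<Rightarrow> bool" where
  "mod0_partition N P \<longleftrightarrow>
     countable P \<and> P \<subseteq> sets N \<and> disjoint P \<and> space N - \<Union>P \<in> null_sets N"

text \<open>
  The join of the partitions \<open>F\<^sup>-\<^sup>i(P)\<close>, \<open>i \<in> I\<close>. The finite joins are obtained with
  \<open>I = {..<n}\<close> and the infinite one with \<open>I = UNIV\<close>.
\<close>

definition join_partition ::
    "'a measure \<Rightarrow> ('a \<Rightarrow> 'a) \<Rightarrow> 'a set set \<Rightarrow> nat set \<Rightarrow> 'a set set" where
  "join_partition N F P I =
     {\<xi>. \<exists>\<omega>. (\<forall>i\<in>I. \<omega> i \<in> P) \<and> \<xi> = {x \<in> space N. \<forall>i\<in>I. (F ^^ i) x \<in> \<omega> i} \<and> \<xi> \<noteq> {}}"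

definition separation_time :: "('a \<Rightarrow> 'a) \<Rightarrow> 'a set set \<Rightarrow> 'a \<Rightarrow> 'a \<Rightarrow> enat" where
  "separation_time F P x y =
     Inf (enat ` {n. \<exists>\<omega>\<^sub>1\<in>P. \<exists>\<omega>\<^sub>2\<in>P. \<omega>\<^sub>1 \<noteq> \<omega>\<^sub>2 \<and> (F ^^ n) x \<in> \<omega>\<^sub>1 \<and> (F ^^ n) y \<in> \<omega>\<^sub>2})"

text \<open>
  The separation time of two points that are never separated is \<open>\<infinity>\<close> (infimum of the empty set);
  correspondingly \<open>\<beta>\<close> to the power \<open>\<infinity>\<close> is 0. A point of the null set missed by \<open>P\<close> lies in no
  member, so it is not separated from anything at time 0.
\<close>

definition enat_power :: "real \<Rightarrow> enat \<Rightarrow> real" where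
  "enat_power \<beta> s = (case s of enat n \<Rightarrow> \<beta> ^ n | \<infinity> \<Rightarrow> 0)"

definition invertibility_domain :: "'a measure \<Rightarrow> ('a \<Rightarrow> 'a) \<Rightarrow> 'a set \<Rightarrow> bool" where
  "invertibility_domain N F \<omega> \<longleftrightarrow>
     inj_on F \<omega> \<and> F ` \<omega> \<in> sets N \<and>
     the_inv_into \<omega> F \<in> restrict_space N (F ` \<omega>) \<rightarrow>\<^sub>M restrict_space N \<omega>"

text \<open>
  The measure space \<open>N\<close> is \<open>\<Delta>\<^sub>0\<close> with its \<open>\<sigma>\<close>-algebra and measure. Injectivity on the members
  of \<open>P\<close>, which is part of the Markov property, is contained in \<open>invertible\<close>.
\<close>

locale WGM_map = finite_measure N
  for N :: "'a measure" and F :: "'a \<Rightarrow> 'a" and P :: "'a set set" +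
  assumes space_pos: "emeasure N (space N) > 0"
    and F_measurable: "F \<in> N \<rightarrow>\<^sub>M N"
    and partition: "mod0_partition N P"
    and invertible: "\<And>\<omega>. \<omega> \<in> P \<Longrightarrow> invertibility_domain N F \<omega>"
    and Markov: "\<And>\<omega>. \<omega> \<in> P \<Longrightarrow>
      \<exists>Q\<subseteq>P. sym_diff (F ` \<omega>) (\<Union>Q) \<in> null_sets N"
    and generating: "\<And>A. A \<in> sets N \<Longrightarrow>
      \<exists>B \<in> sigma_sets (space N) (\<Union>n. join_partition N F P {..<n}).
        sym_diff A B \<in> null_sets N"
    and single_points: "\<And>\<xi>. \<xi> \<in> join_partition N F P UNIV \<Longrightarrow> is_singleton \<xi>"
    and nonsingular_Gibbs: "\<exists>J.
      J \<in> borel_measurable N \<and> (\<forall>x\<in>space N. J x > (0::real)) \<and>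
      (\<forall>\<omega>\<in>P. \<forall>A\<in>sets N. A \<subseteq> \<omega> \<longrightarrow>
        emeasure N (F ` A) = (\<integral>\<^sup>+x\<in>A. ennreal (J x) \<partial>N)) \<and>
      (\<exists>C \<beta>. C > 0 \<and> 0 < \<beta> \<and> \<beta> < 1 \<and>
        (\<forall>\<omega>\<in>P. \<forall>x\<in>\<omega>. \<forall>y\<in>\<omega>.
          ln (J x / J y) \<le> C * enat_power \<beta> (separation_time F P (F x) (F y))))"
    and long_branches: "\<exists>\<delta>>0. \<forall>\<omega>\<in>P. measure N (F ` \<omega>) \<ge> \<delta>"

definition induced_map :: "'a measure \<Rightarrow> ('a \<Rightarrow> 'a) \<Rightarrow> 'a set \<Rightarrow>
    ('a \<Rightarrow> nat) \<Rightarrow> ('a \<Rightarrow> 'a) \<Rightarrow> 'a set set \<Rightarrow> bool" where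
  "induced_map m f \<Delta> R F P \<longleftrightarrow>
     \<Delta> \<in> sets m \<and> emeasure m \<Delta> > 0 \<and>
     F \<in> \<Delta> \<rightarrow> \<Delta> \<and>
     mod0_partition (restrict_space m \<Delta>) P \<and>
     R \<in> restrict_space m \<Delta> \<rightarrow>\<^sub>M count_space UNIV \<and>
     (\<forall>\<omega>\<in>P. R constant_on \<omega> \<and> (\<forall>x\<in>\<omega>. F x = (f ^^ R x) x))"

definition aperiodic :: "'a measure \<Rightarrow> ('a \<Rightarrow> 'a) \<Rightarrow> 'a set set \<Rightarrow> bool" where
  "aperiodic m F P \<longleftrightarrow>
     (\<forall>\<omega>\<^sub>1\<in>P. \<forall>\<omega>\<^sub>2\<in>P. \<exists>k\<^sub>0. \<forall>n\<ge>k\<^sub>0. emeasure m (\<omega>\<^sub>1 \<inter> (F ^^ n) -` \<omega>\<^sub>2) > 0)"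

text \<open>
  The block is represented by the set \<open>Q\<close> of its members \<open>\<omega>\<^sub>1, \<dots>, \<omega>\<^sub>N\<close>, so \<open>N = card Q\<close>. As \<open>R\<close> is constant on
  each member, its image on the union consists of the values \<open>R(\<omega>\<^sub>i)\<close>.
\<close>

definition coprime_block ::
    "'a measure \<Rightarrow> ('a \<Rightarrow> nat) \<Rightarrow> ('a \<Rightarrow> 'a) \<Rightarrow> 'a set set \<Rightarrow> bool" where
  "coprime_block m R F P \<longleftrightarrow>
     (\<exists>Q\<subseteq>P. finite Q \<and> card Q \<ge> 2 \<and> Gcd (R ` \<Union>Q) = 1 \<and>
        (\<forall>\<omega>\<in>Q. \<Union>Q - F ` \<omega> \<in> null_sets m))"

definition expanding :: "('a \<Rightarrow> 'a \<Rightarrow> real) \<Rightarrow> ('a \<Rightarrow> 'a) \<Rightarrow>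
    ('a \<Rightarrow> nat) \<Rightarrow> ('a \<Rightarrow> 'a) \<Rightarrow> 'a set set \<Rightarrow> bool" where
  "expanding d f R F P \<longleftrightarrow>
     (\<exists>C \<beta>. C > 0 \<and> 0 < \<beta> \<and> \<beta> < 1 \<and>
        (\<forall>\<omega>\<in>P. \<forall>x\<in>\<omega>. \<forall>y\<in>\<omega>.
           d (F x) (F y) \<le> C * enat_power \<beta> (separation_time F P x y) \<and>
           (\<forall>j\<le>R x. d ((f ^^ j) x) ((f ^^ j) y) \<le> C * d (F x) (F y))))"

definition ergodic_invariant_prob :: "('a \<Rightarrow> 'a) \<Rightarrow> 'a measure \<Rightarrow> bool" where
  "ergodic_invariant_prob f \<mu> \<longleftrightarrow>
     prob_space \<mu> \<and> f \<in> \<mu> \<rightarrow>\<^sub>M \<mu> \<and> distr \<mu> \<mu> f = \<mu> \<and>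
     (\<forall>A\<in>sets \<mu>. f -` A \<inter> space \<mu> = A \<longrightarrow> measure \<mu> A = 0 \<or> measure \<mu> A = 1)"

definition observables :: "'a measure \<Rightarrow> ('a \<Rightarrow> real) set" where
  "observables m = {\<phi>. \<phi> \<in> borel_measurable m \<and> bounded (\<phi> ` space m)}"

text \<open>
  Moduli of continuity. The real-valued suprema are meaningful for the bounded functions to which
  they are applied.
\<close>

definition osc :: "'a set \<Rightarrow> ('a \<Rightarrow> 'a \<Rightarrow> real) \<Rightarrow> ('a \<Rightarrow> real) \<Rightarrow> real \<Rightarrow> real" where
  "osc X d \<phi> \<epsilon> = Sup {\<bar>\<phi> x - \<phi> y\<bar> | x y. x \<in> X \<and> y \<in> X \<and> d x y \<le> \<epsilon>}"

definition osc_infty :: "'a set \<Rightarrow> ('a \<Rightarrow> real) \<Rightarrow> real" where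
  "osc_infty X \<phi> = Sup {\<bar>\<phi> x - \<phi> y\<bar> | x y. x \<in> X \<and> y \<in> X}"

definition class_R1 :: "'a measure \<Rightarrow> ('a \<Rightarrow> 'a \<Rightarrow> real) \<Rightarrow> real \<Rightarrow> ('a \<Rightarrow> real) set" where
  "class_R1 m d \<tau> = {\<phi> \<in> observables m.
     osc (space m) d \<phi> \<in> O[at_right 0](\<lambda>\<epsilon>. \<epsilon> powr \<tau>)}"

definition class_R2 :: "'a measure \<Rightarrow> ('a \<Rightarrow> 'a \<Rightarrow> real) \<Rightarrow> real \<Rightarrow> ('a \<Rightarrow> real) set" where
  "class_R2 m d \<tau> = {\<phi> \<in> observables m.
     osc (space m) d \<phi> \<in> O[at_right 0](\<lambda>\<epsilon>. exp (- (\<bar>ln \<epsilon>\<bar> powr \<tau>)))}"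

definition class_R4 :: "'a measure \<Rightarrow> ('a \<Rightarrow> 'a \<Rightarrow> real) \<Rightarrow> real \<Rightarrow> ('a \<Rightarrow> real) set" where
  "class_R4 m d \<tau> = {\<phi> \<in> observables m.
     osc (space m) d \<phi> \<in> O[at_right 0](\<lambda>\<epsilon>. \<bar>ln \<epsilon>\<bar> powr (- \<tau>))}"

definition large_deviation ::
    "'a measure \<Rightarrow> ('a \<Rightarrow> 'a) \<Rightarrow> ('a \<Rightarrow> real) \<Rightarrow> real \<Rightarrow> nat \<Rightarrow> real" where
  "large_deviation \<mu> f \<phi> \<epsilon> n =
     measure \<mu> {x \<in> space \<mu>.
       \<bar>(1 / real n) * (\<Sum>i<n. \<phi> ((f ^^ i) x)) - (\<integral>x. \<phi> x \<partial>\<mu>)\<bar> > \<epsilon>}"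

end

theory Submission
  imports Defs "HOL-Real_Asymp.Real_Asymp"
begin

text \<open>
  Since \<open>\<epsilon>\<close> is fixed, only the uniform continuity of the observable matters: up to a small multiple
  of \<open>R\<close>, its sum \<open>\<Phi>\<close> over an excursion from \<open>\<Delta>\<close> is constant on long cylinders of the induced map
  \<open>F\<close>. Polynomial tails then give the rate \<open>n\<^sup>1\<^sup>-\<^sup>a\<close> and exponential tails a rate \<open>exp (- c' \<surd>n)\<close>, both
  stronger than required, and \<open>\<zeta> = 1/2\<close> always works.

  Bounded distortion and long branches bound the law of \<open>F\<^sup>n x\<close>, conditioned on any cylinder of length
  \<open>n\<close>, by a constant multiple of \<open>m\<close>. By the ergodic theorem the positive part of a sum of \<open>\<Phi>\<close> over a long
  block of \<open>l\<close> returns has integral \<open>o(l)\<close>, hence also small conditional integral given the past; so the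
  exponential moments of successive blocks, with \<open>R\<close> truncated at a level \<open>T\<close>, multiply up to factors
  close to 1, and Markov's inequality applies. The truncation costs \<open>n m(R > T)\<close>. Finally, \<open>F\<close> is ergodic for
  \<open>m\<close>, so up to normalisation \<open>\<mu>\<close> is the limit of averages of \<open>m\<close> along \<open>f\<close>-orbits starting in \<open>\<Delta>\<close>, which makes \<open>\<mu>(A)\<close> at
  most a constant times \<open>\<Sum>\<^sub>l m(R > l, f\<^sup>l \<in> A)\<close>.
\<close>

section \<open>Cylinders and distortion of weak Gibbs Markov maps\<close>

text \<open>Quasi-independence holds only up to a constant \<open>K\<close>. Paying \<open>K\<close>
  once per block would give a factor \<open>K^(n/l)\<close>, which cannot be beaten when
  \<open>\<theta>\<close> tends to 0, as it does here. So each block factor is bounded by 1 plus a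
  small function, and only the small part is charged with \<open>K\<close>. This is why the positive
  part of a block sum has to be integrated, and why the block length is fixed after
  \<open>K\<close>, at the mean level \<open>\<epsilon> / (4 K)\<close>. A further obstacle is that
  quasi-independence asks for a past that is exactly constant on cylinders, which sums over
  excursions are not; they are replaced by a majorant that is. On \<Delta> a \<mu>-null set could a
  priori carry \<open>m\<close>-mass. Neither an invariant density of \<open>F\<close> nor a rate of
  mixing is constructed; ergodicity of \<open>F\<close> for \<open>m\<close> carries over the one
  fact needed, that sums of a function of negative \<mu>-mean stay bounded above. Finally,
  exponential moments of \<open>R\<close> may be infinite, which forces the truncation;
  \<open>T\<close> and \<open>\<theta>\<close> stay free in one master bound and are tuned to the
  tail of \<open>R\<close> only at the end.\<close>

context WGM_map
begin

definition cylinder :: "nat \<Rightarrow> (nat \<Rightarrow> 'a set) \<Rightarrow> 'a set" where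
  "cylinder n w = {x \<in> space N. \<forall>i<n. (F ^^ i) x \<in> w i}"

lemma P_sets: "\<omega> \<in> P \<Longrightarrow> \<omega> \<in> sets N"
  and P_countable: "countable P"
  and P_covers: "AE x in N. x \<in> \<Union>P"
proof -
  show "\<omega> \<in> P \<Longrightarrow> \<omega> \<in> sets N" "countable P"
    using partition by (auto simp: mod0_partition_def)
  have "space N - \<Union>P \<in> null_sets N"
    using partition by (auto simp: mod0_partition_def)
  then show "AE x in N. x \<in> \<Union>P"
    by (rule AE_I') auto
qed

lemma P_unique: "\<omega> \<in> P \<Longrightarrow> \<omega>' \<in> P \<Longrightarrow> x \<in> \<omega> \<Longrightarrow> x \<in> \<omega>' \<Longrightarrow> \<omega> = \<omega>'"
  using partition by (auto simp: mod0_partition_def disjoint_def)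

lemma P_Union_sets: "\<Union>P \<in> sets N"
  using P_sets P_countable by (auto intro: sets.countable_Union)

lemma P_subset_space: "\<omega> \<in> P \<Longrightarrow> \<omega> \<subseteq> space N"
  using P_sets sets.sets_into_space by blast

lemma funpow_measurable [measurable]: "(F ^^ n) \<in> N \<rightarrow>\<^sub>M N"
  by (induction n) (auto intro: measurable_compose F_measurable)

declare F_measurable [measurable]

lemma funpow_space: "x \<in> space N \<Longrightarrow> (F ^^ n) x \<in> space N"
  using measurable_space[OF funpow_measurable] .

lemma F_space: "x \<in> space N \<Longrightarrow> F x \<in> space N"
  using measurable_space[OF F_measurable] .

lemma image_sets: "\<omega> \<in> P \<Longrightarrow> F ` \<omega> \<in> sets N"
  using invertible by (auto simp: invertibility_domain_def)

lemma cylinder_sets: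
  assumes "\<And>i. i < n \<Longrightarrow> w i \<in> P"
  shows "cylinder n w \<in> sets N"
proof -
  have "cylinder n w = space N \<inter> (\<Inter>i\<in>{..<n}. (F ^^ i) -` w i \<inter> space N)"
    by (auto simp: cylinder_def)
  also have "\<dots> \<in> sets N"
  proof (cases "n = 0")
    case False
    then show ?thesis
      using P_sets[OF assms] by (auto intro!: sets.Int sets.finite_INT measurable_sets[OF funpow_measurable])
  qed auto
  finally show ?thesis .
qed

lemma cylinder_0: "cylinder 0 w = space N"
  by (simp add: cylinder_def)

lemma cylinder_Suc:
  assumes "w 0 \<in> P"
  shows "cylinder (Suc n) w = {x \<in> w 0. F x \<in> cylinder n (\<lambda>i. w (Suc i))}"
  using P_subset_space[OF assms] F_space
  by (auto simp: cylinder_def All_less_Suc2 funpow_swap1)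

text \<open>By the Markov property the image is a union of members up to a null set, and a member
  outside that union meets it in a null set only. Positive intersections thus become inclusions,
  which is how images of cylinders are computed.\<close>

lemma image_contains:
  assumes "\<omega> \<in> P" "\<omega>' \<in> P" "emeasure N (F ` \<omega> \<inter> \<omega>') \<noteq> 0"
  shows "AE x in N. x \<in> \<omega>' \<longrightarrow> x \<in> F ` \<omega>"
proof -
  obtain Q where Q: "Q \<subseteq> P" "sym_diff (F ` \<omega>) (\<Union>Q) \<in> null_sets N"
    using Markov[OF assms(1)] by blast
  have "\<omega>' \<in> Q"
  proof (rule ccontr)
    assume "\<omega>' \<notin> Q"
    then have "F ` \<omega> \<inter> \<omega>' \<subseteq> sym_diff (F ` \<omega>) (\<Union>Q)"
      using P_unique assms(2) Q(1) by blast
    then have "F ` \<omega> \<inter> \<omega>' \<in> null_sets N"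
      using Q(2) image_sets[OF assms(1)] P_sets[OF assms(2)] by (metis null_sets_subset sets.Int)
    then show False using assms(3) by auto
  qed
  then show ?thesis
    by (intro AE_I'[OF Q(2)]) auto
qed

text \<open>Countably many disjoint cylinders of length \<open>n\<close> cover almost every point,
  so both integrals are sums over them and may be compared term by term.\<close>

lemma nn_integral_cylinders_mono:
  assumes [measurable]: "u \<in> borel_measurable N" "v \<in> borel_measurable N"
    and cover: "AE x in N. \<forall>i. (F ^^ i) x \<in> \<Union>P"
    and le: "\<And>w. (\<And>i. i < n \<Longrightarrow> w i \<in> P) \<Longrightarrow>
      (\<integral>\<^sup>+x. u x * indicator (cylinder n w) x \<partial>N) \<le> (\<integral>\<^sup>+x. v x * indicator (cylinder n w) x \<partial>N)"
  shows "(\<integral>\<^sup>+x. u x \<partial>N) \<le> (\<integral>\<^sup>+x. v x \<partial>N)"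
proof -
  \<comment> \<open>Words are made extensional beyond \<open>n\<close>; otherwise words that differ
    only after time \<open>n\<close> would index the same cylinder and the family would not be
    disjoint.\<close>
  define I where "I = PiE {..<n} (\<lambda>_. P)"
  have I: "countable I" unfolding I_def by (intro countable_PiE) (auto simp: P_countable)
  have wP: "w i \<in> P" if "w \<in> I" "i < n" for w i using that by (auto simp: I_def PiE_iff)
  have cs: "cylinder n w \<in> sets N" if "w \<in> I" for w using cylinder_sets wP[OF that] by blast
  have disj: "disjoint_family_on (cylinder n) I"
    unfolding disjoint_family_on_def
  proof safe
    fix w w' x assume *: "w \<in> I" "w' \<in> I" "w \<noteq> w'" "x \<in> cylinder n w" "x \<in> cylinder n w'"
    then obtain i where "i < n" "w i \<noteq> w' i" unfolding I_def by (metis PiE_ext lessThan_iff)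
    then show "x \<in> {}" using * wP P_unique by (metis (mono_tags, lifting) cylinder_def mem_Collect_eq)
  qed
  define U where "U = (\<Union>w\<in>I. cylinder n w)"
  have U: "U \<in> sets N" unfolding U_def using I cs by (intro sets.countable_UN'') auto
  have AEU: "AE x in N. x \<in> U"
    using cover AE_space
  proof eventually_elim
    case (elim x)
    then have "\<forall>i. \<exists>\<omega>. \<omega> \<in> P \<and> (F ^^ i) x \<in> \<omega>" by blast
    then obtain w where w: "\<And>i. w i \<in> P \<and> (F ^^ i) x \<in> w i" by metis
    then have "restrict w {..<n} \<in> I" "x \<in> cylinder n (restrict w {..<n})"
      using elim by (auto simp: I_def cylinder_def)
    then show ?case by (auto simp: U_def)
  qed
  have eq: "(\<integral>\<^sup>+x. g x \<partial>N) = (\<integral>\<^sup>+w. (\<integral>\<^sup>+x. g x * indicator (cylinder n w) x \<partial>N) \<partial>count_space I)"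
    if [measurable]: "g \<in> borel_measurable N" for g
  proof -
    have "(\<integral>\<^sup>+x. g x \<partial>N) = (\<integral>\<^sup>+x. g x * indicator U x \<partial>N)"
      by (rule nn_integral_cong_AE) (use AEU in \<open>eventually_elim, auto\<close>)
    also have "\<dots> = emeasure (density N g) U" using U by (simp add: emeasure_density)
    also have "\<dots> = (\<integral>\<^sup>+w. emeasure (density N g) (cylinder n w) \<partial>count_space I)"
      unfolding U_def by (rule emeasure_UN_countable) (use I cs disj in auto)
    also have "\<dots> = (\<integral>\<^sup>+w. (\<integral>\<^sup>+x. g x * indicator (cylinder n w) x \<partial>N) \<partial>count_space I)"
      by (intro nn_integral_cong) (use cs in \<open>auto simp: emeasure_density\<close>)
    finally show ?thesis .
  qed
  show ?thesis
    unfolding eq[OF assms(1)] eq[OF assms(2)]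
    by (intro nn_integral_mono le) (use wP in auto)
qed

end

section \<open>Change of variables along cylinders\<close>

locale WGM_jacobian = WGM_map +
  fixes J :: "'a \<Rightarrow> real" and C \<beta> \<delta> :: real
  assumes J_measurable [measurable]: "J \<in> borel_measurable N"
    and J_pos: "x \<in> space N \<Longrightarrow> J x > 0"
    and J_image: "\<omega> \<in> P \<Longrightarrow> A \<in> sets N \<Longrightarrow> A \<subseteq> \<omega> \<Longrightarrow>
      emeasure N (F ` A) = (\<integral>\<^sup>+x\<in>A. ennreal (J x) \<partial>N)"
    and C_pos: "C > 0" and \<beta>_pos: "\<beta> > 0" and \<beta>_less_1: "\<beta> < 1"
    and Gibbs: "\<omega> \<in> P \<Longrightarrow> x \<in> \<omega> \<Longrightarrow> y \<in> \<omega> \<Longrightarrow>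
      ln (J x / J y) \<le> C * enat_power \<beta> (separation_time F P (F x) (F y))"
    and \<delta>_pos: "\<delta> > 0" and images_large: "\<omega> \<in> P \<Longrightarrow> \<delta> \<le> measure N (F ` \<omega>)"
begin

text \<open>Two measures are identified: the image under \<open>F\<close> of the measure with
  density \<open>J\<close> on \<omega>, and the restriction to the image of \<omega>. They agree on
  sets because \<open>J_image\<close> holds for every measurable subset of \<omega>.\<close>

lemma change_variables:
  assumes \<omega>: "\<omega> \<in> P" and h [measurable]: "h \<in> borel_measurable N"
  shows "(\<integral>\<^sup>+x. indicator \<omega> x * (ennreal (J x) * h (F x)) \<partial>N) = (\<integral>\<^sup>+x. indicator (F ` \<omega>) x * h x \<partial>N)"
proof -
  note [measurable] = P_sets[OF \<omega>] image_sets[OF \<omega>]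
  let ?D = "density N (\<lambda>x. indicator \<omega> x * ennreal (J x))"
  have "distr ?D N F = density N (indicator (F ` \<omega>))"
  proof (rule measure_eqI)
    fix A assume "A \<in> sets (distr ?D N F)"
    then have [measurable]: "A \<in> sets N" by simp
    have "emeasure (distr ?D N F) A = emeasure ?D (F -` A \<inter> space N)"
      by (simp add: emeasure_distr)
    also have "\<dots> = (\<integral>\<^sup>+x\<in>(\<omega> \<inter> (F -` A \<inter> space N)). ennreal (J x) \<partial>N)"
      by (subst emeasure_density) (auto intro!: nn_integral_cong split: split_indicator)
    also have "\<dots> = emeasure N (F ` (\<omega> \<inter> (F -` A \<inter> space N)))"
      by (rule J_image[OF \<omega>, symmetric]) auto
    also have "F ` (\<omega> \<inter> (F -` A \<inter> space N)) = F ` \<omega> \<inter> A"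
      using P_subset_space[OF \<omega>] by auto
    also have "emeasure N (F ` \<omega> \<inter> A) = emeasure (density N (indicator (F ` \<omega>))) A"
      by (subst emeasure_density) (auto simp: indicator_inter_arith[symmetric])
    finally show "emeasure (distr ?D N F) A = emeasure (density N (indicator (F ` \<omega>))) A" .
  qed auto
  then have "(\<integral>\<^sup>+x. h x \<partial>distr ?D N F) = (\<integral>\<^sup>+x. h x \<partial>density N (indicator (F ` \<omega>)))"
    by simp
  then show ?thesis
    by (simp add: nn_integral_distr nn_integral_density mult.assoc)
qed

text \<open>If Z is null, the integral of \<open>J\<close> over the part of a member that is mapped
  into Z is the measure of a subset of Z, hence 0. As \<open>J\<close> is strictly positive, that
  part is null, and there are only countably many members.\<close>

lemma AE_preimage:
  assumes "AE x in N. Q x"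
  shows "AE x in N. Q (F x)"
proof -
  obtain Z where Z: "{x \<in> space N. \<not> Q x} \<subseteq> Z" "emeasure N Z = 0" "Z \<in> sets N"
    using assms by (rule AE_E)
  have "AE x in N. \<forall>\<omega>\<in>P. x \<in> \<omega> \<longrightarrow> F x \<notin> Z"
  proof (subst AE_ball_countable[OF P_countable], safe)
    fix \<omega> assume \<omega>: "\<omega> \<in> P"
    note [measurable] = P_sets[OF \<omega>] image_sets[OF \<omega>] Z(3)
    have "(\<integral>\<^sup>+x. indicator \<omega> x * (ennreal (J x) * indicator Z (F x)) \<partial>N) = (\<integral>\<^sup>+x. indicator (F ` \<omega>) x * indicator Z x \<partial>N)"
      by (rule change_variables[OF \<omega>]) auto
    also have "\<dots> = emeasure N (F ` \<omega> \<inter> Z)" by (simp add: indicator_inter_arith[symmetric])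
    also have "\<dots> = 0"
      using Z(2,3) image_sets[OF \<omega>] by (metis emeasure_mono inf_le2 le_zero_eq)
    finally have "AE x in N. indicator \<omega> x * (ennreal (J x) * indicator Z (F x)) = (0::ennreal)"
      by (subst (asm) nn_integral_0_iff_AE) auto
    then show "AE x in N. x \<in> \<omega> \<longrightarrow> F x \<notin> Z"
      using AE_space
    proof eventually_elim
      case (elim x)
      then show ?case using J_pos[of x] by (auto simp: indicator_def split: if_splits)
    qed
  qed
  then show ?thesis
    using P_covers AE_space
  proof eventually_elim
    case (elim x)
    then show ?case using Z(1) F_space[of x] by blast
  qed
qed

lemma AE_iterates: "AE x in N. Q x \<Longrightarrow> AE x in N. \<forall>i. Q ((F ^^ i) x)"
proof (subst AE_all_countable, intro allI)
  fix i assume "AE x in N. Q x"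
  then show "AE x in N. Q ((F ^^ i) x)"
  proof (induction i)
    case (Suc i)
    then show ?case using AE_preimage[of "\<lambda>x. Q ((F ^^ i) x)"] by (simp add: funpow_swap1)
  qed simp
qed

lemma AE_orbit: "AE x in N. \<forall>i. (F ^^ i) x \<in> \<Union>P"
  by (rule AE_iterates[OF P_covers])

definition Jn :: "nat \<Rightarrow> 'a \<Rightarrow> real" where
  "Jn n x = (\<Prod>i<n. J ((F ^^ i) x))"

lemma Jn_measurable [measurable]: "Jn n \<in> borel_measurable N"
  unfolding Jn_def by measurable

lemma Jn_pos: "x \<in> space N \<Longrightarrow> Jn n x > 0"
  unfolding Jn_def by (intro prod_pos) (auto intro!: J_pos funpow_space)

lemma Jn_Suc: "Jn (Suc n) x = J x * Jn n (F x)"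
  unfolding Jn_def by (subst prod.lessThan_Suc_shift) (simp add: funpow_swap1)

text \<open>The first letter is peeled off. Positive measure makes the word admissible: the image of
  each letter contains the next letter up to a null set, so only the image of the last letter
  survives. For a null cylinder the left-hand side is 0, while that image never is.\<close>

lemma cylinder_change_variables:
  assumes "\<And>i. i \<le> n \<Longrightarrow> w i \<in> P" and "emeasure N (cylinder (Suc n) w) \<noteq> 0"
    and [measurable]: "h \<in> borel_measurable N"
  shows "(\<integral>\<^sup>+x. indicator (cylinder (Suc n) w) x * (ennreal (Jn (Suc n) x) * h ((F ^^ Suc n) x)) \<partial>N)
    = (\<integral>\<^sup>+x. indicator (F ` w n) x * h x \<partial>N)"
  using assms(1,2)
proof (induction n arbitrary: w)
  case 0
  then have "cylinder (Suc 0) w = w 0"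
    using P_subset_space[of "w 0"] by (auto simp: cylinder_def)
  then show ?case using change_variables[of "w 0" h] 0 by (simp add: Jn_def)
next
  case (Suc n)
  define w' where "w' i = w (Suc i)" for i
  have w0: "w 0 \<in> P" "w' 0 \<in> P" using Suc by (auto simp: w'_def)
  have w': "w' i \<in> P" if "i \<le> n" for i using Suc.prems(1) that by (auto simp: w'_def)
  note [measurable] = cylinder_sets[of "Suc n" w', OF w', simplified less_Suc_eq_le]
    P_sets[OF w0(1)] P_sets[OF w0(2)] image_sets[OF w0(1)]
  have cyl: "cylinder (Suc (Suc n)) w = {x \<in> w 0. F x \<in> cylinder (Suc n) w'}"
    using cylinder_Suc[of w "Suc n"] w0 by (simp add: w'_def[abs_def])
  have sub: "cylinder (Suc n) w' \<subseteq> w' 0" by (auto simp: cylinder_def)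
  \<comment> \<open>\<open>F\<close> pulls null sets back to null sets, so a null shifted cylinder
    would make the original one null; hence the induction hypothesis applies.\<close>
  have ncyl: "emeasure N (cylinder (Suc n) w') \<noteq> 0"
  proof
    assume "emeasure N (cylinder (Suc n) w') = 0"
    then have "AE x in N. x \<notin> cylinder (Suc n) w'" by (intro AE_not_in) auto
    then have "AE x in N. x \<notin> cylinder (Suc (Suc n)) w"
      using AE_preimage[of "\<lambda>x. x \<notin> cylinder (Suc n) w'"] unfolding cyl by auto
    then show False
      using Suc.prems cylinder_sets[of "Suc (Suc n)" w] by (simp add: AE_iff_null_sets[symmetric] null_sets_def less_Suc_eq_le)
  qed
  have "emeasure N (F ` w 0 \<inter> w' 0) \<noteq> 0"
  proof
    assume "emeasure N (F ` w 0 \<inter> w' 0) = 0"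
    then have "AE x in N. x \<notin> F ` w 0 \<inter> w' 0" by (intro AE_not_in) auto
    then have "AE x in N. F x \<notin> F ` w 0 \<inter> w' 0" by (rule AE_preimage)
    then have "AE x in N. x \<notin> cylinder (Suc (Suc n)) w"
      unfolding cyl using sub by auto
    then show False
      using Suc.prems cylinder_sets[of "Suc (Suc n)" w] by (simp add: AE_iff_null_sets[symmetric] null_sets_def less_Suc_eq_le)
  qed
  then have AEsub: "AE x in N. x \<in> w' 0 \<longrightarrow> x \<in> F ` w 0"
    using image_contains[OF w0] by simp
  have "(\<integral>\<^sup>+x. indicator (cylinder (Suc (Suc n)) w) x * (ennreal (Jn (Suc (Suc n)) x) * h ((F ^^ Suc (Suc n)) x)) \<partial>N)
    = (\<integral>\<^sup>+x. indicator (w 0) x * (ennreal (J x) * (indicator (cylinder (Suc n) w') (F x) * (ennreal (Jn (Suc n) (F x)) * h ((F ^^ Suc n) (F x))))) \<partial>N)"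
  proof (intro nn_integral_cong)
    fix x assume "x \<in> space N"
    then show "indicator (cylinder (Suc (Suc n)) w) x * (ennreal (Jn (Suc (Suc n)) x) * h ((F ^^ Suc (Suc n)) x))
      = indicator (w 0) x * (ennreal (J x) * (indicator (cylinder (Suc n) w') (F x) * (ennreal (Jn (Suc n) (F x)) * h ((F ^^ Suc n) (F x)))))"
      unfolding cyl using ennreal_mult[OF less_imp_le[OF J_pos] less_imp_le[OF Jn_pos[OF F_space]], of x x "Suc n"]
      by (subst Jn_Suc) (auto simp: indicator_def funpow_swap1 mult.assoc)
  qed
  also have "\<dots> = (\<integral>\<^sup>+x. indicator (F ` w 0) x * (indicator (cylinder (Suc n) w') x * (ennreal (Jn (Suc n) x) * h ((F ^^ Suc n) x))) \<partial>N)"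
    by (rule change_variables[OF w0(1)]) measurable
  also have "\<dots> = (\<integral>\<^sup>+x. indicator (cylinder (Suc n) w') x * (ennreal (Jn (Suc n) x) * h ((F ^^ Suc n) x)) \<partial>N)"
    by (rule nn_integral_cong_AE) (use AEsub in \<open>eventually_elim, use sub in \<open>auto simp: indicator_def\<close>\<close>)
  also have "\<dots> = (\<integral>\<^sup>+x. indicator (F ` w' n) x * h x \<partial>N)"
    by (rule Suc.IH[OF w' ncyl])
  finally show ?case by (simp add: w'_def)
qed

end

section \<open>Separation times and bounded distortion\<close>

lemma enat_power_le:
  assumes "0 < \<beta>" "\<beta> < 1" "enat k \<le> s"
  shows "enat_power \<beta> s \<le> \<beta> ^ k"
  using assms by (cases s) (auto simp: enat_power_def intro!: power_decreasing)

context WGM_map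
begin

text \<open>Each point lies in at most one member, so common letters at the times from
  \<open>i\<close> to \<open>n - 1\<close> rule out a separation during the first
  \<open>n - i\<close> steps.\<close>

lemma separation_time_cylinder:
  assumes w: "\<And>i. i < n \<Longrightarrow> w i \<in> P" and xy: "x \<in> cylinder n w" "y \<in> cylinder n w" and "i \<le> n"
  shows "enat (n - i) \<le> separation_time F P ((F ^^ i) x) ((F ^^ i) y)"
  unfolding separation_time_def
proof (rule Inf_greatest)
  fix s assume "s \<in> enat ` {k. \<exists>\<omega>\<^sub>1\<in>P. \<exists>\<omega>\<^sub>2\<in>P. \<omega>\<^sub>1 \<noteq> \<omega>\<^sub>2 \<and> (F ^^ k) ((F ^^ i) x) \<in> \<omega>\<^sub>1 \<and> (F ^^ k) ((F ^^ i) y) \<in> \<omega>\<^sub>2}"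
  then obtain k \<omega>\<^sub>1 \<omega>\<^sub>2 where k: "s = enat k" "\<omega>\<^sub>1 \<in> P" "\<omega>\<^sub>2 \<in> P" "\<omega>\<^sub>1 \<noteq> \<omega>\<^sub>2"
    "(F ^^ (k + i)) x \<in> \<omega>\<^sub>1" "(F ^^ (k + i)) y \<in> \<omega>\<^sub>2"
    by (auto simp: funpow_add)
  have "n \<le> k + i"
  proof (rule ccontr)
    assume "\<not> n \<le> k + i"
    then have "(F ^^ (k + i)) x \<in> w (k + i)" "(F ^^ (k + i)) y \<in> w (k + i)" "w (k + i) \<in> P"
      using xy w by (auto simp: cylinder_def)
    then show False using k P_unique by metis
  qed
  then show "enat (n - i) \<le> s" using k(1) by simp
qed

end

context WGM_jacobian
begin

definition distortion :: real where "distortion = exp (C / (1 - \<beta>))"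

lemma distortion_pos: "distortion > 0" by (simp add: distortion_def)

text \<open>At step \<open>i\<close> the images under \<open>F\<close> still share
  \<open>n - i - 1\<close> letters. The logarithms of the quotients of \<open>J\<close> therefore
  add up to at most C (1 + \<beta> + \<beta>^2 + ...) = C / (1 - \<beta>), whatever the length of
  the cylinder.\<close>

lemma Jn_distortion:
  assumes w: "\<And>i. i < n \<Longrightarrow> w i \<in> P" and xy: "x \<in> cylinder n w" "y \<in> cylinder n w"
  shows "Jn n x \<le> distortion * Jn n y"
proof -
  have sp: "(F ^^ i) x \<in> space N" "(F ^^ i) y \<in> space N" for i
    using xy funpow_space by (auto simp: cylinder_def)
  have one: "J ((F ^^ i) x) \<le> exp (C * \<beta> ^ (n - Suc i)) * J ((F ^^ i) y)" if "i < n" for i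
  proof -
    have "ln (J ((F ^^ i) x) / J ((F ^^ i) y)) \<le> C * enat_power \<beta> (separation_time F P (F ((F ^^ i) x)) (F ((F ^^ i) y)))"
      using xy that by (intro Gibbs[OF w[OF that]]) (auto simp: cylinder_def)
    also have "\<dots> \<le> C * \<beta> ^ (n - Suc i)"
      using separation_time_cylinder[OF w xy, of "Suc i"] that C_pos \<beta>_pos \<beta>_less_1
      by (intro mult_left_mono enat_power_le) auto
    finally have "J ((F ^^ i) x) / J ((F ^^ i) y) \<le> exp (C * \<beta> ^ (n - Suc i))"
      using J_pos[OF sp(1)] J_pos[OF sp(2)] by (simp add: ln_le_cancel_iff ln_ge_iff[symmetric] flip: ln_le_cancel_iff[of _ "exp _"])
    then show ?thesis using J_pos[OF sp(2)] by (simp add: field_simps)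
  qed
  have "Jn n x \<le> (\<Prod>i<n. exp (C * \<beta> ^ (n - Suc i)) * J ((F ^^ i) y))"
    unfolding Jn_def using one J_pos[OF sp(1)] by (intro prod_mono) (auto intro: less_imp_le)
  also have "\<dots> = exp (\<Sum>i<n. C * \<beta> ^ (n - Suc i)) * Jn n y"
    by (simp add: prod.distrib exp_sum Jn_def)
  also have "(\<Sum>i<n. C * \<beta> ^ (n - Suc i)) = C * (\<Sum>i<n. \<beta> ^ i)"
    by (simp add: sum_distrib_left sum.nat_diff_reindex[of "\<lambda>i. C * \<beta> ^ i"])
  also have "\<dots> \<le> C * (1 / (1 - \<beta>))"
    using C_pos \<beta>_pos \<beta>_less_1 by (intro mult_left_mono) (auto simp: sum_gp_strict divide_right_mono)
  finally show ?thesis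
    using Jn_pos xy by (auto simp: distortion_def cylinder_def intro: less_imp_le)
qed

text \<open>On the cylinder, \<open>Jn\<close> is within a factor \<open>distortion\<close> of its
  value \<open>a\<close> at a chosen point. Long branches give
  \<open>\<delta> \<le> distortion * a * m(cylinder)\<close> and so bound \<open>1 / a\<close>. One
  factor \<open>distortion\<close> comes from this, the other from replacing \<open>Jn\<close> by
  \<open>a\<close> in the change of variables.\<close>

lemma cylinder_upper_bound:
  assumes w: "\<And>i. i \<le> n \<Longrightarrow> w i \<in> P" and [measurable]: "h \<in> borel_measurable N"
  shows "(\<integral>\<^sup>+x. h ((F ^^ Suc n) x) * indicator (cylinder (Suc n) w) x \<partial>N)
    \<le> ennreal (distortion\<^sup>2 / \<delta>) * emeasure N (cylinder (Suc n) w) * (\<integral>\<^sup>+x. h x \<partial>N)"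
proof (cases "emeasure N (cylinder (Suc n) w) = 0")
  case True
  note [measurable] = cylinder_sets[of "Suc n" w, OF w, simplified less_Suc_eq_le]
  have "AE x in N. x \<notin> cylinder (Suc n) w" by (intro AE_not_in) (use True in auto)
  then have "(\<integral>\<^sup>+x. h ((F ^^ Suc n) x) * indicator (cylinder (Suc n) w) x \<partial>N) = 0"
    by (subst nn_integral_0_iff_AE) auto
  then show ?thesis by simp
next
  case False
  let ?c = "cylinder (Suc n) w"
  note [measurable] = cylinder_sets[of "Suc n" w, OF w, simplified less_Suc_eq_le] image_sets[OF w[OF order_refl]]
  obtain x0 where x0: "x0 \<in> ?c" using False by fastforce
  define a where "a = Jn (Suc n) x0"
  have a: "a > 0" using x0 unfolding a_def by (intro Jn_pos) (auto simp: cylinder_def)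
  have D: "Jn (Suc n) x \<le> distortion * Jn (Suc n) y" if "x \<in> ?c" "y \<in> ?c" for x y
    using that w by (intro Jn_distortion[of "Suc n" w]) auto
  have "ennreal \<delta> \<le> emeasure N (F ` w n)"
    using images_large[OF w[of n]] by (simp add: emeasure_eq_measure)
  also have "\<dots> = (\<integral>\<^sup>+x. indicator ?c x * (ennreal (Jn (Suc n) x) * 1) \<partial>N)"
    by (subst cylinder_change_variables[OF w False]) auto
  also have "\<dots> \<le> (\<integral>\<^sup>+x. ennreal (distortion * a) * indicator ?c x \<partial>N)"
    using D[OF _ x0] by (intro nn_integral_mono) (auto simp: a_def indicator_def intro!: ennreal_leI)
  also have "\<dots> = ennreal (distortion * a * measure N ?c)"
    using a distortion_pos by (simp add: nn_integral_cmult emeasure_eq_measure ennreal_mult)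
  finally have \<delta>_le: "\<delta> \<le> distortion * a * measure N ?c"
    using a distortion_pos by (subst (asm) ennreal_le_iff) auto
  have "(\<integral>\<^sup>+x. h ((F ^^ Suc n) x) * indicator ?c x \<partial>N)
     \<le> (\<integral>\<^sup>+x. ennreal (distortion / a) * (indicator ?c x * (ennreal (Jn (Suc n) x) * h ((F ^^ Suc n) x))) \<partial>N)"
  proof (intro nn_integral_mono)
    fix x assume "x \<in> space N"
    show "h ((F ^^ Suc n) x) * indicator ?c x \<le> ennreal (distortion / a) * (indicator ?c x * (ennreal (Jn (Suc n) x) * h ((F ^^ Suc n) x)))"
    proof (cases "x \<in> ?c")
      case True
      have "1 \<le> distortion / a * Jn (Suc n) x"
        using D[OF x0 True] a by (simp add: a_def field_simps)
      then have "ennreal 1 \<le> ennreal (distortion / a * Jn (Suc n) x)" by (intro ennreal_leI)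
      then have "1 * h ((F ^^ Suc n) x) \<le> ennreal (distortion / a * Jn (Suc n) x) * h ((F ^^ Suc n) x)"
        by (intro mult_right_mono) auto
      also have "ennreal (distortion / a * Jn (Suc n) x) = ennreal (distortion / a) * ennreal (Jn (Suc n) x)"
        using a distortion_pos by (intro ennreal_mult') auto
      finally show ?thesis using True by (simp add: mult.assoc)
    qed simp
  qed
  also have "\<dots> = ennreal (distortion / a) * (\<integral>\<^sup>+x. indicator (F ` w n) x * h x \<partial>N)"
    by (subst cylinder_change_variables[OF w False, symmetric]) (auto intro!: nn_integral_cmult)
  also have "\<dots> \<le> ennreal (distortion\<^sup>2 / \<delta> * measure N ?c) * (\<integral>\<^sup>+x. h x \<partial>N)"
  proof (intro mult_mono ennreal_leI nn_integral_mono)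
    have "distortion * \<delta> \<le> distortion * (distortion * a * measure N ?c)"
      using \<delta>_le distortion_pos by (intro mult_left_mono) auto
    then show "distortion / a \<le> distortion\<^sup>2 / \<delta> * measure N ?c"
      using a \<delta>_pos by (simp add: field_simps power2_eq_square)
  qed (auto simp: indicator_def)
  also have "\<dots> = ennreal (distortion\<^sup>2 / \<delta>) * emeasure N ?c * (\<integral>\<^sup>+x. h x \<partial>N)"
    using \<delta>_pos ennreal_mult[of "distortion\<^sup>2 / \<delta>" "measure N ?c"] by (simp add: emeasure_eq_measure)
  finally show ?thesis .
qed

text \<open>The reverse comparison, where the finite total mass takes the place of long branches and
  bounds \<open>a\<close> from above. Applied to an invariant set, it carries a small proportion in
  a cylinder to a small measure in its image; ergodicity rests on this.\<close>

lemma cylinder_lower_bound: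
  assumes w: "\<And>i. i \<le> n \<Longrightarrow> w i \<in> P" and ne: "emeasure N (cylinder (Suc n) w) \<noteq> 0"
    and [measurable]: "h \<in> borel_measurable N"
  shows "(\<integral>\<^sup>+x. indicator (F ` w n) x * h x \<partial>N) * emeasure N (cylinder (Suc n) w)
    \<le> ennreal (distortion\<^sup>2 * measure N (space N)) * (\<integral>\<^sup>+x. h ((F ^^ Suc n) x) * indicator (cylinder (Suc n) w) x \<partial>N)"
proof -
  let ?c = "cylinder (Suc n) w"
  note [measurable] = cylinder_sets[of "Suc n" w, OF w, simplified less_Suc_eq_le] image_sets[OF w[OF order_refl]]
  obtain x0 where x0: "x0 \<in> ?c" using ne by fastforce
  define a where "a = Jn (Suc n) x0"
  have a: "a > 0" using x0 unfolding a_def by (intro Jn_pos) (auto simp: cylinder_def)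
  have D: "Jn (Suc n) x \<le> distortion * Jn (Suc n) y" if "x \<in> ?c" "y \<in> ?c" for x y
    using that w by (intro Jn_distortion[of "Suc n" w]) auto
  have "ennreal (a * measure N ?c) = (\<integral>\<^sup>+x. ennreal a * indicator ?c x \<partial>N)"
    using a by (simp add: nn_integral_cmult emeasure_eq_measure ennreal_mult)
  also have "\<dots> \<le> (\<integral>\<^sup>+x. ennreal distortion * (indicator ?c x * (ennreal (Jn (Suc n) x) * 1)) \<partial>N)"
    using D[OF x0] distortion_pos
    by (intro nn_integral_mono) (auto simp: a_def indicator_def simp flip: ennreal_mult' intro!: ennreal_leI)
  also have "\<dots> = ennreal distortion * (\<integral>\<^sup>+x. indicator (F ` w n) x * 1 \<partial>N)"
    by (subst cylinder_change_variables[OF w ne, symmetric]) (auto intro!: nn_integral_cmult)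
  also have "\<dots> \<le> ennreal distortion * ennreal (measure N (space N))"
    by (intro mult_left_mono) (auto simp: emeasure_eq_measure bounded_measure)
  finally have a_le: "a * measure N ?c \<le> distortion * measure N (space N)"
    using distortion_pos by (simp flip: ennreal_mult)
  have "(\<integral>\<^sup>+x. indicator (F ` w n) x * h x \<partial>N) = (\<integral>\<^sup>+x. indicator ?c x * (ennreal (Jn (Suc n) x) * h ((F ^^ Suc n) x)) \<partial>N)"
    by (rule cylinder_change_variables[OF w ne, symmetric]) auto
  also have "\<dots> \<le> (\<integral>\<^sup>+x. ennreal (distortion * a) * (h ((F ^^ Suc n) x) * indicator ?c x) \<partial>N)"
    using D[OF _ x0] by (intro nn_integral_mono) (auto simp: a_def indicator_def intro!: mult_right_mono ennreal_leI)
  also have "\<dots> = ennreal (distortion * a) * (\<integral>\<^sup>+x. h ((F ^^ Suc n) x) * indicator ?c x \<partial>N)"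
    by (intro nn_integral_cmult) measurable
  finally have "(\<integral>\<^sup>+x. indicator (F ` w n) x * h x \<partial>N) * emeasure N ?c
      \<le> ennreal (distortion * a) * (\<integral>\<^sup>+x. h ((F ^^ Suc n) x) * indicator ?c x \<partial>N) * emeasure N ?c"
    by (intro mult_right_mono) auto
  also have "\<dots> = ennreal (distortion * a * measure N ?c) * (\<integral>\<^sup>+x. h ((F ^^ Suc n) x) * indicator ?c x \<partial>N)"
    using distortion_pos a by (simp add: emeasure_eq_measure ennreal_mult mult_ac)
  also have "\<dots> \<le> ennreal (distortion\<^sup>2 * measure N (space N)) * (\<integral>\<^sup>+x. h ((F ^^ Suc n) x) * indicator ?c x \<partial>N)"
    using mult_left_mono[OF a_le, of distortion] distortion_pos
    by (intro mult_right_mono ennreal_leI) (auto simp: power2_eq_square mult_ac)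
  finally show ?thesis .
qed

end

section \<open>Quasi-independence of past and future\<close>

context WGM_map
begin

lemma obtain_jacobian:
  obtains J C \<beta> \<delta> where "WGM_jacobian N F P J C \<beta> \<delta>"
proof -
  obtain J C \<beta> where J: "J \<in> borel_measurable N" "\<forall>x\<in>space N. J x > (0::real)"
      "\<forall>\<omega>\<in>P. \<forall>A\<in>sets N. A \<subseteq> \<omega> \<longrightarrow> emeasure N (F ` A) = (\<integral>\<^sup>+x\<in>A. ennreal (J x) \<partial>N)"
      "C > 0" "0 < \<beta>" "\<beta> < 1" "\<forall>\<omega>\<in>P. \<forall>x\<in>\<omega>. \<forall>y\<in>\<omega>.
          ln (J x / J y) \<le> C * enat_power \<beta> (separation_time F P (F x) (F y))"
    using nonsingular_Gibbs by (elim exE conjE) (rule that)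
  obtain \<delta> where "\<delta> > 0" "\<forall>\<omega>\<in>P. measure N (F ` \<omega>) \<ge> \<delta>"
    using long_branches by blast
  with J have "WGM_jacobian N F P J C \<beta> \<delta>"
    by unfold_locales auto
  then show ?thesis by (rule that)
qed

text \<open>Constancy is asked on cylinders only. Points that leave \<open>\<Union>P\<close> within
  \<open>n\<close> steps lie in no cylinder, so neither their values nor measurability are
  controlled.\<close>

definition cylinder_constant :: "nat \<Rightarrow> ('a \<Rightarrow> 'b) \<Rightarrow> bool" where
  "cylinder_constant n u \<longleftrightarrow>
     (\<forall>w. (\<forall>i<n. w i \<in> P) \<longrightarrow> u constant_on cylinder n w)"

lemma AE_good: "AE x in N. \<forall>i. (F ^^ i) x \<in> \<Union>P"
proof -
  obtain J C \<beta> \<delta> where "WGM_jacobian N F P J C \<beta> \<delta>" by (rule obtain_jacobian)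
  then interpret WGM_jacobian N F P J C \<beta> \<delta> .
  show ?thesis by (rule AE_orbit)
qed

lemma measure_space_pos: "measure N (space N) > 0"
  using space_pos unfolding emeasure_eq_measure by (simp only: ennreal_less_zero_iff)

text \<open>A function of the first \<open>n\<close> letters can be pulled out of the integral on
  each cylinder; the other factor is then bounded by \<open>cylinder_upper_bound\<close>, with a
  constant independent of \<open>n\<close> and of the cylinder.\<close>

lemma obtain_quasi_independence_constant:
  obtains K where "K > 0"
    "\<And>n u h. u \<in> borel_measurable N \<Longrightarrow> h \<in> borel_measurable N \<Longrightarrow> cylinder_constant n u \<Longrightarrow>
      (\<integral>\<^sup>+x. u x * h ((F ^^ n) x) \<partial>N) \<le> ennreal K * (\<integral>\<^sup>+x. u x \<partial>N) * (\<integral>\<^sup>+x. h x \<partial>N)"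
proof -
  obtain J C \<beta> \<delta> where "WGM_jacobian N F P J C \<beta> \<delta>" by (rule obtain_jacobian)
  then interpret WGM_jacobian N F P J C \<beta> \<delta> .
  \<comment> \<open>The second entry serves \<open>n = 0\<close>, where the only cylinder is the
    whole space and there is no last letter whose image could be used.\<close>
  define K where "K = max (distortion\<^sup>2 / \<delta>) (1 / measure N (space N))"
  have K: "K > 0" "distortion\<^sup>2 / \<delta> \<le> K" "1 / measure N (space N) \<le> K"
    unfolding K_def using measure_space_pos less_max_iff_disj[of 0 "distortion\<^sup>2 / \<delta>" "1 / measure N (space N)"] by simp_all
  have bound: "(\<integral>\<^sup>+x. h ((F ^^ n) x) * indicator (cylinder n w) x \<partial>N)
      \<le> ennreal K * emeasure N (cylinder n w) * (\<integral>\<^sup>+x. h x \<partial>N)"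
    if w: "\<And>i. i < n \<Longrightarrow> w i \<in> P" and [measurable]: "h \<in> borel_measurable N" for n w h
  proof (cases n)
    case 0
    have "1 \<le> K * measure N (space N)" using K(3) measure_space_pos by (simp add: field_simps)
    then have "ennreal 1 \<le> ennreal K * emeasure N (space N)"
      using K(1) by (simp add: emeasure_eq_measure flip: ennreal_mult ennreal_1)
    then have "1 * (\<integral>\<^sup>+x. h x \<partial>N) \<le> ennreal K * emeasure N (space N) * (\<integral>\<^sup>+x. h x \<partial>N)"
      by (intro mult_right_mono) auto
    moreover have "(\<integral>\<^sup>+x. h x * indicator (space N) x \<partial>N) = (\<integral>\<^sup>+x. h x \<partial>N)"
      by (intro nn_integral_cong) auto
    ultimately show ?thesis by (simp add: 0 cylinder_0)
  next
    case (Suc n')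
    have "(\<integral>\<^sup>+x. h ((F ^^ n) x) * indicator (cylinder n w) x \<partial>N)
      \<le> ennreal (distortion\<^sup>2 / \<delta>) * emeasure N (cylinder n w) * (\<integral>\<^sup>+x. h x \<partial>N)"
      unfolding Suc by (rule cylinder_upper_bound) (use w Suc in auto)
    also have "\<dots> \<le> ennreal K * emeasure N (cylinder n w) * (\<integral>\<^sup>+x. h x \<partial>N)"
      using K(2) by (intro mult_right_mono ennreal_leI) auto
    finally show ?thesis .
  qed
  have "(\<integral>\<^sup>+x. u x * h ((F ^^ n) x) \<partial>N) \<le> ennreal K * (\<integral>\<^sup>+x. u x \<partial>N) * (\<integral>\<^sup>+x. h x \<partial>N)"
    if [measurable]: "u \<in> borel_measurable N" "h \<in> borel_measurable N" and u: "cylinder_constant n u" for n u h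
  proof -
    define I where "I = ennreal K * (\<integral>\<^sup>+x. h x \<partial>N)"
    have "(\<integral>\<^sup>+x. u x * h ((F ^^ n) x) \<partial>N) \<le> (\<integral>\<^sup>+x. I * u x \<partial>N)"
    proof (rule nn_integral_cylinders_mono[OF _ _ AE_good, of _ _ n])
      fix w assume w: "\<And>i. i < n \<Longrightarrow> w i \<in> P"
      then obtain c where c: "\<And>x. x \<in> cylinder n w \<Longrightarrow> u x = c"
        using u unfolding cylinder_constant_def constant_on_def by metis
      note [measurable] = cylinder_sets[of n w, OF w]
      have "(\<integral>\<^sup>+x. u x * h ((F ^^ n) x) * indicator (cylinder n w) x \<partial>N)
        = (\<integral>\<^sup>+x. c * (h ((F ^^ n) x) * indicator (cylinder n w) x) \<partial>N)"
        by (intro nn_integral_cong) (auto simp: indicator_def c)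
      also have "\<dots> = c * (\<integral>\<^sup>+x. h ((F ^^ n) x) * indicator (cylinder n w) x \<partial>N)"
        by (intro nn_integral_cmult) measurable
      also have "\<dots> \<le> c * (ennreal K * emeasure N (cylinder n w) * (\<integral>\<^sup>+x. h x \<partial>N))"
        by (intro mult_left_mono bound w) auto
      also have "\<dots> = I * c * emeasure N (cylinder n w)"
        unfolding I_def by (simp only: mult_ac)
      also have "\<dots> = (\<integral>\<^sup>+x. I * c * indicator (cylinder n w) x \<partial>N)"
        by (rule nn_integral_cmult_indicator[symmetric]) measurable
      also have "\<dots> = (\<integral>\<^sup>+x. I * u x * indicator (cylinder n w) x \<partial>N)"
        by (intro nn_integral_cong) (auto simp: indicator_def c)
      finally show "(\<integral>\<^sup>+x. u x * h ((F ^^ n) x) * indicator (cylinder n w) x \<partial>N) \<le> \<dots>" .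
    qed measurable
    also have "\<dots> = I * (\<integral>\<^sup>+x. u x \<partial>N)"
      by (rule nn_integral_cmult) fact
    also have "\<dots> = ennreal K * (\<integral>\<^sup>+x. u x \<partial>N) * (\<integral>\<^sup>+x. h x \<partial>N)"
      unfolding I_def by (simp only: mult_ac)
    finally show ?thesis .
  qed
  with K(1) show ?thesis by (rule that)
qed

text \<open>Fixing one such constant frees later statements from \<open>J\<close>, \<open>C\<close>,
  \<beta> and \<delta>.\<close>

definition K :: real where
  "K = (SOME K. K > 0 \<and> (\<forall>n u h. u \<in> borel_measurable N \<longrightarrow> h \<in> borel_measurable N \<longrightarrow> cylinder_constant n u \<longrightarrow>
     (\<integral>\<^sup>+x. u x * h ((F ^^ n) x) \<partial>N) \<le> ennreal K * (\<integral>\<^sup>+x. u x \<partial>N) * (\<integral>\<^sup>+x. h x \<partial>N)))"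

lemma K_pos: "K > 0"
  and quasi_independence: "u \<in> borel_measurable N \<Longrightarrow> h \<in> borel_measurable N \<Longrightarrow> cylinder_constant n u \<Longrightarrow>
    (\<integral>\<^sup>+x. u x * h ((F ^^ n) x) \<partial>N) \<le> ennreal K * (\<integral>\<^sup>+x. u x \<partial>N) * (\<integral>\<^sup>+x. h x \<partial>N)"
proof -
  have "\<exists>K>0. \<forall>n u h. u \<in> borel_measurable N \<longrightarrow> h \<in> borel_measurable N \<longrightarrow> cylinder_constant n u \<longrightarrow>
     (\<integral>\<^sup>+x. u x * h ((F ^^ n) x) \<partial>N) \<le> ennreal K * (\<integral>\<^sup>+x. u x \<partial>N) * (\<integral>\<^sup>+x. h x \<partial>N)"
    by (rule obtain_quasi_independence_constant) blast
  from someI_ex[OF this, folded K_def] show "K > 0"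
    and "u \<in> borel_measurable N \<Longrightarrow> h \<in> borel_measurable N \<Longrightarrow> cylinder_constant n u \<Longrightarrow>
    (\<integral>\<^sup>+x. u x * h ((F ^^ n) x) \<partial>N) \<le> ennreal K * (\<integral>\<^sup>+x. u x \<partial>N) * (\<integral>\<^sup>+x. h x \<partial>N)"
    by blast+
qed

end

section \<open>Ergodicity of the induced map\<close>

context WGM_map
begin

text \<open>Membership depends only on the itinerary before time \<open>n\<close>. Comparing
  itineraries, instead of asking for a union of cylinders, keeps the class closed under complements
  also on the null set missed by \<open>P\<close>.\<close>

definition determined :: "nat \<Rightarrow> 'a set \<Rightarrow> bool" where
  "determined n B \<longleftrightarrow> (\<forall>x\<in>space N. \<forall>y\<in>space N.
     (\<forall>i<n. \<forall>\<omega>\<in>P. (F ^^ i) x \<in> \<omega> \<longleftrightarrow> (F ^^ i) y \<in> \<omega>) \<longrightarrow> (x \<in> B \<longleftrightarrow> y \<in> B))"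

lemma determined_mono: "determined n B \<Longrightarrow> n \<le> k \<Longrightarrow> determined k B"
  unfolding determined_def by (meson order_less_le_trans)

lemma determined_Compl: "determined n B \<Longrightarrow> determined n (space N - B)"
  unfolding determined_def by blast

lemma determined_UN:
  assumes "\<And>i. i \<in> I \<Longrightarrow> determined n (B i)"
  shows "determined n (\<Union>i\<in>I. B i)"
  unfolding determined_def
proof (intro ballI impI)
  fix x y assume "x \<in> space N" "y \<in> space N" "\<forall>i<n. \<forall>\<omega>\<in>P. ((F ^^ i) x \<in> \<omega>) = ((F ^^ i) y \<in> \<omega>)"
  then have "x \<in> B i \<longleftrightarrow> y \<in> B i" if "i \<in> I" for i
    using assms[OF that] unfolding determined_def by blast
  then show "x \<in> (\<Union>i\<in>I. B i) \<longleftrightarrow> y \<in> (\<Union>i\<in>I. B i)" by blast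
qed

text \<open>The sets with such approximations contain the cylinders and are closed under
  complements. For a countable union, a finite part exhausts all but \<open>e / 2\<close> of the
  measure, and finitely many determined sets share a common length.\<close>

lemma determined_approximation_sigma_sets:
  assumes "A \<in> sigma_sets (space N) (\<Union>n. join_partition N F P {..<n})"
  shows "A \<in> sets N \<and> (\<forall>e>0. \<exists>n B. B \<in> sets N \<and> determined n B \<and> measure N (sym_diff A B) < e)"
  using assms
proof induction
  case (Basic A)
  then obtain n w where w: "\<And>i. i < n \<Longrightarrow> w i \<in> P" "A = cylinder n w"
    by (auto simp: join_partition_def cylinder_def)
  then have "A \<in> sets N" using cylinder_sets by blast
  moreover have "determined n A"
    using w unfolding determined_def w(2) cylinder_def by blast
  ultimately show ?case by fastforce
next
  case Empty
  have "determined 0 {}" by (simp add: determined_def)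
  then show ?case by (intro conjI allI impI exI[of _ "0::nat"] exI[of _ "{}"]) auto
next
  case (Compl A)
  show ?case
  proof (intro conjI allI impI)
    fix e :: real assume "e > 0"
    then obtain n B where B: "B \<in> sets N" "determined n B" "measure N (sym_diff A B) < e"
      using Compl by blast
    have "sym_diff (space N - A) (space N - B) = sym_diff A B"
      using B(1) Compl.IH sets.sets_into_space by blast
    then show "\<exists>n B. B \<in> sets N \<and> determined n B \<and> measure N (sym_diff (space N - A) B) < e"
      using B(1,3) determined_Compl[OF B(2)] by (intro exI[of _ n] exI[of _ "space N - B"]) simp
  qed (use Compl.IH in blast)
next
  case (Union a)
  then have a [measurable]: "a i \<in> sets N" for i by blast
  show ?case
  proof (intro conjI allI impI)
    fix e :: real assume e: "e > 0"
    have "(\<lambda>k. measure N (\<Union>i<k. a i)) \<longlonglongrightarrow> measure N (\<Union>k. \<Union>i<k. a i)"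
      by (intro finite_Lim_measure_incseq) (auto simp: incseq_def intro: order_less_le_trans)
    moreover have "(\<Union>k. \<Union>i<k. a i) = (\<Union>i. a i)" by blast
    ultimately have "eventually (\<lambda>k. measure N (\<Union>i. a i) - e / 2 < measure N (\<Union>i<k. a i)) sequentially"
      using e by (intro order_tendstoD) auto
    then obtain k where k: "measure N (\<Union>i. a i) - e / 2 < measure N (\<Union>i<k. a i)"
      by (auto simp: eventually_sequentially)
    define r where "r = e / (2 * (real k + 1))"
    have "r > 0" using e by (simp add: r_def)
    then have "\<forall>i. \<exists>n B. B \<in> sets N \<and> determined n B \<and> measure N (sym_diff (a i) B) < r"
      using Union.IH by blast
    then obtain n B where B: "\<And>i. B i \<in> sets N" "\<And>i. determined (n i) (B i)" "\<And>i. measure N (sym_diff (a i) (B i)) < r"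
      by metis
    note [measurable] = B(1)
    define D where "D = (\<Union>i<k. B i)"
    have "determined (\<Sum>i<k. n i) (B i)" if "i < k" for i
      using that by (intro determined_mono[OF B(2)] member_le_sum) auto
    then have "determined (\<Sum>i<k. n i) D"
      unfolding D_def by (intro determined_UN) auto
    moreover have [measurable]: "D \<in> sets N" unfolding D_def by auto
    moreover have "measure N (sym_diff (\<Union>i. a i) D) < e"
    proof -
      have "measure N (sym_diff (\<Union>i. a i) D)
          \<le> measure N (((\<Union>i. a i) - (\<Union>i<k. a i)) \<union> (\<Union>i<k. sym_diff (a i) (B i)))"
        unfolding D_def by (intro finite_measure_mono) auto
      also have "\<dots> \<le> measure N ((\<Union>i. a i) - (\<Union>i<k. a i)) + measure N (\<Union>i<k. sym_diff (a i) (B i))"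
        by (intro measure_Un_le) auto
      also have "measure N ((\<Union>i. a i) - (\<Union>i<k. a i)) = measure N (\<Union>i. a i) - measure N (\<Union>i<k. a i)"
        by (intro finite_measure_Diff) auto
      also have "measure N (\<Union>i<k. sym_diff (a i) (B i)) \<le> (\<Sum>i<k. measure N (sym_diff (a i) (B i)))"
        by (intro measure_UNION_le) auto
      also have "\<dots> \<le> (\<Sum>i<k. r)"
        using B(3) by (intro sum_mono) (auto intro: less_imp_le)
      also have "\<dots> \<le> e / 2"
        using e by (simp add: r_def field_simps)
      finally show ?thesis using k by simp
    qed
    ultimately show "\<exists>n B. B \<in> sets N \<and> determined n B \<and> measure N (sym_diff (\<Union>i. a i) B) < e"
      by blast
  qed (use a in blast)
qed

lemma determined_approximation:
  assumes A: "A \<in> sets N" and "e > 0"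
  obtains n B where "B \<in> sets N" "determined n B" "measure N (sym_diff A B) < e"
proof -
  obtain A' where A': "A' \<in> sigma_sets (space N) (\<Union>n. join_partition N F P {..<n})" "sym_diff A A' \<in> null_sets N"
    using generating[OF A] by blast
  obtain n B where B: "A' \<in> sets N" "B \<in> sets N" "determined n B" "measure N (sym_diff A' B) < e"
    using determined_approximation_sigma_sets[OF A'(1)] \<open>e > 0\<close> by blast
  have "measure N (sym_diff A B) \<le> measure N (sym_diff A A' \<union> sym_diff A' B)"
    using A B by (intro finite_measure_mono) auto
  also have "\<dots> \<le> measure N (sym_diff A A') + measure N (sym_diff A' B)"
    using A B by (intro measure_Un_le) auto
  also have "measure N (sym_diff A A') = 0"
    using A'(2) by (simp add: measure_def null_sets_def)
  finally show ?thesis using B by (intro that) auto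
qed

section \<open>Invariant sets of the induced map\<close>

lemma obtain_finite_subpartition:
  assumes "\<delta> > 0"
  obtains P\<^sub>0 where "finite P\<^sub>0" "P\<^sub>0 \<subseteq> P" "measure N (space N - \<Union>P\<^sub>0) < \<delta>"
proof -
  have ne: "P \<noteq> {}"
  proof
    assume "P = {}"
    then show False using partition space_pos by (simp add: mod0_partition_def null_sets_def)
  qed
  define A where "A k = (\<Union>i<k. from_nat_into P i)" for k :: nat
  have P: "from_nat_into P i \<in> P" for i by (rule from_nat_into[OF ne])
  have A [measurable]: "A k \<in> sets N" for k unfolding A_def using P_sets[OF P] by auto
  have "(\<lambda>k. measure N (A k)) \<longlonglongrightarrow> measure N (\<Union>k. A k)"
    using A by (intro finite_Lim_measure_incseq) (auto simp: incseq_def A_def intro: order_less_le_trans)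
  moreover have "(\<Union>k. A k) = \<Union>(range (from_nat_into P))" unfolding A_def by blast
  moreover have "measure N (\<Union>P) = measure N (space N)"
    using P_covers P_Union_sets by (intro finite_measure_eq_AE) auto
  ultimately have "eventually (\<lambda>k. measure N (space N) - \<delta> < measure N (A k)) sequentially"
    using assms range_from_nat_into[OF ne P_countable] by (intro order_tendstoD) auto
  then obtain k where k: "measure N (space N) - \<delta> < measure N (A k)"
    by (auto simp: eventually_sequentially)
  have "measure N (space N - A k) = measure N (space N) - measure N (A k)"
    using A[of k] sets.sets_into_space[OF A[of k]] by (intro finite_measure_Diff) auto
  with k show ?thesis
    using P by (intro that[of "from_nat_into P ` {..<k}"]) (auto simp: A_def)
qed

text \<open>The complement \<open>H\<close> of the invariant set has arbitrarily small proportion in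
  suitable cylinders, and distortion carries this to the image of the last letter. Since images are
  large, finitely many members suffice to turn smallness into vanishing of \<open>H\<close> on one
  whole member; aperiodicity then spreads the vanishing to all of them.\<close>

lemma ergodic:
  assumes ap: "aperiodic N F P"
    and G [measurable]: "G \<in> sets N" and inv: "\<And>x. x \<in> \<Union>P \<Longrightarrow> F x \<in> G \<longleftrightarrow> x \<in> G"
    and nonnull: "emeasure N G \<noteq> 0"
  shows "AE x in N. x \<in> G"
proof -
  obtain J C \<beta> \<delta> where "WGM_jacobian N F P J C \<beta> \<delta>" by (rule obtain_jacobian)
  then interpret WGM_jacobian N F P J C \<beta> \<delta> .
  define H where "H = space N - G"
  have H [measurable]: "H \<in> sets N" by (simp add: H_def)
  define D where "D = distortion\<^sup>2 * measure N (space N)"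
  have D: "D > 0" using distortion_pos measure_space_pos by (simp add: D_def)
  \<comment> \<open>Invariance is assumed on \<open>\<Union>P\<close> only; along a cylinder the
    first \<open>n\<close> iterates stay there.\<close>
  have H_inv: "(F ^^ n) x \<in> H \<longleftrightarrow> x \<in> H" if "x \<in> cylinder n w" "\<And>i. i < n \<Longrightarrow> w i \<in> P" for n w x
  proof -
    have "(F ^^ i) x \<in> G \<longleftrightarrow> x \<in> G" if "i \<le> n" for i
      using that
    proof (induction i)
      case (Suc i)
      then have "(F ^^ i) x \<in> w i" "w i \<in> P"
        using \<open>x \<in> cylinder n w\<close> \<open>\<And>i. i < n \<Longrightarrow> w i \<in> P\<close> by (auto simp: cylinder_def)
      then show ?case using inv[of "(F ^^ i) x"] Suc by auto
    qed simp
    then show ?thesis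
      using that funpow_space[of x] by (auto simp: H_def cylinder_def)
  qed
  have image_H: "emeasure N (F ` w n \<inter> H) * emeasure N (cylinder (Suc n) w) \<le> ennreal D * emeasure N (cylinder (Suc n) w \<inter> H)"
    if w: "\<And>i. i \<le> n \<Longrightarrow> w i \<in> P" and ne: "emeasure N (cylinder (Suc n) w) \<noteq> 0" for w n
  proof -
    note [measurable] = cylinder_sets[of "Suc n" w, OF w, simplified less_Suc_eq_le] image_sets[OF w[OF order_refl]]
    have "emeasure N (F ` w n \<inter> H) = (\<integral>\<^sup>+x. indicator (F ` w n) x * indicator H x \<partial>N)"
      by (simp add: indicator_inter_arith[symmetric])
    moreover have "(\<integral>\<^sup>+x. indicator H ((F ^^ Suc n) x) * indicator (cylinder (Suc n) w) x \<partial>N)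
        = (\<integral>\<^sup>+x. indicator (cylinder (Suc n) w \<inter> H) x \<partial>N)"
      using H_inv[of _ "Suc n" w] w by (intro nn_integral_cong) (auto simp: indicator_def less_Suc_eq_le)
    ultimately show ?thesis
      using cylinder_lower_bound[OF w ne, of "indicator H"] by (simp add: D_def)
  qed
  have small_image: "\<exists>\<omega>\<in>P. measure N (F ` \<omega> \<inter> H) \<le> \<eta>" if "\<eta> > 0" for \<eta>
  proof -
    define \<theta> where "\<theta> = \<eta> / D"
    have \<theta>: "\<theta> > 0" using that D by (simp add: \<theta>_def)
    have "\<exists>n w. (\<forall>i\<le>n. w i \<in> P) \<and> emeasure N (cylinder (Suc n) w) \<noteq> 0 \<and>
        emeasure N (cylinder (Suc n) w \<inter> H) \<le> ennreal \<theta> * emeasure N (cylinder (Suc n) w)"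
    proof (rule ccontr)
      \<comment> \<open>Otherwise \<open>H\<close> has proportion at least \<theta> in every
        cylinder of positive length, hence in every determined set. But the invariant set has
        positive measure and is approximated by determined sets that are almost free of
        \<open>H\<close>.\<close>
      assume contra: "\<not> ?thesis"
      have ge: "ennreal \<theta> * emeasure N (cylinder (Suc n) w) \<le> emeasure N (cylinder (Suc n) w \<inter> H)"
        if w: "\<And>i. i \<le> n \<Longrightarrow> w i \<in> P" for n w
        using contra w by (cases "emeasure N (cylinder (Suc n) w) = 0") (auto simp: not_le intro: less_imp_le)
      have ge': "\<theta> * measure N B \<le> measure N (B \<inter> H)" if [measurable]: "B \<in> sets N" and B: "determined n B" for n B
      proof -
        have "(\<integral>\<^sup>+x. ennreal \<theta> * indicator B x \<partial>N) \<le> (\<integral>\<^sup>+x. indicator (B \<inter> H) x \<partial>N)"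
        proof (rule nn_integral_cylinders_mono[OF _ _ AE_good, of _ _ "Suc n"])
          fix w assume w: "\<And>i. i < Suc n \<Longrightarrow> w i \<in> P"
          let ?c = "cylinder (Suc n) w"
          note [measurable] = cylinder_sets[of "Suc n" w, OF w]
          have "x \<in> B \<longleftrightarrow> y \<in> B" if "x \<in> ?c" "y \<in> ?c" for x y
          proof -
            have "(F ^^ i) x \<in> \<omega> \<longleftrightarrow> (F ^^ i) y \<in> \<omega>" if "i < Suc n" "\<omega> \<in> P" for i \<omega>
              using w[OF that(1)] that \<open>x \<in> ?c\<close> \<open>y \<in> ?c\<close> P_unique[of \<omega> "w i"] unfolding cylinder_def by blast
            then show ?thesis
              using determined_mono[OF B, of "Suc n"] that unfolding determined_def cylinder_def by simp
          qed
          then consider "?c \<subseteq> B" | "?c \<inter> B = {}" by blast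
          then show "(\<integral>\<^sup>+x. ennreal \<theta> * indicator B x * indicator ?c x \<partial>N) \<le> (\<integral>\<^sup>+x. indicator (B \<inter> H) x * indicator ?c x \<partial>N)"
          proof cases
            case 1
            have "(\<integral>\<^sup>+x. ennreal \<theta> * indicator B x * indicator ?c x \<partial>N) = (\<integral>\<^sup>+x. ennreal \<theta> * indicator ?c x \<partial>N)"
              using 1 by (intro nn_integral_cong) (auto simp: indicator_def)
            also have "\<dots> = ennreal \<theta> * emeasure N ?c" by (simp add: nn_integral_cmult)
            also have "\<dots> \<le> emeasure N (?c \<inter> H)" using ge w by auto
            also have "\<dots> = (\<integral>\<^sup>+x. indicator (?c \<inter> H) x \<partial>N)" by simp
            also have "\<dots> = (\<integral>\<^sup>+x. indicator (B \<inter> H) x * indicator ?c x \<partial>N)"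
              using 1 by (intro nn_integral_cong) (auto simp: indicator_def)
            finally show ?thesis .
          next
            case 2
            then have "(\<integral>\<^sup>+x. ennreal \<theta> * indicator B x * indicator ?c x \<partial>N) = (\<integral>\<^sup>+x. 0 \<partial>N)"
              by (intro nn_integral_cong) (auto simp: indicator_def)
            then show ?thesis by simp
          qed
        qed measurable
        then show ?thesis
          using \<theta> by (simp add: nn_integral_cmult emeasure_eq_measure flip: ennreal_mult)
      qed
      define g where "g = measure N G"
      have g: "g > 0" using nonnull by (simp add: g_def emeasure_eq_measure zero_less_measure_iff)
      \<comment> \<open>The first entry leaves a determined set of measure at least
        \<open>g / 2\<close>; the second keeps \<open>H\<close> there below half of
        \<open>\<theta> * g / 2\<close>.\<close>
      define e where "e = min (g / 2) (\<theta> * g / 4)"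
      have e: "e > 0" using g \<theta> by (simp add: e_def)
      obtain n B where B [measurable]: "B \<in> sets N" and B': "determined n B" "measure N (sym_diff G B) < e"
        using determined_approximation[OF G e] .
      have "measure N (B \<inter> H) \<le> measure N (sym_diff G B)"
        by (intro finite_measure_mono) (auto simp: H_def)
      moreover have "g \<le> measure N (B \<union> sym_diff G B)"
        unfolding g_def by (intro finite_measure_mono) auto
      moreover have "measure N (B \<union> sym_diff G B) \<le> measure N B + measure N (sym_diff G B)"
        by (intro measure_Un_le) auto
      ultimately have "measure N (B \<inter> H) < e" "g / 2 \<le> measure N B"
        using B'(2) by (auto simp: e_def)
      moreover from this(2) have "\<theta> * (g / 2) \<le> \<theta> * measure N B" using \<theta> by (intro mult_left_mono) auto
      moreover have "e \<le> \<theta> * g / 4" by (simp add: e_def)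
      moreover have "\<theta> * g > 0" using \<theta> g by simp
      ultimately show False using ge'[OF B B'(1)] by auto
    qed
    then obtain n w where w: "\<And>i. i \<le> n \<Longrightarrow> w i \<in> P" and ne: "emeasure N (cylinder (Suc n) w) \<noteq> 0"
      and le: "emeasure N (cylinder (Suc n) w \<inter> H) \<le> ennreal \<theta> * emeasure N (cylinder (Suc n) w)"
      by auto
    let ?m = "measure N (cylinder (Suc n) w)"
    have m: "?m > 0" using ne by (simp add: emeasure_eq_measure zero_less_measure_iff)
    have "emeasure N (F ` w n \<inter> H) * emeasure N (cylinder (Suc n) w) \<le> ennreal D * (ennreal \<theta> * emeasure N (cylinder (Suc n) w))"
      using image_H[OF w ne] le by (meson mult_left_mono order_trans zero_le)
    then have "measure N (F ` w n \<inter> H) * ?m \<le> D * (\<theta> * ?m)"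
      using D \<theta> by (simp add: emeasure_eq_measure flip: ennreal_mult)
    then have "measure N (F ` w n \<inter> H) \<le> \<eta>"
      using m D by (simp add: \<theta>_def)
    then show ?thesis using w by blast
  qed
  \<comment> \<open>The uncovered part is smaller than \<delta>, the lower bound for all images, so
    every image meets one of these finitely many members in positive measure.\<close>
  obtain P\<^sub>0 where P\<^sub>0: "finite P\<^sub>0" "P\<^sub>0 \<subseteq> P" "measure N (space N - \<Union>P\<^sub>0) < \<delta>"
    using obtain_finite_subpartition[OF \<delta>_pos] .
  obtain \<eta> where \<eta>: "\<eta> > 0" "\<And>\<omega>. \<omega> \<in> P\<^sub>0 \<Longrightarrow> measure N (\<omega> \<inter> H) \<le> \<eta> \<Longrightarrow> measure N (\<omega> \<inter> H) = 0"
  proof -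
    \<comment> \<open>Below half of the least positive value of
      \<open>m(\<omega> \<inter> H)\<close> over these members only the value 0 is left. The
      additional element 1 keeps the minimum defined.\<close>
    define S where "S = insert 1 {measure N (\<omega> \<inter> H) |\<omega>. \<omega> \<in> P\<^sub>0 \<and> measure N (\<omega> \<inter> H) \<noteq> 0}"
    have S: "finite S" "S \<noteq> {}" "\<And>s. s \<in> S \<Longrightarrow> s > 0"
      using P\<^sub>0(1) by (auto simp: S_def zero_less_measure_iff)
    show ?thesis
    proof (rule that[of "Min S / 2"])
      show "Min S / 2 > 0" using S by simp
      fix \<omega> assume \<omega>: "\<omega> \<in> P\<^sub>0" "measure N (\<omega> \<inter> H) \<le> Min S / 2"
      show "measure N (\<omega> \<inter> H) = 0"
      proof (rule ccontr)
        assume "measure N (\<omega> \<inter> H) \<noteq> 0"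
        then have "Min S \<le> measure N (\<omega> \<inter> H)" using \<omega>(1) S(1) by (intro Min_le) (auto simp: S_def)
        then show False using \<omega>(2) S(3)[OF Min_in[OF S(1,2)]] by simp
      qed
    qed
  qed
  obtain \<omega> where \<omega>: "\<omega> \<in> P" "measure N (F ` \<omega> \<inter> H) \<le> \<eta>" using small_image[OF \<eta>(1)] by blast
  note [measurable] = image_sets[OF \<omega>(1)]
  have P\<^sub>0_sets: "\<omega>' \<in> sets N" if "\<omega>' \<in> P\<^sub>0" for \<omega>' using that P\<^sub>0 P_sets by blast
  have "\<exists>\<omega>'\<in>P\<^sub>0. measure N (F ` \<omega> \<inter> \<omega>') \<noteq> 0"
  proof (rule ccontr)
    assume *: "\<not> ?thesis"
    have U: "\<Union>P\<^sub>0 \<in> sets N" using P\<^sub>0(1) P\<^sub>0_sets by blast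
    have "\<delta> \<le> measure N (F ` \<omega>)" by (rule images_large[OF \<omega>(1)])
    also have "\<dots> \<le> measure N ((space N - \<Union>P\<^sub>0) \<union> (\<Union>\<omega>'\<in>P\<^sub>0. F ` \<omega> \<inter> \<omega>'))"
      using U P\<^sub>0 P\<^sub>0_sets sets.sets_into_space[OF image_sets[OF \<omega>(1)]]
      by (intro finite_measure_mono) (auto intro!: sets.finite_UN)
    also have "\<dots> \<le> measure N (space N - \<Union>P\<^sub>0) + measure N (\<Union>\<omega>'\<in>P\<^sub>0. F ` \<omega> \<inter> \<omega>')"
      using U P\<^sub>0 P\<^sub>0_sets by (intro measure_Un_le) (auto intro!: sets.finite_UN)
    also have "measure N (\<Union>\<omega>'\<in>P\<^sub>0. F ` \<omega> \<inter> \<omega>') \<le> (\<Sum>\<omega>'\<in>P\<^sub>0. measure N (F ` \<omega> \<inter> \<omega>'))"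
      using P\<^sub>0(1) P\<^sub>0_sets by (intro measure_UNION_le) auto
    also have "\<dots> = 0" using * by simp
    finally show False using P\<^sub>0(3) by simp
  qed
  then obtain \<omega>' where \<omega>': "\<omega>' \<in> P\<^sub>0" "measure N (F ` \<omega> \<inter> \<omega>') \<noteq> 0" by blast
  have \<omega>'P: "\<omega>' \<in> P" using \<omega>' P\<^sub>0 by blast
  have "AE x in N. x \<in> \<omega>' \<longrightarrow> x \<in> F ` \<omega>"
    using \<omega>'(2) by (intro image_contains \<omega>(1) \<omega>'P) (auto simp: measure_def)
  then have "measure N (\<omega>' \<inter> H) \<le> measure N (F ` \<omega> \<inter> H)"
    using P_sets[OF \<omega>'P] by (intro finite_measure_mono_AE) auto
  then have \<omega>'_null: "measure N (\<omega>' \<inter> H) = 0" using \<eta>(2) \<omega>' \<omega>(2) by simp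
  have "AE x in N. x \<in> \<omega>\<^sub>2 \<longrightarrow> x \<notin> H" if \<omega>\<^sub>2: "\<omega>\<^sub>2 \<in> P" for \<omega>\<^sub>2
  proof -
    note [measurable] = P_sets[OF \<omega>\<^sub>2] P_sets[OF \<omega>'P]
    obtain k where "\<forall>n\<ge>k. emeasure N (\<omega>' \<inter> (F ^^ n) -` \<omega>\<^sub>2) > 0"
      using ap \<omega>'P \<omega>\<^sub>2 unfolding aperiodic_def by blast
    \<comment> \<open>Time \<open>k + 1\<close> instead of \<open>k\<close>, because the cylinder
      estimates need a last letter.\<close>
    then have pos: "emeasure N (\<omega>' \<inter> (F ^^ Suc k) -` \<omega>\<^sub>2) \<noteq> 0" by (metis le_SucI less_irrefl order_refl)
    define B where "B = {x \<in> space N. x \<in> \<omega>' \<and> (F ^^ Suc k) x \<in> \<omega>\<^sub>2}"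
    have B [measurable]: "B \<in> sets N" unfolding B_def by measurable
    have "B = \<omega>' \<inter> (F ^^ Suc k) -` \<omega>\<^sub>2"
      using P_subset_space[OF \<omega>'P] unfolding B_def by blast
    with pos have B_pos: "emeasure N B \<noteq> 0" by simp
    have "\<exists>w. (\<forall>i\<le>k. w i \<in> P) \<and> w 0 = \<omega>' \<and> emeasure N (cylinder (Suc k) w \<inter> B) \<noteq> 0"
    proof (rule ccontr)
      assume *: "\<not> ?thesis"
      have "(\<integral>\<^sup>+x. indicator B x \<partial>N) \<le> (\<integral>\<^sup>+x. 0 \<partial>N)"
      proof (rule nn_integral_cylinders_mono[OF _ _ AE_good, of _ _ "Suc k"])
        fix w assume w: "\<And>i. i < Suc k \<Longrightarrow> w i \<in> P"
        note [measurable] = cylinder_sets[of "Suc k" w, OF w]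
        have "emeasure N (cylinder (Suc k) w \<inter> B) = 0"
        proof (cases "w 0 = \<omega>'")
          case True
          then show ?thesis using * w by (auto simp: less_Suc_eq_le)
        next
          case False
          then have "cylinder (Suc k) w \<inter> B = {}"
            using P_unique[OF w[of 0] \<omega>'P] by (fastforce simp: cylinder_def B_def)
          then show ?thesis by simp
        qed
        then show "(\<integral>\<^sup>+x. indicator B x * indicator (cylinder (Suc k) w) x \<partial>N) \<le> (\<integral>\<^sup>+x. 0 * indicator (cylinder (Suc k) w) x \<partial>N)"
          by (simp add: indicator_inter_arith[symmetric] Int_commute)
      qed auto
      then show False using B_pos by simp
    qed
    then obtain w where w: "\<And>i. i \<le> k \<Longrightarrow> w i \<in> P" "w 0 = \<omega>'" and cB: "emeasure N (cylinder (Suc k) w \<inter> B) \<noteq> 0"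
      by blast
    let ?c = "cylinder (Suc k) w"
    note [measurable] = cylinder_sets[of "Suc k" w, OF w(1), simplified less_Suc_eq_le] image_sets[OF w(1)[OF order_refl]]
    have c_ne: "emeasure N ?c \<noteq> 0"
      using cB emeasure_mono[of "?c \<inter> B" ?c N] by auto
    have "emeasure N (F ` w k \<inter> \<omega>\<^sub>2) \<noteq> 0"
    proof
      assume 0: "emeasure N (F ` w k \<inter> \<omega>\<^sub>2) = 0"
      have "emeasure N (?c \<inter> B) = (\<integral>\<^sup>+x. indicator (?c \<inter> B) x \<partial>N)" by simp
      also have "\<dots> \<le> (\<integral>\<^sup>+x. indicator (F ` w k \<inter> \<omega>\<^sub>2) ((F ^^ Suc k) x) * indicator ?c x \<partial>N)"
        by (intro nn_integral_mono) (auto simp: indicator_def B_def cylinder_def)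
      also have "\<dots> \<le> ennreal (distortion\<^sup>2 / \<delta>) * emeasure N ?c * (\<integral>\<^sup>+x. indicator (F ` w k \<inter> \<omega>\<^sub>2) x \<partial>N)"
        by (intro cylinder_upper_bound w) measurable
      also have "\<dots> = 0" using 0 by simp
      finally show False using cB by simp
    qed
    then have AE1: "AE x in N. x \<in> \<omega>\<^sub>2 \<longrightarrow> x \<in> F ` w k"
      by (intro image_contains w \<omega>\<^sub>2) auto
    \<comment> \<open>The cylinder begins in \<open>\<omega>'\<close>, where \<open>H\<close> is
      null. The lower bound passes this on to its image, and the image contains
      \<open>\<omega>\<^sub>2\<close> up to a null set.\<close>
    have "emeasure N (?c \<inter> H) \<le> emeasure N (\<omega>' \<inter> H)"
      using w(2) by (intro emeasure_mono) (auto simp: cylinder_def)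
    also have "\<dots> = 0" using \<omega>'_null by (simp add: emeasure_eq_measure)
    finally have "emeasure N (F ` w k \<inter> H) * emeasure N ?c = 0"
      using image_H[OF w(1) c_ne] by simp
    then have "emeasure N (F ` w k \<inter> H) = 0" using c_ne by simp
    then have "AE x in N. x \<notin> F ` w k \<inter> H" by (intro AE_not_in) auto
    with AE1 show ?thesis by eventually_elim auto
  qed
  then have "AE x in N. \<forall>\<omega>\<^sub>2\<in>P. x \<in> \<omega>\<^sub>2 \<longrightarrow> x \<notin> H"
    by (subst AE_ball_countable[OF P_countable]) auto
  then show ?thesis
    using P_covers AE_space by eventually_elim (auto simp: H_def)
qed

end

section \<open>Birkhoff sums bounded above\<close>

text \<open>The values lie in a commutative monoid because the same sum serves for return times in
  \<open>nat\<close>, observables in \<open>real\<close> and indicators in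
  \<open>ennreal\<close>.\<close>

definition birkhoff_sum :: "('a \<Rightarrow> 'a) \<Rightarrow> ('a \<Rightarrow> 'b::comm_monoid_add) \<Rightarrow> nat \<Rightarrow> 'a \<Rightarrow> 'b" where
  "birkhoff_sum T g n x = (\<Sum>i<n. g ((T ^^ i) x))"

lemma birkhoff_sum_0 [simp]: "birkhoff_sum T g 0 x = 0"
  by (simp add: birkhoff_sum_def)

lemma birkhoff_sum_add:
  "birkhoff_sum T g (k + n) x = birkhoff_sum T g k x + birkhoff_sum T g n ((T ^^ k) x)"
proof (induction n)
  case (Suc n)
  have "(T ^^ (k + n)) x = (T ^^ n) ((T ^^ k) x)"
    by (subst add.commute) (simp add: funpow_add)
  with Suc show ?case by (simp add: birkhoff_sum_def add.assoc)
qed simp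

lemma birkhoff_sum_Suc: "birkhoff_sum T g (Suc n) x = g x + birkhoff_sum T g n (T x)"
  using birkhoff_sum_add[of T g 1 n x] by (simp add: birkhoff_sum_def)

lemma birkhoff_sum_measurable:
  fixes g :: "'a \<Rightarrow> 'b::{second_countable_topology, topological_comm_monoid_add}"
  assumes [measurable]: "T \<in> M \<rightarrow>\<^sub>M M" "g \<in> borel_measurable M"
  shows "birkhoff_sum T g n \<in> borel_measurable M"
proof -
  have [measurable]: "(T ^^ i) \<in> M \<rightarrow>\<^sub>M M" for i
    by (induction i) (auto intro: measurable_compose assms(1))
  show ?thesis unfolding birkhoff_sum_def by measurable
qed

text \<open>\<open>max_birkhoff T g n\<close> is the maximum of the Birkhoff sums of length at most \<open>n\<close>.\<close>

primrec max_birkhoff :: "('a \<Rightarrow> 'a) \<Rightarrow> ('a \<Rightarrow> real) \<Rightarrow> nat \<Rightarrow> 'a \<Rightarrow> real" where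
  "max_birkhoff T g 0 = (\<lambda>x. 0)"
| "max_birkhoff T g (Suc n) = (\<lambda>x. max 0 (g x + max_birkhoff T g n (T x)))"

lemma max_birkhoff_nonneg: "0 \<le> max_birkhoff T g n x"
  by (cases n) auto

lemma max_birkhoff_le_Suc: "max_birkhoff T g n x \<le> max_birkhoff T g (Suc n) x"
proof (induction n arbitrary: x)
  case (Suc n)
  from Suc[of "T x"] show ?case by (auto simp: max_def)
qed simp

lemma max_birkhoff_mono: "k \<le> n \<Longrightarrow> max_birkhoff T g k x \<le> max_birkhoff T g n x"
  by (rule lift_Suc_mono_le[of "\<lambda>n. max_birkhoff T g n x"]) (rule max_birkhoff_le_Suc)

lemma birkhoff_sum_le_max_birkhoff: "birkhoff_sum T g n x \<le> max_birkhoff T g n x"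
proof (induction n arbitrary: x)
  case (Suc n)
  from Suc[of "T x"] show ?case by (auto simp: birkhoff_sum_Suc)
qed simp

lemma max_birkhoff_measurable:
  assumes [measurable]: "T \<in> M \<rightarrow>\<^sub>M M" "g \<in> borel_measurable M"
  shows "max_birkhoff T g n \<in> borel_measurable M"
proof (induction n)
  case (Suc n)
  note [measurable] = Suc
  show ?case by simp
qed simp

lemma max_birkhoff_le:
  assumes "T \<in> X \<rightarrow> X" "\<And>x. x \<in> X \<Longrightarrow> \<bar>g x\<bar> \<le> b" "x \<in> X"
  shows "max_birkhoff T g n x \<le> real n * b"
  using assms(3)
proof (induction n arbitrary: x)
  case (Suc n)
  then have "T x \<in> X" using assms(1) by blast
  then have "max_birkhoff T g n (T x) \<le> real n * b" by (rule Suc.IH)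
  moreover have "\<bar>g x\<bar> \<le> b" by (rule assms(2)[OF Suc.prems])
  moreover from this have "0 \<le> real n * b" by simp
  ultimately show ?case by (simp add: algebra_simps)
qed simp

text \<open>
  If the Birkhoff sums were unbounded above almost everywhere,
  then \<open>max_birkhoff (n + 1) - max_birkhoff n \<circ> f\<close> would converge boundedly to \<open>\<psi>\<close>, while its integrals
  are nonnegative by invariance and monotonicity.
\<close>

lemma ergodic_birkhoff_sums_bounded_above:
  fixes \<psi> :: "'a \<Rightarrow> real"
  assumes erg: "ergodic_invariant_prob f \<mu>" and \<psi> [measurable]: "\<psi> \<in> borel_measurable \<mu>"
    and b: "\<And>x. x \<in> space \<mu> \<Longrightarrow> \<bar>\<psi> x\<bar> \<le> b" and neg: "(\<integral>x. \<psi> x \<partial>\<mu>) < 0"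
  obtains A where "A \<in> sets \<mu>" "f -` A \<inter> space \<mu> = A" "measure \<mu> A = 0"
    "\<And>x. x \<in> space \<mu> - A \<Longrightarrow> \<exists>c. \<forall>n. birkhoff_sum f \<psi> n x \<le> c"
proof -
  interpret prob_space \<mu> using erg by (simp add: ergodic_invariant_prob_def)
  have f [measurable]: "f \<in> \<mu> \<rightarrow>\<^sub>M \<mu>" and inv: "distr \<mu> \<mu> f = \<mu>"
    and zero_one: "\<And>A. A \<in> sets \<mu> \<Longrightarrow> f -` A \<inter> space \<mu> = A \<Longrightarrow> measure \<mu> A = 0 \<or> measure \<mu> A = 1"
    using erg by (auto simp: ergodic_invariant_prob_def)
  have fs: "f x \<in> space \<mu>" if "x \<in> space \<mu>" for x using measurable_space[OF f that] .
  define M where "M = max_birkhoff f \<psi>"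
  have M_meas [measurable]: "M n \<in> borel_measurable \<mu>" for n
    unfolding M_def by (rule max_birkhoff_measurable) auto
  have M_Suc: "M (Suc n) x = max 0 (\<psi> x + M n (f x))" for n x by (simp add: M_def)
  have M_nonneg: "0 \<le> M n x" for n x by (simp add: M_def max_birkhoff_nonneg)
  have M_le: "M n x \<le> real n * b" if "x \<in> space \<mu>" for n x
    unfolding M_def by (rule max_birkhoff_le[OF _ b that]) (use fs in auto)
  \<comment> \<open>Integer levels make measurability evident. The set turns out to be invariant
    exactly and not just almost everywhere, as the definition of ergodicity asks.\<close>
  define A where "A = {x \<in> space \<mu>. \<forall>c::nat. \<exists>n. M n x > real c}"
  have A_iff: "x \<in> A \<longleftrightarrow> (\<forall>c. \<exists>n. M n x > c)" if "x \<in> space \<mu>" for x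
  proof
    assume x: "x \<in> A"
    show "\<forall>c. \<exists>n. M n x > c"
    proof
      fix c :: real
      obtain k :: nat where k: "c < real k" using reals_Archimedean2 by blast
      obtain n where "M n x > real k" using x by (auto simp: A_def)
      with k show "\<exists>n. M n x > c" by (intro exI[of _ n]) simp
    qed
  qed (use that in \<open>auto simp: A_def\<close>)
  have A [measurable]: "A \<in> sets \<mu>" unfolding A_def by measurable
  have f_A: "f x \<in> A \<longleftrightarrow> x \<in> A" if x: "x \<in> space \<mu>" for x
  proof
    assume "f x \<in> A"
    then have *: "\<exists>n. M n (f x) > c" for c using A_iff[OF fs[OF x]] by blast
    show "x \<in> A" unfolding A_iff[OF x]
    proof
      fix c
      obtain n where "M n (f x) > c + b" using * by blast
      then have "M (Suc n) x > c" using b[OF x] by (auto simp: M_Suc)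
      then show "\<exists>n. M n x > c" by blast
    qed
  next
    assume "x \<in> A"
    then have *: "\<exists>n. M n x > c" for c using A_iff[OF x] by blast
    show "f x \<in> A" unfolding A_iff[OF fs[OF x]]
    proof
      fix c
      obtain n where n: "M n x > max c 0 + b" using * by blast
      then obtain n' where "n = Suc n'" using b[OF x] by (cases n) (auto simp: M_def)
      then have "M n' (f x) > c" using n b[OF x] by (auto simp: M_Suc)
      then show "\<exists>n. M n (f x) > c" by blast
    qed
  qed
  have A_inv: "f -` A \<inter> space \<mu> = A" using f_A sets.sets_into_space[OF A] by blast
  have "measure \<mu> A = 0"
  proof (rule ccontr)
    assume "measure \<mu> A \<noteq> 0"
    then have "prob A = 1" using zero_one[OF A A_inv] by blast
    then have AE_A: "AE x in \<mu>. x \<in> A" using AE_in_set_eq_1[OF A] by simp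
    \<comment> \<open>This is the maximum of \<open>\<psi> x\<close> and \<open>- M n (f x)\<close>:
      it is bounded by \<open>b\<close> in absolute value and equals \<open>\<psi> x\<close> as soon
      as \<open>M n (f x)\<close> exceeds \<open>b\<close>.\<close>
    define D where "D n x = M (Suc n) x - M n (f x)" for n x
    have [measurable]: "D n \<in> borel_measurable \<mu>" for n unfolding D_def by measurable
    have int_M: "integrable \<mu> (M n)" for n
      by (rule integrable_const_bound[where B = "real n * b"]) (use M_le M_nonneg in \<open>auto intro!: AE_I2\<close>)
    have int_M': "integrable \<mu> (\<lambda>x. M n (f x))" for n
      by (rule integrable_const_bound[where B = "real n * b"]) (use M_le M_nonneg fs in \<open>auto intro!: AE_I2\<close>)
    have eq: "(\<integral>x. M n (f x) \<partial>\<mu>) = (\<integral>x. M n x \<partial>\<mu>)" for n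
      using integral_distr[of f \<mu> \<mu> "M n"] by (simp add: inv)
    have D_nonneg: "0 \<le> (\<integral>x. D n x \<partial>\<mu>)" for n
    proof -
      have "(\<integral>x. M n x \<partial>\<mu>) \<le> (\<integral>x. M (Suc n) x \<partial>\<mu>)"
        using int_M by (intro integral_mono) (auto simp: M_def intro: max_birkhoff_le_Suc simp del: max_birkhoff.simps)
      then show ?thesis unfolding D_def using int_M int_M' eq by simp
    qed
    have "(\<lambda>n. \<integral>x. D n x \<partial>\<mu>) \<longlonglongrightarrow> (\<integral>x. \<psi> x \<partial>\<mu>)"
    proof (rule integral_dominated_convergence[where w = "\<lambda>_. b"])
      show "AE x in \<mu>. (\<lambda>n. D n x) \<longlonglongrightarrow> \<psi> x"
        using AE_A AE_space
      proof eventually_elim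
        case (elim x)
        then have "\<forall>c. \<exists>n. M n (f x) > c" using f_A[of x] A_iff[OF fs[of x]] by blast
        then obtain n0 where n0: "M n0 (f x) > b" by blast
        have "D n x = \<psi> x" if "n \<ge> n0" for n
        proof -
          have "M n (f x) > b" using n0 max_birkhoff_mono[OF that, of f \<psi> "f x"] by (simp add: M_def)
          then show ?thesis using b[of x] elim by (auto simp: D_def M_Suc)
        qed
        then show ?case by (intro tendsto_eventually) (auto simp: eventually_sequentially)
      qed
      show "AE x in \<mu>. norm (D n x) \<le> b" for n
        using AE_space
      proof eventually_elim
        case (elim x)
        then show ?case using b[of x] M_nonneg[of n "f x"] by (auto simp: D_def M_Suc max_def)
      qed
    qed auto
    then have "0 \<le> (\<integral>x. \<psi> x \<partial>\<mu>)" by (rule LIMSEQ_le_const) (use D_nonneg in auto)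
    then show False using neg by simp
  qed
  moreover have "\<exists>c. \<forall>n. birkhoff_sum f \<psi> n x \<le> c" if x: "x \<in> space \<mu> - A" for x
  proof -
    obtain c where "\<And>n. M n x \<le> c" using x A_iff[of x] by (auto simp: not_less)
    then have "birkhoff_sum f \<psi> n x \<le> c" for n
      using birkhoff_sum_le_max_birkhoff[of f \<psi> n x] by (auto simp: M_def intro: order_trans)
    then show ?thesis by blast
  qed
  ultimately show ?thesis using A A_inv by (intro that)
qed

section \<open>Induced maps and return times\<close>

locale expanding_induced_map = WGM_map "restrict_space m \<Delta>" F P
  for m :: "'a measure" and \<Delta> F P +
  fixes \<mu> :: "'a measure" and d :: "'a \<Rightarrow> 'a \<Rightarrow> real" and f :: "'a \<Rightarrow> 'a" and R :: "'a \<Rightarrow> nat"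
  assumes f_measurable [measurable]: "f \<in> m \<rightarrow>\<^sub>M m"
    and induced: "induced_map m f \<Delta> R F P"
    and aperiodic_m: "aperiodic m F P"
    and coprime: "coprime_block m R F P"
    and expanding: "expanding d f R F P"
    and R_integrable: "integrable (restrict_space m \<Delta>) (\<lambda>x. real (R x))"
    and sets_\<mu>: "sets \<mu> = sets m"
    and ergodic_\<mu>: "ergodic_invariant_prob f \<mu>"
    and \<mu>_absolutely_continuous: "absolutely_continuous m \<mu>"
    and \<mu>_\<Delta>_pos: "emeasure \<mu> \<Delta> > 0"
begin

abbreviation N :: "'a measure" where "N \<equiv> restrict_space m \<Delta>"

lemma \<Delta>_sets [measurable]: "\<Delta> \<in> sets m"
  using induced by (simp add: induced_map_def)

lemma \<Delta>_subset: "\<Delta> \<subseteq> space m"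
  using sets.sets_into_space[OF \<Delta>_sets] .

lemma space_N: "space N = \<Delta>"
  using \<Delta>_subset by (auto simp: space_restrict_space)

lemma sets_N: "A \<in> sets N \<longleftrightarrow> A \<in> sets m \<and> A \<subseteq> \<Delta>"
  using \<Delta>_sets \<Delta>_subset by (subst sets_restrict_space_iff) (simp_all add: Int_absorb2 conj_commute)

lemma emeasure_N: "A \<subseteq> \<Delta> \<Longrightarrow> emeasure N A = emeasure m A"
  using \<Delta>_subset by (intro emeasure_restrict_space) (simp_all add: Int_absorb2)

lemma measurable_N: "g \<in> measurable m L \<Longrightarrow> g \<in> measurable N L"
  by (rule measurable_restrict_space1)

lemma R_measurable [measurable]: "R \<in> N \<rightarrow>\<^sub>M count_space UNIV"
  using induced by (simp add: induced_map_def)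

lemma F_eq: "\<omega> \<in> P \<Longrightarrow> x \<in> \<omega> \<Longrightarrow> F x = (f ^^ R x) x"
  using induced by (simp add: induced_map_def)

lemma R_const: "\<omega> \<in> P \<Longrightarrow> x \<in> \<omega> \<Longrightarrow> y \<in> \<omega> \<Longrightarrow> R x = R y"
  using induced unfolding induced_map_def constant_on_def by metis

lemma f_funpow_measurable [measurable]: "(f ^^ n) \<in> m \<rightarrow>\<^sub>M m"
  by (induction n) (auto intro: measurable_compose f_measurable)

lemma f_funpow_space: "x \<in> space m \<Longrightarrow> (f ^^ n) x \<in> space m"
  using measurable_space[OF f_funpow_measurable] .

lemma space_\<mu>: "space \<mu> = space m"
  using sets_\<mu> by (rule sets_eq_imp_space_eq)

sublocale \<mu>: prob_space \<mu>
  using ergodic_\<mu> by (simp add: ergodic_invariant_prob_def)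

lemma aperiodic_N: "aperiodic N F P"
proof -
  have "emeasure N (\<omega> \<inter> B) = emeasure m (\<omega> \<inter> B)" if "\<omega> \<in> P" for \<omega> B
    using P_subset_space[OF that] by (intro emeasure_N) (auto simp: space_N)
  then show ?thesis using aperiodic_m unfolding aperiodic_def by simp
qed

text \<open>Where \<open>R = 0\<close>, a member would consist of fixed points of \<open>F\<close>.
  Aperiodicity would then make it the only member, whereas the coprime block has at least two.
  Consequently \<open>n\<close> returns take at least \<open>n\<close> steps of
  \<open>f\<close>.\<close>

lemma R_pos:
  assumes "\<omega> \<in> P" "x \<in> \<omega>"
  shows "R x > 0"
proof (rule ccontr)
  assume "\<not> R x > 0"
  then have "F y = y" if "y \<in> \<omega>" for y
    using F_eq[OF assms(1) that] R_const[OF assms that] by simp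
  then have fix_\<omega>: "(F ^^ n) y = y" if "y \<in> \<omega>" for y n
    using that by (induction n) auto
  have "\<omega>' = \<omega>" if "\<omega>' \<in> P" for \<omega>'
  proof -
    obtain k where "\<forall>n\<ge>k. emeasure m (\<omega> \<inter> (F ^^ n) -` \<omega>') > 0"
      using aperiodic_m assms(1) \<open>\<omega>' \<in> P\<close> unfolding aperiodic_def by blast
    then have "emeasure m (\<omega> \<inter> (F ^^ k) -` \<omega>') > 0" by blast
    then have "\<omega> \<inter> (F ^^ k) -` \<omega>' \<noteq> {}" by fastforce
    then obtain y where "y \<in> \<omega>" "(F ^^ k) y \<in> \<omega>'" by blast
    then show ?thesis using fix_\<omega> P_unique[OF \<open>\<omega>' \<in> P\<close> assms(1), of y] by simp
  qed
  then have "P \<subseteq> {\<omega>}" by blast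
  then have "card Q \<le> 1" if "Q \<subseteq> P" for Q
    using card_mono[of "{\<omega>}" Q] that by simp
  then show False using coprime unfolding coprime_block_def by fastforce
qed

text \<open>\<open>F\<close> is known to be a power of \<open>f\<close> on members of
  \<open>P\<close> only. On this forward invariant set of full measure, the identities between
  orbits of \<open>F\<close> and of \<open>f\<close> hold without exceptions.\<close>

definition \<Omega> :: "'a set" where "\<Omega> = {x \<in> \<Delta>. \<forall>i. (F ^^ i) x \<in> \<Union>P}"

lemma AE_\<Omega>: "AE x in N. x \<in> \<Omega>"
  using AE_good AE_space by eventually_elim (auto simp: \<Omega>_def space_N)

lemma \<Omega>_space: "x \<in> \<Omega> \<Longrightarrow> x \<in> space m"
  using \<Delta>_subset by (auto simp: \<Omega>_def)

lemma \<Omega>_P: "x \<in> \<Omega> \<Longrightarrow> \<exists>\<omega>\<in>P. x \<in> \<omega>"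
  unfolding \<Omega>_def using funpow_0[of F x] by (metis (mono_tags, lifting) Union_iff mem_Collect_eq)

lemma \<Omega>_funpow:
  assumes "x \<in> \<Omega>" shows "(F ^^ n) x \<in> \<Omega>"
proof -
  have "(F ^^ i) ((F ^^ n) x) \<in> \<Union>P" for i
    using assms unfolding \<Omega>_def by (simp flip: funpow_add[THEN fun_cong, unfolded o_apply])
  moreover have "(F ^^ n) x \<in> \<Delta>"
    using assms funpow_space[of x n] by (simp add: \<Omega>_def space_N)
  ultimately show ?thesis by (simp add: \<Omega>_def)
qed

lemma \<Omega>_F: "x \<in> \<Omega> \<Longrightarrow> F x \<in> \<Omega>"
  using \<Omega>_funpow[of x 1] by simp

lemma \<Omega>_R_pos: "x \<in> \<Omega> \<Longrightarrow> R x > 0"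
  using \<Omega>_P R_pos by blast

lemma \<Omega>_F_eq: "x \<in> \<Omega> \<Longrightarrow> F x = (f ^^ R x) x"
  using \<Omega>_P F_eq by blast

section \<open>Return times and sums over excursions\<close>

definition return_time :: "nat \<Rightarrow> 'a \<Rightarrow> nat" where
  "return_time n x = birkhoff_sum F R n x"

definition induced_sum :: "('a \<Rightarrow> 'b::comm_monoid_add) \<Rightarrow> 'a \<Rightarrow> 'b" where
  "induced_sum g x = birkhoff_sum f g (R x) x"

lemma return_time_Suc: "return_time (Suc n) x = return_time n x + R ((F ^^ n) x)"
  by (simp add: return_time_def birkhoff_sum_def)

lemma return_time_0 [simp]: "return_time 0 x = 0"
  by (simp add: return_time_def)

lemma funpow_F_eq: "x \<in> \<Omega> \<Longrightarrow> (F ^^ n) x = (f ^^ return_time n x) x"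
proof (induction n)
  case (Suc n)
  have "(f ^^ return_time (Suc n) x) x = (f ^^ R ((F ^^ n) x)) ((f ^^ return_time n x) x)"
    unfolding return_time_Suc by (subst add.commute) (simp add: funpow_add)
  then show ?case using Suc \<Omega>_F_eq[OF \<Omega>_funpow[OF Suc.prems, of n]] by simp
qed simp

lemma return_time_ge: "x \<in> \<Omega> \<Longrightarrow> n \<le> return_time n x"
proof (induction n)
  case (Suc n)
  then show ?case using \<Omega>_R_pos[OF \<Omega>_funpow[OF Suc.prems, of n]] by (simp add: return_time_Suc)
qed simp

lemma birkhoff_sum_return_time:
  "x \<in> \<Omega> \<Longrightarrow> birkhoff_sum f g (return_time n x) x = birkhoff_sum F (induced_sum g) n x"
proof (induction n)
  case (Suc n)
  then show ?case
    by (simp add: return_time_Suc birkhoff_sum_add funpow_F_eq[symmetric])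
      (simp add: birkhoff_sum_def induced_sum_def)
qed simp

lemma induced_sum_measurable:
  fixes g :: "'a \<Rightarrow> 'b::{second_countable_topology, topological_comm_monoid_add}"
  assumes "g \<in> borel_measurable m"
  shows "induced_sum g \<in> borel_measurable N"
  unfolding induced_sum_def
  by (rule measurable_compose_countable[OF _ R_measurable])
    (intro measurable_N birkhoff_sum_measurable f_measurable assms)

lemma abs_birkhoff_sum_le:
  fixes \<psi> :: "'a \<Rightarrow> real"
  assumes "\<And>x. x \<in> space m \<Longrightarrow> \<bar>\<psi> x\<bar> \<le> b" "x \<in> space m"
  shows "\<bar>birkhoff_sum f \<psi> n x\<bar> \<le> b * real n"
proof -
  have "\<bar>birkhoff_sum f \<psi> n x\<bar> \<le> (\<Sum>i<n. \<bar>\<psi> ((f ^^ i) x)\<bar>)"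
    unfolding birkhoff_sum_def by (rule sum_abs)
  also have "\<dots> \<le> (\<Sum>i<n. b)"
    by (intro sum_mono assms f_funpow_space)
  finally show ?thesis by (simp add: mult.commute)
qed

text \<open>The exceptional set is invariant under \<open>f\<close> and \<mu>-null. Its complement
  in \<Delta> is invariant under \<open>F\<close>; it is not \<open>m\<close>-null, since otherwise
  absolute continuity would give \<Delta> zero \<mu>-measure. Ergodicity of \<open>F\<close>
  therefore makes it full for \<open>m\<close>.\<close>

lemma AE_birkhoff_sums_bounded_above:
  fixes \<psi> :: "'a \<Rightarrow> real"
  assumes \<psi>: "\<psi> \<in> borel_measurable m" and b: "\<And>x. x \<in> space m \<Longrightarrow> \<bar>\<psi> x\<bar> \<le> b"
    and neg: "(\<integral>x. \<psi> x \<partial>\<mu>) < 0"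
  shows "AE x in N. \<exists>c. \<forall>n. birkhoff_sum f \<psi> n x \<le> c"
proof -
  have "\<psi> \<in> borel_measurable \<mu>" using \<psi> sets_\<mu> by (simp cong: measurable_cong_sets)
  then obtain A where A: "A \<in> sets m" "f -` A \<inter> space m = A" "measure \<mu> A = 0"
    "\<And>x. x \<in> space m - A \<Longrightarrow> \<exists>c. \<forall>n. birkhoff_sum f \<psi> n x \<le> c"
    using ergodic_birkhoff_sums_bounded_above[OF ergodic_\<mu> _ b neg] unfolding space_\<mu> sets_\<mu> by blast
  define G where "G = \<Delta> - A"
  have G: "G \<in> sets N" using A(1) by (auto simp: G_def sets_N)
  have f_A: "(f ^^ n) x \<in> A \<longleftrightarrow> x \<in> A" if "x \<in> space m" for x n
  proof (induction n)
    case (Suc n)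
    have "f ((f ^^ n) x) \<in> A \<longleftrightarrow> (f ^^ n) x \<in> A"
      using A(2) f_funpow_space[OF that, of n] by blast
    with Suc show ?case by simp
  qed simp
  have "AE x in N. x \<in> G"
  proof (rule ergodic[OF aperiodic_N G])
    fix x assume "x \<in> \<Union>P"
    then obtain \<omega> where \<omega>: "\<omega> \<in> P" "x \<in> \<omega>" by blast
    then have x: "x \<in> \<Delta>" using P_subset_space space_N by blast
    moreover have "F x \<in> \<Delta>" using F_space x space_N by blast
    moreover have "F x \<in> A \<longleftrightarrow> x \<in> A" using F_eq[OF \<omega>] f_A x \<Delta>_subset by auto
    ultimately show "F x \<in> G \<longleftrightarrow> x \<in> G" by (simp add: G_def)
  next
    show "emeasure N G \<noteq> 0"
    proof
      assume "emeasure N G = 0"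
      then have "G \<in> null_sets m" using G by (simp add: null_sets_def sets_N emeasure_N)
      then have "emeasure \<mu> G = 0"
        using \<mu>_absolutely_continuous unfolding absolutely_continuous_def by blast
      moreover have "emeasure \<mu> \<Delta> \<le> emeasure \<mu> (G \<union> A)"
        using A(1) G by (intro emeasure_mono) (auto simp: G_def sets_\<mu>)
      moreover have "emeasure \<mu> (G \<union> A) \<le> emeasure \<mu> G + emeasure \<mu> A"
        using A(1) G by (intro emeasure_subadditive) (auto simp: sets_\<mu> sets_N)
      moreover have "emeasure \<mu> A = 0" using A(3) by (simp add: \<mu>.emeasure_eq_measure)
      ultimately show False using \<mu>_\<Delta>_pos by simp
    qed
  qed
  then show ?thesis
    by eventually_elim (use A(4) \<Delta>_subset in \<open>auto simp: G_def\<close>)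
qed

text \<open>The sets where some Birkhoff sum exceeds \<open>M\<close> decrease to a null set as
  \<open>M\<close> grows, so almost sure boundedness becomes one uniform bound off a set of small
  measure.\<close>

lemma exceptional_set:
  fixes \<psi> :: "'a \<Rightarrow> real"
  assumes \<psi> [measurable]: "\<psi> \<in> borel_measurable m" and b: "\<And>x. x \<in> space m \<Longrightarrow> \<bar>\<psi> x\<bar> \<le> b"
    and neg: "(\<integral>x. \<psi> x \<partial>\<mu>) < 0" and "e > 0"
  obtains B and M :: nat where "B \<in> sets N" "measure N B < e"
    "\<And>x n. x \<in> \<Delta> - B \<Longrightarrow> birkhoff_sum f \<psi> n x \<le> real M"
proof -
  note [measurable] = measurable_N[OF birkhoff_sum_measurable[OF f_measurable \<psi>]]
  define B where "B M = {x \<in> space N. \<exists>n. birkhoff_sum f \<psi> n x > real M}" for M :: nat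
  have B [measurable]: "B M \<in> sets N" for M unfolding B_def by measurable
  have "(\<lambda>M. measure N (B M)) \<longlonglongrightarrow> measure N (\<Inter>M. B M)"
  proof (intro finite_Lim_measure_decseq)
    show "decseq B"
      unfolding decseq_def B_def by (intro allI impI Collect_mono conj_mono ex_mono) (auto intro: order_le_less_trans)
  qed (use B in auto)
  moreover have "measure N (\<Inter>M. B M) = 0"
  proof -
    have "AE x in N. \<exists>c. \<forall>n. birkhoff_sum f \<psi> n x \<le> c"
      by (rule AE_birkhoff_sums_bounded_above[OF \<psi> b neg])
    then have "AE x in N. x \<notin> (\<Inter>M. B M)"
    proof eventually_elim
      case (elim x)
      then obtain c where c: "\<And>n. birkhoff_sum f \<psi> n x \<le> c" by blast
      obtain M :: nat where "c < real M" using reals_Archimedean2 by blast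
      then have "x \<notin> B M" using c by (auto simp: B_def not_less intro: order_trans less_imp_le)
      then show ?case by blast
    qed
    then have "(\<Inter>M. B M) \<in> null_sets N" by (subst AE_iff_null_sets) auto
    then show ?thesis by (simp add: measure_def null_sets_def)
  qed
  ultimately have "eventually (\<lambda>M. measure N (B M) < e) sequentially"
    using \<open>e > 0\<close> by (intro order_tendstoD) auto
  then obtain M where "measure N (B M) < e" by (auto simp: eventually_sequentially)
  then show ?thesis
    by (intro that[of "B M" M] B) (auto simp: B_def space_N not_less)
qed

section \<open>Bounds uniform over the iterates of the induced map\<close>

definition K1 :: real where "K1 = K * measure N (space N)"

lemma K1_pos: "K1 > 0"
  using K_pos measure_space_pos by (simp add: K1_def)

text \<open>Quasi-independence with a constant past bounds the image measures under all iterates of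
  \<open>F\<close> by one multiple of the original measure, which replaces invariance.\<close>

lemma iterate_integral_bound:
  assumes "h \<in> borel_measurable N"
  shows "(\<integral>\<^sup>+x. h ((F ^^ n) x) \<partial>N) \<le> ennreal K1 * (\<integral>\<^sup>+x. h x \<partial>N)"
proof -
  have "cylinder_constant n (\<lambda>x. 1::ennreal)"
    by (simp add: cylinder_constant_def constant_on_def)
  with assms have "(\<integral>\<^sup>+x. 1 * h ((F ^^ n) x) \<partial>N) \<le> ennreal K * (\<integral>\<^sup>+x. 1 \<partial>N) * (\<integral>\<^sup>+x. h x \<partial>N)"
    by (intro quasi_independence) auto
  then show ?thesis
    using K_pos by (simp add: K1_def emeasure_eq_measure ennreal_mult)
qed

lemma birkhoff_sum_integral_bound:
  assumes h [measurable]: "h \<in> borel_measurable N"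
  shows "(\<integral>\<^sup>+x. birkhoff_sum F h n x \<partial>N) \<le> of_nat n * (ennreal K1 * (\<integral>\<^sup>+x. h x \<partial>N))"
proof -
  have "(\<integral>\<^sup>+x. birkhoff_sum F h n x \<partial>N) = (\<Sum>i<n. \<integral>\<^sup>+x. h ((F ^^ i) x) \<partial>N)"
    unfolding birkhoff_sum_def by (rule nn_integral_sum) measurable
  also have "\<dots> \<le> (\<Sum>i<n. ennreal K1 * (\<integral>\<^sup>+x. h x \<partial>N))"
    by (intro sum_mono iterate_integral_bound h)
  finally show ?thesis by simp
qed

end

lemma le_if_multiples_le:
  fixes a b c :: real
  assumes "\<And>n::nat. real n * a \<le> c + real n * b"
  shows "a \<le> b"
proof (rule ccontr)
  assume "\<not> a \<le> b"
  then obtain n :: nat where "c / (a - b) < real n" using reals_Archimedean2 by blast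
  then show False using assms[of n] \<open>\<not> a \<le> b\<close> by (simp add: field_simps)
qed

context WGM_map
begin

lemma cylinder_cong: "(\<And>i. i < n \<Longrightarrow> w i = w' i) \<Longrightarrow> cylinder n w = cylinder n w'"
  by (auto simp: cylinder_def)

text \<open>The cylinders, together with the set of points that leave \<open>\<Union>P\<close>, form
  a countable cover by measurable sets on each of which the function is constant. The last piece
  needs its own hypothesis because cylinder constancy is silent there.\<close>

lemma cylinder_constant_measurable:
  fixes u :: "'a \<Rightarrow> 'b::topological_space"
  assumes u: "cylinder_constant n u"
    and outside: "\<And>x. x \<in> space N \<Longrightarrow> \<not> (\<forall>i<n. (F ^^ i) x \<in> \<Union>P) \<Longrightarrow> u x = c"
  shows "u \<in> borel_measurable N"
proof -
  define I where "I = PiE {..<n} (\<lambda>_. P)"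
  have I: "countable I" unfolding I_def by (intro countable_PiE) (auto simp: P_countable)
  have wP: "w i \<in> P" if "w \<in> I" "i < n" for w i using that by (auto simp: I_def PiE_iff)
  define E where "E = {x \<in> space N. \<not> (\<forall>i<n. (F ^^ i) x \<in> \<Union>P)}"
  note [measurable] = P_Union_sets
  have E: "E \<in> sets N" unfolding E_def by measurable
  show ?thesis
  proof (rule measurable_piecewise_restrict[where C = "insert E (cylinder n ` I)"])
    show "countable (insert E (cylinder n ` I))" using I by simp
    show "X \<inter> space N \<in> sets N" if "X \<in> insert E (cylinder n ` I)" for X
      using that E wP cylinder_sets by (auto intro!: sets.Int)
    show "space N \<subseteq> \<Union>(insert E (cylinder n ` I))"
    proof
      fix x assume x: "x \<in> space N"
      show "x \<in> \<Union>(insert E (cylinder n ` I))"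
      proof (cases "x \<in> E")
        case False
        then have "\<forall>i\<in>{..<n}. \<exists>\<omega>. \<omega> \<in> P \<and> (F ^^ i) x \<in> \<omega>" using x by (auto simp: E_def)
        then obtain w where w: "\<forall>i\<in>{..<n}. w i \<in> P \<and> (F ^^ i) x \<in> w i" by (rule bchoice[THEN exE])
        then have "restrict w {..<n} \<in> I" "x \<in> cylinder n (restrict w {..<n})"
          using x by (auto simp: I_def cylinder_def)
        then show ?thesis by blast
      qed simp
    qed
    fix X assume X: "X \<in> insert E (cylinder n ` I)"
    have "\<exists>c. \<forall>x\<in>X. u x = c"
    proof (cases "X = E")
      case True
      then show ?thesis using outside by (auto simp: E_def)
    next
      case False
      then show ?thesis using X u wP unfolding cylinder_constant_def constant_on_def by blast
    qed
    then obtain c' where "\<And>x. x \<in> X \<Longrightarrow> u x = c'" by blast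
    then have "u \<in> borel_measurable (restrict_space N X) \<longleftrightarrow> (\<lambda>_. c') \<in> borel_measurable (restrict_space N X)"
      by (intro measurable_cong) (auto simp: space_restrict_space)
    then show "u \<in> borel_measurable (restrict_space N X)" by simp
  qed
qed

end

section \<open>Comparison of \<mu> with the tower over \<Delta>\<close>

context expanding_induced_map
begin

text \<open>Ergodicity turns averages along \<open>\<mu>\<close> into averages over \<open>\<Delta>\<close> with respect to \<open>m\<close>, which are estimated by
  the tower over \<open>\<Delta>\<close>.\<close>

lemma \<mu>_le_tower:
  obtains c where "c > 0"
    "\<And>A. A \<in> sets m \<Longrightarrow> emeasure \<mu> A \<le> ennreal c * (\<integral>\<^sup>+x. induced_sum (indicator A) x \<partial>N)"
proof -
  define V where "V = measure N (space N)"
  have V: "V > 0" using measure_space_pos by (simp add: V_def)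
  show ?thesis
  proof (rule that)
    show "K1 / V > 0" using K1_pos V by simp
    fix A assume A [measurable]: "A \<in> sets m"
    define H :: "'a \<Rightarrow> ennreal" where "H = induced_sum (indicator A)"
    have [measurable]: "H \<in> borel_measurable N"
      unfolding H_def by (intro induced_sum_measurable) measurable
    show "emeasure \<mu> A \<le> ennreal (K1 / V) * (\<integral>\<^sup>+x. induced_sum (indicator A) x \<partial>N)"
    proof (cases "\<integral>\<^sup>+x. H x \<partial>N")
      case top
      then show ?thesis using K1_pos V by (simp add: H_def[symmetric] ennreal_mult_top)
    next
      case (real h)
      define p where "p = measure \<mu> A"
      have p: "0 \<le> p" "p \<le> 1" by (auto simp: p_def)
      \<comment> \<open>Here \<open>h\<close> is the integral of the number of visits to
        \<open>A\<close> during one excursion. The claim compares it with the frequency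
        \<open>p\<close> of visits that ergodicity prescribes.\<close>
      have "p * V \<le> K1 * h"
      proof (rule field_le_epsilon)
        fix e :: real assume e: "e > 0"
        define \<eta> where "\<eta> = e / (2 * (V + 1))"
        have \<eta>: "\<eta> > 0" "\<eta> * V \<le> e / 2" using e V by (auto simp: \<eta>_def field_simps)
        define q where "q = p - \<eta>"
        \<comment> \<open>The mean is negative, so off a small set the number of visits to
          \<open>A\<close> before time \<open>n\<close> is at least
          \<open>q * n - M\<close>.\<close>
        define \<psi> where "\<psi> x = q - indicator A x" for x :: 'a
        have \<psi>: "\<psi> \<in> borel_measurable m" unfolding \<psi>_def by measurable
        have b: "\<bar>\<psi> x\<bar> \<le> \<bar>q\<bar> + 1" for x by (auto simp: \<psi>_def indicator_def)
        have "(\<integral>x. \<psi> x \<partial>\<mu>) = q - p"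
          unfolding \<psi>_def p_def using A sets_\<mu>
          by (subst Bochner_Integration.integral_diff) (auto simp: \<mu>.prob_space \<mu>.emeasure_eq_measure)
        then have "(\<integral>x. \<psi> x \<partial>\<mu>) < 0" using \<eta> by (simp add: q_def)
        then obtain B and M :: nat where B [measurable]: "B \<in> sets N" and B': "measure N B < e / 2"
          "\<And>x n. x \<in> \<Delta> - B \<Longrightarrow> birkhoff_sum f \<psi> n x \<le> real M"
          using exceptional_set[OF \<psi> b, of "e / 2"] e by (metis half_gt_zero)
        have "real n * (q * (V - measure N B)) \<le> real M * V + real n * (K1 * h)" for n
        proof (cases "q \<ge> 0")
          case q: True
          have "(\<integral>\<^sup>+x. ennreal (real n * q) * indicator (space N - B) x \<partial>N) \<le> (\<integral>\<^sup>+x. ennreal (real M) + birkhoff_sum F H n x \<partial>N)"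
          proof (rule nn_integral_mono_AE)
            show "AE x in N. ennreal (real n * q) * indicator (space N - B) x \<le> ennreal (real M) + birkhoff_sum F H n x"
              using AE_\<Omega>
            proof eventually_elim
              case (elim x)
              show ?case
              proof (cases "x \<in> space N - B")
                case True
                then have "birkhoff_sum f \<psi> n x \<le> real M" using B'(2) by (simp add: space_N)
                then have "real n * q \<le> real M + birkhoff_sum f (indicator A) n x"
                  by (simp add: birkhoff_sum_def \<psi>_def sum_subtractf)
                then have "ennreal (real n * q) \<le> ennreal (real M + birkhoff_sum f (indicator A) n x)"
                  by (rule ennreal_leI)
                also have "\<dots> = ennreal (real M) + (birkhoff_sum f (indicator A) n x :: ennreal)"
                  unfolding birkhoff_sum_def by (subst ennreal_plus) (auto intro!: sum_nonneg simp flip: sum_ennreal ennreal_indicator)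
                \<comment> \<open>The first \<open>n\<close> excursions last at least
                  \<open>n\<close> steps and the additional terms are nonnegative, so visits may be
                  counted over complete excursions.\<close>
                also have "\<dots> \<le> ennreal (real M) + birkhoff_sum f (indicator A) (return_time n x) x"
                  unfolding birkhoff_sum_def using return_time_ge[OF elim, of n]
                  by (intro add_left_mono sum_mono2) auto
                also have "\<dots> = ennreal (real M) + birkhoff_sum F H n x"
                  unfolding H_def by (subst birkhoff_sum_return_time[OF elim]) simp
                finally show ?thesis using True by simp
              qed simp
            qed
          qed
          also have "\<dots> = ennreal (real M) * emeasure N (space N) + (\<integral>\<^sup>+x. birkhoff_sum F H n x \<partial>N)"
            by (subst nn_integral_add) (auto intro!: birkhoff_sum_measurable)
          also have "\<dots> \<le> ennreal (real M) * emeasure N (space N) + of_nat n * (ennreal K1 * (\<integral>\<^sup>+x. H x \<partial>N))"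
            by (intro add_left_mono birkhoff_sum_integral_bound) auto
          also have "\<dots> = ennreal (real M * V + real n * (K1 * h))"
            using real K1_pos V by (simp add: V_def emeasure_eq_measure ennreal_mult ennreal_of_nat_eq_real_of_nat)
          also have "(\<integral>\<^sup>+x. ennreal (real n * q) * indicator (space N - B) x \<partial>N) = ennreal (real n * q) * emeasure N (space N - B)"
            by (rule nn_integral_cmult_indicator) measurable
          also have "\<dots> = ennreal (real n * q) * ennreal (V - measure N B)"
            by (simp only: emeasure_eq_measure finite_measure_compl[OF B] V_def)
          also have "\<dots> = ennreal (real n * q * (V - measure N B))"
            using q bounded_measure[of B] by (intro ennreal_mult[symmetric]) (auto simp: V_def)
          finally show ?thesis
            using real K1_pos V by (subst (asm) ennreal_le_iff) (auto simp: mult.assoc)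
        next
          case False
          have "V - measure N B \<ge> 0" using bounded_measure[of B] unfolding V_def by linarith
          then have "real n * (q * (V - measure N B)) \<le> 0"
            using False by (intro mult_nonneg_nonpos mult_nonpos_nonneg) auto
          also have "0 \<le> real M * V + real n * (K1 * h)"
            using real K1_pos V by auto
          finally show ?thesis .
        qed
        \<comment> \<open>Division by \<open>n\<close> removes \<open>M\<close>, about whose size
          nothing is known.\<close>
        then have "q * (V - measure N B) \<le> K1 * h" by (rule le_if_multiples_le)
        moreover have "q * measure N B \<le> e / 2"
        proof -
          have "q * measure N B \<le> 1 * measure N B" using p \<eta> by (intro mult_right_mono) (auto simp: q_def)
          then show ?thesis using B' by simp
        qed
        ultimately show "p * V \<le> K1 * h + e"
          using \<eta> by (simp add: q_def algebra_simps)
      qed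
      then have "p \<le> K1 / V * h" using V by (simp add: field_simps)
      then have "ennreal p \<le> ennreal (K1 / V * h)" by (rule ennreal_leI)
      also have "\<dots> = ennreal (K1 / V) * ennreal h"
        using real K1_pos V by (intro ennreal_mult) auto
      finally show ?thesis
        using real by (simp add: p_def \<mu>.emeasure_eq_measure H_def[symmetric])
    qed
  qed
qed

section \<open>Mean return time and block sums of small positive part\<close>

definition mean_return_time :: real where "mean_return_time = (\<integral>x. real (R x) \<partial>N)"

lemma mean_return_time_nonneg: "mean_return_time \<ge> 0"
  unfolding mean_return_time_def by simp

lemma R_real_measurable [measurable]: "(\<lambda>x. real (R x)) \<in> borel_measurable N"
  by (rule measurable_compose[OF R_measurable]) simp

lemma nn_integral_R: "(\<integral>\<^sup>+x. ennreal (real (R x)) \<partial>N) = ennreal mean_return_time"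
  unfolding mean_return_time_def by (intro nn_integral_eq_integral R_integrable) auto

lemma return_time_truncation:
  assumes "e > 0"
  obtains L :: nat where "(\<integral>\<^sup>+x. ennreal (real (R x) - real L) \<partial>N) \<le> ennreal e"
proof -
  have "(\<lambda>L. \<integral>\<^sup>+x. ennreal (real (R x) - real L) \<partial>N) \<longlonglongrightarrow> (\<integral>\<^sup>+x. 0 \<partial>N)"
  proof (rule nn_integral_dominated_convergence[where w = "\<lambda>x. ennreal (real (R x))"])
    show "(\<integral>\<^sup>+x. ennreal (real (R x)) \<partial>N) < \<infinity>" by (simp add: nn_integral_R)
    show "AE x in N. (\<lambda>L. ennreal (real (R x) - real L)) \<longlonglongrightarrow> 0"
    proof (intro AE_I2 tendsto_eventually)
      fix x show "eventually (\<lambda>L. ennreal (real (R x) - real L) = 0) sequentially"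
        by (auto simp: eventually_sequentially ennreal_eq_0_iff intro: exI[of _ "R x"])
    qed
  qed (auto intro!: ennreal_leI)
  then have "eventually (\<lambda>L. (\<integral>\<^sup>+x. ennreal (real (R x) - real L) \<partial>N) < ennreal e) sequentially"
    using assms by (intro order_tendstoD) auto
  then show ?thesis using that by (auto simp: eventually_sequentially intro: less_imp_le)
qed

lemma return_time_real: "real (return_time n x) = (\<Sum>i<n. real (R ((F ^^ i) x)))"
  by (simp add: return_time_def birkhoff_sum_def)

lemma induced_birkhoff_sum_abs_le:
  fixes \<psi> :: "'a \<Rightarrow> real"
  assumes "\<And>x. x \<in> space m \<Longrightarrow> \<bar>\<psi> x\<bar> \<le> b" "x \<in> \<Omega>"
  shows "\<bar>birkhoff_sum F (induced_sum \<psi>) n x\<bar> \<le> b * real (return_time n x)"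
  using abs_birkhoff_sum_le[OF assms(1) \<Omega>_space[OF assms(2)]]
  by (simp add: birkhoff_sum_return_time[OF assms(2), symmetric])

text \<open>Off the exceptional set the sum is at most \<open>\<eta>'\<close> times the elapsed time
  plus \<open>M\<close>. On it, the sum is bounded by \<open>b\<close> times the elapsed time, where
  the excess of each return over a level \<open>L\<close> is split off. The coercion to
  \<open>ennreal\<close> sends negative values to 0, so the integral is that of the positive
  part.\<close>

lemma induced_birkhoff_sums_small:
  fixes \<psi> :: "'a \<Rightarrow> real"
  assumes \<psi> [measurable]: "\<psi> \<in> borel_measurable m" and b: "\<And>x. x \<in> space m \<Longrightarrow> \<bar>\<psi> x\<bar> \<le> b" and "0 \<le> b"
    and mean: "(\<integral>x. \<psi> x \<partial>\<mu>) \<le> 0" and \<eta>: "\<eta> > 0"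
  obtains n\<^sub>0 where
    "\<And>n. n \<ge> n\<^sub>0 \<Longrightarrow> (\<integral>\<^sup>+x. ennreal (birkhoff_sum F (induced_sum \<psi>) n x) \<partial>N) \<le> ennreal (\<eta> * real n)"
proof -
  define V where "V = measure N (space N)"
  define \<rho> where "\<rho> = mean_return_time"
  have V: "V > 0" using measure_space_pos by (simp add: V_def)
  have \<rho>: "\<rho> \<ge> 0" by (simp add: \<rho>_def mean_return_time_nonneg)
  \<comment> \<open>Four contributions share \<eta> equally: the drift \<open>\<eta>'\<close>, the
    excess \<open>t\<close> of long returns, the exceptional set of measure \<open>e\<close>, and,
    for large \<open>n\<close>, the constant \<open>M\<close>. The level \<open>L\<close> is fixed
    before \<open>e\<close>, since the exceptional set costs \<open>b * L * e\<close> per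
    return.\<close>
  define \<eta>' where "\<eta>' = \<eta> / (4 * (K1 * \<rho> + 1))"
  have K1\<rho>: "K1 * \<rho> \<ge> 0" using K1_pos \<rho> by simp
  then have \<eta>': "\<eta>' > 0" "\<eta>' * (K1 * \<rho>) \<le> \<eta> / 4" using \<eta> by (auto simp: \<eta>'_def field_simps)
  define t where "t = \<eta> / (4 * (b * K1 + 1))"
  have bK: "b * K1 \<ge> 0" using K1_pos \<open>0 \<le> b\<close> by simp
  then have t: "t > 0" "b * (K1 * t) \<le> \<eta> / 4" using \<eta> by (auto simp: t_def field_simps)
  obtain L :: nat where L: "(\<integral>\<^sup>+x. ennreal (real (R x) - real L) \<partial>N) \<le> ennreal t"
    using return_time_truncation[OF t(1)] .
  define e where "e = \<eta> / (4 * (b * real L + 1))"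
  have bL: "b * real L \<ge> 0" using \<open>0 \<le> b\<close> by simp
  then have e: "e > 0" "b * real L * e \<le> \<eta> / 4" using \<eta> by (auto simp: e_def field_simps)
  define \<psi>' where "\<psi>' x = \<psi> x - \<eta>'" for x
  have \<psi>': "\<psi>' \<in> borel_measurable m" unfolding \<psi>'_def by measurable
  have b': "\<bar>\<psi>' x\<bar> \<le> b + \<eta>'" if "x \<in> space m" for x using b[OF that] \<eta>' by (auto simp: \<psi>'_def)
  have "integrable \<mu> \<psi>"
    using b \<psi> sets_\<mu> by (intro \<mu>.integrable_const_bound[where B = b] AE_I2) (auto simp: space_\<mu> cong: measurable_cong_sets)
  then have "(\<integral>x. \<psi>' x \<partial>\<mu>) = (\<integral>x. \<psi> x \<partial>\<mu>) - \<eta>'"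
    unfolding \<psi>'_def by (subst Bochner_Integration.integral_diff) (auto simp: \<mu>.prob_space)
  then have neg: "(\<integral>x. \<psi>' x \<partial>\<mu>) < 0" using mean \<eta>' by simp
  obtain B and M :: nat where B [measurable]: "B \<in> sets N" and B': "measure N B < e"
      "\<And>x n. x \<in> \<Delta> - B \<Longrightarrow> birkhoff_sum f \<psi>' n x \<le> real M"
    using exceptional_set[OF \<psi>' b' neg e(1)] by metis
  define h1 where "h1 x = ennreal (real (R x))" for x
  define h2 where "h2 x = ennreal (real (R x) - real L)" for x
  have h [measurable]: "h1 \<in> borel_measurable N" "h2 \<in> borel_measurable N"
    unfolding h1_def h2_def by measurable
  note [measurable] = birkhoff_sum_measurable[OF F_measurable h(1)] birkhoff_sum_measurable[OF F_measurable h(2)]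
  have bound: "(\<integral>\<^sup>+x. ennreal (birkhoff_sum F (induced_sum \<psi>) n x) \<partial>N) \<le> ennreal (3 / 4 * \<eta> * real n + real M * V)" for n
  proof -
    have "(\<integral>\<^sup>+x. ennreal (birkhoff_sum F (induced_sum \<psi>) n x) \<partial>N)
      \<le> (\<integral>\<^sup>+x. ennreal \<eta>' * birkhoff_sum F h1 n x + (ennreal (real M) + (ennreal (b * real L * real n) * indicator B x + ennreal b * birkhoff_sum F h2 n x)) \<partial>N)"
    proof (rule nn_integral_mono_AE)
      show "AE x in N. ennreal (birkhoff_sum F (induced_sum \<psi>) n x)
        \<le> ennreal \<eta>' * birkhoff_sum F h1 n x + (ennreal (real M) + (ennreal (b * real L * real n) * indicator B x + ennreal b * birkhoff_sum F h2 n x))"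
        using AE_\<Omega>
      proof eventually_elim
        case (elim x)
        define S where "S = birkhoff_sum F (induced_sum \<psi>) n x"
        have S: "S = birkhoff_sum f \<psi> (return_time n x) x"
          by (simp add: S_def birkhoff_sum_return_time[OF elim])
        have h1: "ennreal \<eta>' * birkhoff_sum F h1 n x = ennreal (\<eta>' * real (return_time n x))"
          using \<eta>' by (simp add: birkhoff_sum_def h1_def return_time_real sum_ennreal ennreal_mult' flip: sum_ennreal)
        show ?case
        proof (cases "x \<in> B")
          case False
          then have "birkhoff_sum f \<psi>' (return_time n x) x \<le> real M"
            using B'(2) elim by (auto simp: \<Omega>_def)
          then have "S \<le> \<eta>' * real (return_time n x) + real M"
            by (simp add: S birkhoff_sum_def \<psi>'_def sum_subtractf mult.commute)
          then have "ennreal S \<le> ennreal (\<eta>' * real (return_time n x) + real M)" by (rule ennreal_leI)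
          also have "\<dots> = ennreal (\<eta>' * real (return_time n x)) + ennreal (real M)"
            using \<eta>' by (intro ennreal_plus) auto
          finally have "ennreal S \<le> ennreal \<eta>' * birkhoff_sum F h1 n x + ennreal (real M)" by (simp add: h1)
          also have "\<dots> \<le> ennreal \<eta>' * birkhoff_sum F h1 n x + (ennreal (real M) + (ennreal (b * real L * real n) * indicator B x + ennreal b * birkhoff_sum F h2 n x))"
            by (intro add_left_mono) simp
          finally show ?thesis unfolding S_def .
        next
          case True
          have "real (return_time n x) \<le> (\<Sum>i<n. real L + max 0 (real (R ((F ^^ i) x)) - real L))"
            unfolding return_time_real by (intro sum_mono) auto
          also have "\<dots> = real L * real n + (\<Sum>i<n. max 0 (real (R ((F ^^ i) x)) - real L))"
            by (simp add: sum.distrib mult.commute)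
          finally have "b * real (return_time n x) \<le> b * (real L * real n + (\<Sum>i<n. max 0 (real (R ((F ^^ i) x)) - real L)))"
            using \<open>0 \<le> b\<close> by (intro mult_left_mono) auto
          then have "S \<le> b * real L * real n + b * (\<Sum>i<n. max 0 (real (R ((F ^^ i) x)) - real L))"
            using induced_birkhoff_sum_abs_le[of \<psi> b x n, OF b elim] by (simp add: S_def algebra_simps)
          then have "ennreal S \<le> ennreal (b * real L * real n + b * (\<Sum>i<n. max 0 (real (R ((F ^^ i) x)) - real L)))"
            by (rule ennreal_leI)
          also have "\<dots> = ennreal (b * real L * real n) + ennreal (b * (\<Sum>i<n. max 0 (real (R ((F ^^ i) x)) - real L)))"
            using \<open>0 \<le> b\<close> by (intro ennreal_plus mult_nonneg_nonneg sum_nonneg) auto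
          also have "ennreal (b * (\<Sum>i<n. max 0 (real (R ((F ^^ i) x)) - real L))) = ennreal b * (\<Sum>i<n. ennreal (max 0 (real (R ((F ^^ i) x)) - real L)))"
            using \<open>0 \<le> b\<close> by (subst sum_ennreal) (auto simp: ennreal_mult sum_nonneg)
          also have "(\<Sum>i<n. ennreal (max 0 (real (R ((F ^^ i) x)) - real L))) = birkhoff_sum F h2 n x"
            unfolding birkhoff_sum_def h2_def by (intro sum.cong refl) (simp add: max_def ennreal_neg)
          finally have "ennreal S \<le> ennreal (b * real L * real n) * indicator B x + ennreal b * birkhoff_sum F h2 n x"
            using True by simp
          also have "\<dots> \<le> ennreal \<eta>' * birkhoff_sum F h1 n x + (ennreal (real M) + (ennreal (b * real L * real n) * indicator B x + ennreal b * birkhoff_sum F h2 n x))"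
            by (simp add: add_increasing)
          finally show ?thesis unfolding S_def .
        qed
      qed
    qed
    also have "\<dots> = ennreal \<eta>' * (\<integral>\<^sup>+x. birkhoff_sum F h1 n x \<partial>N) + (ennreal (real M) * emeasure N (space N)
        + (ennreal (b * real L * real n) * emeasure N B + ennreal b * (\<integral>\<^sup>+x. birkhoff_sum F h2 n x \<partial>N)))"
      by (simp add: nn_integral_add nn_integral_cmult nn_integral_cmult_indicator)
    also have "\<dots> \<le> ennreal \<eta>' * (of_nat n * (ennreal K1 * ennreal \<rho>)) + (ennreal (real M) * emeasure N (space N)
        + (ennreal (b * real L * real n) * ennreal e + ennreal b * (of_nat n * (ennreal K1 * ennreal t))))"
    proof (intro add_mono mult_left_mono)
      show "(\<integral>\<^sup>+x. birkhoff_sum F h1 n x \<partial>N) \<le> of_nat n * (ennreal K1 * ennreal \<rho>)"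
        using birkhoff_sum_integral_bound[OF h(1), of n] by (simp add: h1_def nn_integral_R \<rho>_def)
      have "(\<integral>\<^sup>+x. birkhoff_sum F h2 n x \<partial>N) \<le> of_nat n * (ennreal K1 * (\<integral>\<^sup>+x. h2 x \<partial>N))"
        by (rule birkhoff_sum_integral_bound[OF h(2)])
      also have "\<dots> \<le> of_nat n * (ennreal K1 * ennreal t)"
        using L by (intro mult_left_mono) (auto simp: h2_def)
      finally show "(\<integral>\<^sup>+x. birkhoff_sum F h2 n x \<partial>N) \<le> of_nat n * (ennreal K1 * ennreal t)" .
      show "emeasure N B \<le> ennreal e" using B'(1) by (simp add: emeasure_eq_measure ennreal_leI)
    qed auto
    also have "\<dots> = ennreal (\<eta>' * (real n * (K1 * \<rho>)) + (real M * V + (b * real L * real n * e + b * (real n * (K1 * t)))))"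
      using \<eta>'(1) K1_pos \<rho> V e(1) t(1) \<open>0 \<le> b\<close>
      by (simp add: V_def emeasure_eq_measure ennreal_of_nat_eq_real_of_nat ennreal_mult)
    also have "\<dots> \<le> ennreal (3 / 4 * \<eta> * real n + real M * V)"
    proof (rule ennreal_leI)
      have "real n * (\<eta>' * (K1 * \<rho>)) \<le> real n * (\<eta> / 4)" "real n * (b * real L * e) \<le> real n * (\<eta> / 4)"
        "real n * (b * (K1 * t)) \<le> real n * (\<eta> / 4)"
        by (intro mult_left_mono \<eta>' e t of_nat_0_le_iff)+
      then show "\<eta>' * (real n * (K1 * \<rho>)) + (real M * V + (b * real L * real n * e + b * (real n * (K1 * t)))) \<le> 3 / 4 * \<eta> * real n + real M * V"
        by (simp add: algebra_simps)
    qed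
    finally show ?thesis .
  qed
  obtain n\<^sub>0 :: nat where n\<^sub>0: "4 * (real M * V) / \<eta> < real n\<^sub>0" using reals_Archimedean2 by blast
  show ?thesis
  proof (rule that[of n\<^sub>0])
    fix n assume "n \<ge> n\<^sub>0"
    then have "4 * (real M * V) / \<eta> < real n" using n\<^sub>0 by (meson of_nat_le_iff order_less_le_trans)
    then have "3 / 4 * \<eta> * real n + real M * V \<le> \<eta> * real n" using \<eta> by (simp add: field_simps)
    then show "(\<integral>\<^sup>+x. ennreal (birkhoff_sum F (induced_sum \<psi>) n x) \<partial>N) \<le> ennreal (\<eta> * real n)"
      using bound[of n] ennreal_leI order_trans by blast
  qed
qed

end

section \<open>Conditional exponential moments of blocks of returns\<close>

text \<open>The deviations of an observable in either direction are those of two observables of this kind.\<close>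

locale uniformly_continuous_observable = expanding_induced_map +
  fixes \<psi> :: "'a \<Rightarrow> real" and b :: real
  assumes \<psi> [measurable]: "\<psi> \<in> borel_measurable m" and b: "\<And>x. x \<in> space m \<Longrightarrow> \<bar>\<psi> x\<bar> \<le> b" and b0: "0 \<le> b"
    and uc: "\<And>e. e > 0 \<Longrightarrow> \<exists>r>0. \<forall>x\<in>space m. \<forall>y\<in>space m. d x y \<le> r \<longrightarrow> \<bar>\<psi> x - \<psi> y\<bar> \<le> e"
    and mean: "(\<integral>x. \<psi> x \<partial>\<mu>) \<le> 0"
begin

text \<open>On a cylinder of length \<open>n\<close> the block sum oscillates by at most
  \<open>V\<close>, and \<open>V\<close> is constant there. The value at a chosen representative
  plus \<open>V\<close> is therefore a majorant constant on cylinders, too large by at most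
  \<open>2 * V\<close>. Only the last \<open>k\<close> returns, with too few common letters left,
  enter \<open>V\<close> without a small factor, and they are negligible in a long block.\<close>

lemma block_majorant:
  assumes \<eta>: "\<eta> > 0"
  obtains n Y D where "n \<ge> 1" "D > 0" "Y \<in> borel_measurable N" "cylinder_constant n Y"
    "\<And>x. x \<in> \<Omega> \<Longrightarrow> birkhoff_sum F (induced_sum \<psi>) n x \<le> Y x"
    "\<And>x. x \<in> \<Omega> \<Longrightarrow> Y x \<le> D * real (return_time n x)"
    "(\<integral>\<^sup>+x. ennreal (Y x) \<partial>N) \<le> ennreal (\<eta> * real n)"
proof -
  define \<rho> where "\<rho> = mean_return_time"
  have \<rho>: "\<rho> \<ge> 0" by (simp add: \<rho>_def mean_return_time_nonneg)
  have K1\<rho>: "K1 * \<rho> \<ge> 0" using K1_pos \<rho> by simp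
  define \<eta>' where "\<eta>' = \<eta> / (8 * (K1 * \<rho> + 1))"
  have \<eta>': "\<eta>' > 0" "2 * \<eta>' * (K1 * \<rho>) \<le> \<eta> / 4" using \<eta> K1\<rho> by (auto simp: \<eta>'_def field_simps)
  obtain r where r: "r > 0" "\<And>x y. x \<in> space m \<Longrightarrow> y \<in> space m \<Longrightarrow> d x y \<le> r \<Longrightarrow> \<bar>\<psi> x - \<psi> y\<bar> \<le> \<eta>'"
    using uc[OF \<eta>'(1)] by blast
  obtain C \<beta> where C: "C > 0" "0 < \<beta>" "\<beta> < 1" and E: "\<forall>\<omega>\<in>P. \<forall>x\<in>\<omega>. \<forall>y\<in>\<omega>.
      d (F x) (F y) \<le> C * enat_power \<beta> (separation_time F P x y) \<and>
      (\<forall>j\<le>R x. d ((f ^^ j) x) ((f ^^ j) y) \<le> C * d (F x) (F y))"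
    using expanding unfolding expanding_def by (elim exE conjE) (rule that)
  have dF: "d (F x) (F y) \<le> C * enat_power \<beta> (separation_time F P x y)"
    and df: "j \<le> R x \<Longrightarrow> d ((f ^^ j) x) ((f ^^ j) y) \<le> C * d (F x) (F y)"
    if "\<omega> \<in> P" "x \<in> \<omega>" "y \<in> \<omega>" for \<omega> x y j
    using E[rule_format, OF that] by simp_all
  \<comment> \<open>The two expansion estimates each cost a factor \<open>C\<close>: with at least
    \<open>k\<close> common letters left, the points of an excursion stay within
    \<open>C * C * \<beta> ^ k < r\<close> of each other.\<close>
  obtain k where k: "\<beta> ^ k < r / (C * C)"
    using real_arch_pow_inv[of "r / (C * C)" \<beta>] r(1) C by auto
  obtain n\<^sub>0 where n\<^sub>0: "\<And>n. n \<ge> n\<^sub>0 \<Longrightarrow> (\<integral>\<^sup>+x. ennreal (birkhoff_sum F (induced_sum \<psi>) n x) \<partial>N) \<le> ennreal (\<eta> / 2 * real n)"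
    using induced_birkhoff_sums_small[OF \<psi> b b0 mean, of "\<eta> / 2"] \<eta> by (metis half_gt_zero)
  obtain n\<^sub>1 :: nat where n\<^sub>1: "16 * (b * real k * (K1 * \<rho>)) / \<eta> < real n\<^sub>1" using reals_Archimedean2 by blast
  define n where "n = max 1 (max n\<^sub>0 n\<^sub>1)"
  have n: "n \<ge> 1" "n \<ge> n\<^sub>0" "n \<ge> n\<^sub>1" by (auto simp: n_def)
  \<comment> \<open>A small weight while at least \<open>k\<close> letters remain, and the trivial
    oscillation \<open>2 * b\<close> afterwards.\<close>
  define v where "v i = (if i + k \<le> n then \<eta>' else 2 * b)" for i
  have v: "0 \<le> v i" "v i \<le> 2 * b + \<eta>'" for i using b0 \<eta>' by (auto simp: v_def)
  define V where "V x = (\<Sum>i<n. v i * real (R ((F ^^ i) x)))" for x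
  have V_meas [measurable]: "V \<in> borel_measurable N"
    unfolding V_def using measurable_compose[OF funpow_measurable R_real_measurable] by measurable
  have V_le: "V x \<le> (2 * b + \<eta>') * real (return_time n x)" for x
    unfolding V_def return_time_real sum_distrib_left using v by (intro sum_mono mult_right_mono) auto
  define S where "S = birkhoff_sum F (induced_sum \<psi>) n"
  have S_meas [measurable]: "S \<in> borel_measurable N"
    unfolding S_def by (intro birkhoff_sum_measurable F_measurable induced_sum_measurable \<psi>)
  have oscillation: "S x \<le> S y + V x"
    if w: "\<And>i. i < n \<Longrightarrow> w i \<in> P" and xy: "x \<in> cylinder n w" "y \<in> cylinder n w" for w x y
  proof -
    have "induced_sum \<psi> ((F ^^ i) x) \<le> induced_sum \<psi> ((F ^^ i) y) + v i * real (R ((F ^^ i) x))" if i: "i < n" for i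
    proof -
      define x' y' where "x' = (F ^^ i) x" and "y' = (F ^^ i) y"
      have \<omega>: "w i \<in> P" "x' \<in> w i" "y' \<in> w i"
        using w[OF i] xy i by (auto simp: cylinder_def x'_def y'_def)
      have sp: "x' \<in> space m" "y' \<in> space m"
        using \<omega> P_subset_space \<Delta>_subset unfolding space_N by blast+
      have diff: "\<psi> ((f ^^ j) x') \<le> \<psi> ((f ^^ j) y') + v i" if j: "j < R x'" for j
      proof (cases "i + k \<le> n")
        case True
        have "d ((f ^^ j) x') ((f ^^ j) y') \<le> C * d (F x') (F y')"
          using df[OF \<omega>] j by simp
        also have "\<dots> \<le> C * (C * enat_power \<beta> (separation_time F P x' y'))"
          using dF[OF \<omega>] C(1) by (intro mult_left_mono) auto
        also have "\<dots> \<le> C * (C * \<beta> ^ (n - i))"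
          using separation_time_cylinder[OF w xy, of i] i C(1-3)
          by (intro mult_left_mono enat_power_le) (auto simp: x'_def y'_def)
        also have "\<dots> \<le> C * (C * \<beta> ^ k)"
          using True C(1-3) by (intro mult_left_mono power_decreasing) auto
        also have "\<dots> \<le> r" using k C(1) by (simp add: field_simps)
        finally have "\<bar>\<psi> ((f ^^ j) x') - \<psi> ((f ^^ j) y')\<bar> \<le> \<eta>'"
          by (intro r f_funpow_space sp)
        then show ?thesis using True by (simp add: v_def)
      next
        case False
        then show ?thesis
          using b[OF f_funpow_space[OF sp(1)], of j] b[OF f_funpow_space[OF sp(2)], of j] by (simp add: v_def)
      qed
      have "induced_sum \<psi> x' \<le> (\<Sum>j<R x'. \<psi> ((f ^^ j) y') + v i)"
        unfolding induced_sum_def birkhoff_sum_def by (intro sum_mono) (simp add: diff)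
      also have "\<dots> = induced_sum \<psi> y' + v i * real (R x')"
        using R_const[OF \<omega>] by (simp add: induced_sum_def birkhoff_sum_def sum.distrib mult.commute)
      finally show ?thesis by (simp add: x'_def y'_def)
    qed
    then have "S x \<le> (\<Sum>i<n. induced_sum \<psi> ((F ^^ i) y) + v i * real (R ((F ^^ i) x)))"
      unfolding S_def birkhoff_sum_def by (intro sum_mono) simp
    then show ?thesis by (simp add: S_def birkhoff_sum_def V_def sum.distrib)
  qed
  have V_const: "V x = V y"
    if w: "\<And>i. i < n \<Longrightarrow> w i \<in> P" and xy: "x \<in> cylinder n w" "y \<in> cylinder n w" for w x y
  proof -
    have "R ((F ^^ i) x) = R ((F ^^ i) y)" if "i < n" for i
      using xy that by (intro R_const[OF w[OF that]]) (simp_all add: cylinder_def)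
    then show ?thesis unfolding V_def by (intro sum.cong refl) simp
  qed
  \<comment> \<open>The word of a point is recovered by choice; disjointness of the members makes it
    unique, so the representative depends on the cylinder only.\<close>
  define itin where "itin x i = (SOME \<omega>. \<omega> \<in> P \<and> (F ^^ i) x \<in> \<omega>)" for x i
  define rep where "rep x = (SOME y. y \<in> cylinder n (itin x))" for x
  \<comment> \<open>The value 0 off the cylinders makes the majorant constant on each of countably
    many measurable pieces, hence measurable although the representatives are arbitrary.\<close>
  define Y where "Y x = (if \<forall>i<n. (F ^^ i) x \<in> \<Union>P then S (rep x) + V x else 0)" for x
  have itin: "cylinder n (itin x) = cylinder n w"
    if w: "\<And>i. i < n \<Longrightarrow> w i \<in> P" and x: "x \<in> cylinder n w" for w x
  proof (rule cylinder_cong)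
    fix i assume i: "i < n"
    then have *: "w i \<in> P \<and> (F ^^ i) x \<in> w i" using w x by (simp add: cylinder_def)
    then have "itin x i \<in> P \<and> (F ^^ i) x \<in> itin x i" unfolding itin_def by (rule someI)
    with * show "itin x i = w i" using P_unique by blast
  qed
  have rep: "rep x \<in> cylinder n w" if w: "\<And>i. i < n \<Longrightarrow> w i \<in> P" and x: "x \<in> cylinder n w" for w x
    using itin[OF w x] x someI[of "\<lambda>y. y \<in> cylinder n w" x] by (simp add: rep_def)
  have inP: "\<forall>i<n. (F ^^ i) x \<in> \<Union>P" if w: "\<And>i. i < n \<Longrightarrow> w i \<in> P" and x: "x \<in> cylinder n w" for w x
    using w x by (auto simp: cylinder_def)
  have Y_const: "cylinder_constant n Y"
    unfolding cylinder_constant_def constant_on_def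
  proof (intro allI impI)
    fix w assume "\<forall>i<n. w i \<in> P"
    then have w: "\<And>i. i < n \<Longrightarrow> w i \<in> P" by blast
    have "Y x = Y y" if xy: "x \<in> cylinder n w" "y \<in> cylinder n w" for x y
    proof -
      have "rep x = rep y" unfolding rep_def using itin[OF w xy(1)] itin[OF w xy(2)] by simp
      then show ?thesis using V_const[OF w xy] inP[OF w xy(1)] inP[OF w xy(2)] by (simp add: Y_def)
    qed
    then show "\<exists>c. \<forall>x\<in>cylinder n w. Y x = c" by blast
  qed
  have Y_meas: "Y \<in> borel_measurable N"
    by (rule cylinder_constant_measurable[OF Y_const, of 0]) (simp only: Y_def if_False)
  have in_cyl: "\<exists>w. (\<forall>i<n. w i \<in> P) \<and> x \<in> cylinder n w" if "x \<in> \<Omega>" for x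
  proof -
    have "\<forall>i. \<exists>\<omega>. \<omega> \<in> P \<and> (F ^^ i) x \<in> \<omega>" using that by (auto simp: \<Omega>_def)
    then obtain w where "\<And>i. w i \<in> P \<and> (F ^^ i) x \<in> w i" by metis
    then show ?thesis using that by (intro exI[of _ w]) (auto simp: cylinder_def \<Omega>_def space_N)
  qed
  have Y_ge: "S x \<le> Y x" and Y_le: "Y x \<le> S x + 2 * V x" if x\<Omega>: "x \<in> \<Omega>" for x
  proof -
    obtain w where "\<forall>i<n. w i \<in> P" and x: "x \<in> cylinder n w" using in_cyl[OF x\<Omega>] by blast
    then have w: "\<And>i. i < n \<Longrightarrow> w i \<in> P" by blast
    have Y: "Y x = S (rep x) + V x" using inP[OF w x] by (simp add: Y_def)
    show "S x \<le> Y x" unfolding Y by (rule oscillation[OF w x rep[OF w x]])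
    have "S (rep x) \<le> S x + V x"
      using oscillation[OF w rep[OF w x] x] V_const[OF w rep[OF w x] x] by simp
    then show "Y x \<le> S x + 2 * V x" unfolding Y by simp
  qed
  have sum_v: "(\<Sum>i<n. v i) \<le> real n * \<eta>' + 2 * b * real k"
  proof -
    have "(\<Sum>i<n. v i) \<le> (\<Sum>i<n. \<eta>' + (if i \<in> {n-k..<n} then 2 * b else 0))"
      using b0 \<eta>' by (intro sum_mono) (auto simp: v_def)
    also have "\<dots> = real n * \<eta>' + (\<Sum>i\<in>{n-k..<n}. 2 * b)"
    proof -
      have "{..<n} \<inter> {n-k..<n} = {n-k..<n}" by auto
      then have "(\<Sum>i<n. if i \<in> {n-k..<n} then 2 * b else 0) = (\<Sum>i\<in>{n-k..<n}. 2 * b)"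
        using sum.inter_restrict[of "{..<n}" "\<lambda>_. 2 * b" "{n-k..<n}"] by simp
      then show ?thesis by (simp add: sum.distrib)
    qed
    also have "\<dots> \<le> real n * \<eta>' + 2 * b * real k"
    proof -
      have "real (n - (n - k)) \<le> real k" by simp
      then have "real (n - (n - k)) * (2 * b) \<le> real k * (2 * b)" using b0 by (intro mult_right_mono) auto
      then show ?thesis by (simp add: mult.commute)
    qed
    finally show ?thesis .
  qed
  have int_V: "(\<integral>\<^sup>+x. ennreal (V x) \<partial>N) \<le> ennreal ((real n * \<eta>' + 2 * b * real k) * (K1 * \<rho>))"
  proof -
    have [measurable]: "(\<lambda>x. real (R ((F ^^ i) x))) \<in> borel_measurable N" for i
      using measurable_compose[OF funpow_measurable R_real_measurable] .
    have "(\<integral>\<^sup>+x. ennreal (V x) \<partial>N) = (\<integral>\<^sup>+x. (\<Sum>i<n. ennreal (v i) * ennreal (real (R ((F ^^ i) x)))) \<partial>N)"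
      unfolding V_def using v by (intro nn_integral_cong) (simp add: sum_ennreal[symmetric] ennreal_mult)
    also have "\<dots> = (\<Sum>i<n. ennreal (v i) * (\<integral>\<^sup>+x. ennreal (real (R ((F ^^ i) x))) \<partial>N))"
      by (subst nn_integral_sum) (auto simp: nn_integral_cmult)
    also have "\<dots> \<le> (\<Sum>i<n. ennreal (v i) * (ennreal K1 * ennreal \<rho>))"
    proof (intro sum_mono mult_left_mono)
      fix i show "(\<integral>\<^sup>+x. ennreal (real (R ((F ^^ i) x))) \<partial>N) \<le> ennreal K1 * ennreal \<rho>"
        using iterate_integral_bound[of "\<lambda>x. ennreal (real (R x))" i] by (simp add: nn_integral_R \<rho>_def)
    qed auto
    also have "\<dots> = ennreal ((\<Sum>i<n. v i) * (K1 * \<rho>))"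
      using v K1_pos \<rho> by (simp add: sum_distrib_right[symmetric] sum_ennreal ennreal_mult sum_nonneg)
    also have "\<dots> \<le> ennreal ((real n * \<eta>' + 2 * b * real k) * (K1 * \<rho>))"
      by (intro ennreal_leI mult_right_mono sum_v K1\<rho>)
    finally show ?thesis .
  qed
  have "(\<integral>\<^sup>+x. ennreal (Y x) \<partial>N) \<le> (\<integral>\<^sup>+x. ennreal (S x) + 2 * ennreal (V x) \<partial>N)"
  proof (rule nn_integral_mono_AE)
    have V_nonneg: "V x \<ge> 0" for x unfolding V_def using v by (intro sum_nonneg mult_nonneg_nonneg) auto
    show "AE x in N. ennreal (Y x) \<le> ennreal (S x) + 2 * ennreal (V x)"
      using AE_\<Omega>
    proof eventually_elim
      case (elim x)
      have "ennreal (Y x) \<le> ennreal (max 0 (S x) + 2 * V x)"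
        using Y_le[OF elim] by (intro ennreal_leI) auto
      also have "\<dots> = ennreal (max 0 (S x)) + ennreal (2 * V x)"
        using V_nonneg by (intro ennreal_plus) auto
      also have "\<dots> = ennreal (S x) + 2 * ennreal (V x)"
        using V_nonneg[of x] by (simp add: ennreal_mult max_def ennreal_neg)
      finally show ?case .
    qed
  qed
  also have "\<dots> = (\<integral>\<^sup>+x. ennreal (S x) \<partial>N) + 2 * (\<integral>\<^sup>+x. ennreal (V x) \<partial>N)"
    by (simp add: nn_integral_add nn_integral_cmult)
  also have "\<dots> \<le> ennreal (\<eta> / 2 * real n) + 2 * ennreal ((real n * \<eta>' + 2 * b * real k) * (K1 * \<rho>))"
    using n\<^sub>0[OF n(2)] int_V unfolding S_def by (intro add_mono mult_left_mono) auto
  also have "\<dots> = ennreal (\<eta> / 2 * real n + 2 * ((real n * \<eta>' + 2 * b * real k) * (K1 * \<rho>)))"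
  proof -
    define W where "W = (real n * \<eta>' + 2 * b * real k) * (K1 * \<rho>)"
    have "0 \<le> W"
      unfolding W_def by (rule mult_nonneg_nonneg[OF _ K1\<rho>]) (use \<eta>' b0 in simp)
    then have "ennreal (\<eta> / 2 * real n) + 2 * ennreal W = ennreal (\<eta> / 2 * real n + 2 * W)"
      using \<eta> by (simp add: ennreal_mult ennreal_plus)
    then show ?thesis by (simp only: W_def)
  qed
  also have "\<dots> \<le> ennreal (\<eta> * real n)"
  proof (rule ennreal_leI)
    have "real n * (2 * \<eta>' * (K1 * \<rho>)) \<le> real n * (\<eta> / 4)" by (intro mult_left_mono \<eta>'(2)) simp
    moreover have "16 * (b * real k * (K1 * \<rho>)) / \<eta> < real n" using n\<^sub>1 n(3) by (meson of_nat_le_iff order_less_le_trans)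
    then have "16 * (b * real k * (K1 * \<rho>)) \<le> \<eta> * real n" using \<eta> by (simp add: field_simps)
    ultimately show "\<eta> / 2 * real n + 2 * ((real n * \<eta>' + 2 * b * real k) * (K1 * \<rho>)) \<le> \<eta> * real n"
      by (simp add: algebra_simps)
  qed
  finally have int_Y: "(\<integral>\<^sup>+x. ennreal (Y x) \<partial>N) \<le> ennreal (\<eta> * real n)" .
  show ?thesis
  proof (rule that[OF n(1) _ Y_meas Y_const _ _ int_Y])
    \<comment> \<open>Per unit of return time, the block sum contributes \<open>b\<close> and
      \<open>2 * V\<close> contributes \<open>2 * (2 * b + \<eta>')\<close>.\<close>
    show "5 * b + 2 * \<eta>' > 0" using b0 \<eta>' by simp
    show "birkhoff_sum F (induced_sum \<psi>) n x \<le> Y x" if "x \<in> \<Omega>" for x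
      using Y_ge[OF that] by (simp add: S_def)
    show "Y x \<le> (5 * b + 2 * \<eta>') * real (return_time n x)" if "x \<in> \<Omega>" for x
    proof -
      have "S x \<le> b * real (return_time n x)"
        using induced_birkhoff_sum_abs_le[of \<psi> b x n, OF b that] by (simp add: S_def)
      then show ?thesis using Y_le[OF that] V_le[of x] by (simp add: algebra_simps)
    qed
  qed
qed

end

section \<open>Products over successive blocks\<close>

context WGM_map
begin

lemma cylinder_constantI:
  assumes "\<And>w x y. (\<And>i. i < n \<Longrightarrow> w i \<in> P) \<Longrightarrow> x \<in> cylinder n w \<Longrightarrow> y \<in> cylinder n w \<Longrightarrow> u x = u y"
  shows "cylinder_constant n u"
  unfolding cylinder_constant_def constant_on_def
proof (intro allI impI)
  fix w assume "\<forall>i<n. w i \<in> P"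
  then have "u x = u y" if "x \<in> cylinder n w" "y \<in> cylinder n w" for x y
    using assms[of w x y] that by blast
  then show "\<exists>c. \<forall>x\<in>cylinder n w. u x = c" by blast
qed

lemma cylinder_constantD:
  assumes "cylinder_constant n u" "\<And>i. i < n \<Longrightarrow> w i \<in> P" "x \<in> cylinder n w" "y \<in> cylinder n w"
  shows "u x = u y"
  using assms unfolding cylinder_constant_def constant_on_def by metis

lemma funpow_cylinder:
  assumes "x \<in> cylinder n w" "j + l \<le> n"
  shows "(F ^^ j) x \<in> cylinder l (\<lambda>i. w (j + i))"
proof -
  have "(F ^^ i) ((F ^^ j) x) = (F ^^ (j + i)) x" for i
    by (subst add.commute) (simp add: funpow_add)
  then show ?thesis
    using assms funpow_space[of x j] by (auto simp: cylinder_def)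
qed

lemma cylinder_constant_funpow:
  assumes "cylinder_constant l u" "j + l \<le> n"
  shows "cylinder_constant n (\<lambda>x. u ((F ^^ j) x))"
proof (rule cylinder_constantI)
  fix w x y assume w: "\<And>i. i < n \<Longrightarrow> w i \<in> P" and xy: "x \<in> cylinder n w" "y \<in> cylinder n w"
  show "u ((F ^^ j) x) = u ((F ^^ j) y)"
    by (rule cylinder_constantD[OF assms(1) _ funpow_cylinder[OF xy(1) assms(2)] funpow_cylinder[OF xy(2) assms(2)]])
      (use assms(2) w in auto)
qed

lemma cylinder_constant_prod:
  assumes "\<And>i. i \<in> I \<Longrightarrow> cylinder_constant n (u i)"
  shows "cylinder_constant n (\<lambda>x. \<Prod>i\<in>I. u i x)"
  by (intro cylinder_constantI prod.cong refl) (rule cylinder_constantD[OF assms])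

text \<open>The product of the first \<open>k\<close> blocks is constant on cylinders of length
  \<open>k * l\<close> and may serve as the past. Quasi-independence is applied to \<open>g'\<close>
  only: the summand 1 passes through with factor 1, so \<open>K\<close> multiplies a small integral
  instead of the whole product at every block.\<close>

lemma nn_integral_prod_blocks:
  fixes g g' :: "'a \<Rightarrow> ennreal"
  assumes [measurable]: "g \<in> borel_measurable N" "g' \<in> borel_measurable N"
    and g: "cylinder_constant l g" and le: "\<And>x. g x \<le> 1 + g' x"
  shows "(\<integral>\<^sup>+x. (\<Prod>j<k. g ((F ^^ (j * l)) x)) \<partial>N) \<le> (1 + ennreal K * (\<integral>\<^sup>+x. g' x \<partial>N)) ^ k * emeasure N (space N)"
proof (induction k)
  case (Suc k)
  define u where "u x = (\<Prod>j<k. g ((F ^^ (j * l)) x))" for x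
  have [measurable]: "u \<in> borel_measurable N" unfolding u_def by measurable
  have u: "cylinder_constant (k * l) u"
    unfolding u_def
  proof (rule cylinder_constant_prod)
    fix j assume "j \<in> {..<k}"
    then have "Suc j * l \<le> k * l" by (intro mult_right_mono) auto
    then show "cylinder_constant (k * l) (\<lambda>x. g ((F ^^ (j * l)) x))"
      by (intro cylinder_constant_funpow[OF g]) simp
  qed
  have "(\<integral>\<^sup>+x. (\<Prod>j<Suc k. g ((F ^^ (j * l)) x)) \<partial>N) = (\<integral>\<^sup>+x. u x * g ((F ^^ (k * l)) x) \<partial>N)"
    by (simp add: u_def)
  also have "\<dots> \<le> (\<integral>\<^sup>+x. u x + u x * g' ((F ^^ (k * l)) x) \<partial>N)"
  proof (rule nn_integral_mono)
    fix x
    have "u x * g ((F ^^ (k * l)) x) \<le> u x * (1 + g' ((F ^^ (k * l)) x))" by (intro mult_left_mono le) simp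
    then show "u x * g ((F ^^ (k * l)) x) \<le> u x + u x * g' ((F ^^ (k * l)) x)" by (simp add: distrib_left)
  qed
  also have "\<dots> = (\<integral>\<^sup>+x. u x \<partial>N) + (\<integral>\<^sup>+x. u x * g' ((F ^^ (k * l)) x) \<partial>N)"
    by (rule nn_integral_add) measurable
  also have "\<dots> \<le> (\<integral>\<^sup>+x. u x \<partial>N) + ennreal K * (\<integral>\<^sup>+x. u x \<partial>N) * (\<integral>\<^sup>+x. g' x \<partial>N)"
    by (intro add_left_mono quasi_independence u) measurable
  also have "\<dots> = (1 + ennreal K * (\<integral>\<^sup>+x. g' x \<partial>N)) * (\<integral>\<^sup>+x. u x \<partial>N)"
    unfolding distrib_right mult_1_left by (simp only: mult_ac)
  also have "\<dots> \<le> (1 + ennreal K * (\<integral>\<^sup>+x. g' x \<partial>N)) * ((1 + ennreal K * (\<integral>\<^sup>+x. g' x \<partial>N)) ^ k * emeasure N (space N))"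
    using Suc unfolding u_def by (intro mult_left_mono) auto
  finally show ?case by (simp add: mult.assoc)
qed simp

end

section \<open>Truncation of the return time\<close>

context expanding_induced_map
begin

text \<open>The argument is real because the tail is needed at integer truncation levels and also at
  levels such as \<open>1 / (D * \<theta>)\<close>.\<close>

definition tail :: "real \<Rightarrow> real" where
  "tail s = measure N {x \<in> \<Delta>. real (R x) > s}"

lemma tail_sets [measurable]: "{x \<in> \<Delta>. real (R x) > s} \<in> sets N"
proof -
  have "{x \<in> space N. real (R x) > s} \<in> sets N" by measurable
  then show ?thesis by (simp add: space_N)
qed

lemma tail_nonneg: "0 \<le> tail s"
  by (simp add: tail_def)

lemma tail_antimono: "s \<le> t \<Longrightarrow> tail t \<le> tail s"
  unfolding tail_def by (intro finite_measure_mono) auto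

lemma \<Omega>_sets [measurable]: "\<Omega> \<in> sets N"
proof -
  note [measurable] = P_Union_sets
  have "{x \<in> space N. \<forall>i. (F ^^ i) x \<in> \<Union>P} \<in> sets N" by measurable
  then show ?thesis by (simp add: \<Omega>_def space_N)
qed

lemma R_funpow_measurable [measurable]: "(\<lambda>x. R ((F ^^ i) x)) \<in> N \<rightarrow>\<^sub>M count_space UNIV"
  by (rule measurable_compose[OF funpow_measurable R_measurable])

lemma R_cylinder_constant: "cylinder_constant 1 R"
  by (intro cylinder_constantI) (auto simp: cylinder_def intro: R_const)

lemma emeasure_iterate_tail:
  shows "emeasure N {x \<in> \<Delta>. \<exists>i<n. real (R ((F ^^ i) x)) > s} \<le> ennreal (real n * K1 * tail s)"
proof -
  define h :: "'a \<Rightarrow> ennreal" where "h = indicator {x \<in> \<Delta>. real (R x) > s}"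
  have h [measurable]: "h \<in> borel_measurable N" unfolding h_def by measurable
  have "emeasure N {x \<in> \<Delta>. \<exists>i<n. real (R ((F ^^ i) x)) > s} = (\<integral>\<^sup>+x. indicator {x \<in> \<Delta>. \<exists>i<n. real (R ((F ^^ i) x)) > s} x \<partial>N)"
  proof (rule nn_integral_indicator[symmetric])
    have "{x \<in> space N. \<exists>i<n. real (R ((F ^^ i) x)) > s} \<in> sets N" by measurable
    then show "{x \<in> \<Delta>. \<exists>i<n. real (R ((F ^^ i) x)) > s} \<in> sets N" unfolding space_N .
  qed
  also have "\<dots> \<le> (\<integral>\<^sup>+x. birkhoff_sum F h n x \<partial>N)"
  proof (rule nn_integral_mono)
    fix x assume x: "x \<in> space N"
    show "indicator {x \<in> \<Delta>. \<exists>i<n. real (R ((F ^^ i) x)) > s} x \<le> birkhoff_sum F h n x"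
    proof (cases "\<exists>i<n. real (R ((F ^^ i) x)) > s")
      case True
      then obtain i where i: "i < n" "real (R ((F ^^ i) x)) > s" by blast
      then have "h ((F ^^ i) x) = 1" using funpow_space[OF x, of i] by (simp add: h_def space_N)
      moreover have "h ((F ^^ i) x) \<le> birkhoff_sum F h n x"
        unfolding birkhoff_sum_def using i(1) by (intro member_le_sum) auto
      ultimately show ?thesis by (auto simp: indicator_def)
    qed simp
  qed
  also have "\<dots> \<le> of_nat n * (ennreal K1 * (\<integral>\<^sup>+x. h x \<partial>N))"
    by (rule birkhoff_sum_integral_bound[OF h])
  also have "(\<integral>\<^sup>+x. h x \<partial>N) = ennreal (tail s)"
    by (simp add: h_def tail_def emeasure_eq_measure)
  also have "of_nat n * (ennreal K1 * ennreal (tail s)) = ennreal (real n * K1 * tail s)"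
    using K1_pos tail_nonneg by (simp add: ennreal_of_nat_eq_real_of_nat ennreal_mult mult.assoc)
  finally show ?thesis .
qed

text \<open>While \<open>\<theta> * Y \<le> 1\<close>, the exponential is linear up to a factor 2
  and the small integral of the positive part decides. A larger value forces one of the
  \<open>l\<close> returns above \<open>1 / (\<theta> * D * l)\<close>; such points are rare, and
  the truncation at \<open>T\<close> bounds the exponential there.\<close>

lemma truncated_exponential_bound:
  assumes l: "l \<ge> 1" and D: "D > 0" and Y [measurable]: "Y \<in> borel_measurable N"
    and Y_le: "\<And>x. x \<in> \<Omega> \<Longrightarrow> Y x \<le> D * real (return_time l x)"
    and int_Y: "(\<integral>\<^sup>+x. ennreal (Y x) \<partial>N) \<le> ennreal (\<eta> * real l)" and \<eta>: "\<eta> > 0" and \<theta>: "\<theta> > 0"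
  shows "(\<integral>\<^sup>+x. (if \<forall>i<l. R ((F ^^ i) x) \<le> T then ennreal (exp (\<theta> * Y x) - 1) else 0) \<partial>N)
    \<le> ennreal (2 * \<theta> * \<eta> * real l + exp (\<theta> * D * real l * real T) * (real l * K1 * tail (1 / (\<theta> * D * real l))))"
proof -
  define s where "s = 1 / (\<theta> * D * real l)"
  define E where "E = {x \<in> \<Delta>. \<exists>i<l. real (R ((F ^^ i) x)) > s}"
  have E [measurable]: "E \<in> sets N"
  proof -
    have "{x \<in> space N. \<exists>i<l. real (R ((F ^^ i) x)) > s} \<in> sets N" by measurable
    then show ?thesis unfolding space_N E_def .
  qed
  define c where "c = exp (\<theta> * D * real l * real T)"
  have "(\<integral>\<^sup>+x. (if \<forall>i<l. R ((F ^^ i) x) \<le> T then ennreal (exp (\<theta> * Y x) - 1) else 0) \<partial>N)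
    \<le> (\<integral>\<^sup>+x. ennreal (2 * \<theta>) * ennreal (Y x) + ennreal c * indicator E x \<partial>N)"
  proof (rule nn_integral_mono_AE)
    show "AE x in N. (if \<forall>i<l. R ((F ^^ i) x) \<le> T then ennreal (exp (\<theta> * Y x) - 1) else 0)
        \<le> ennreal (2 * \<theta>) * ennreal (Y x) + ennreal c * indicator E x"
      using AE_\<Omega>
    proof eventually_elim
      case (elim x)
      show ?case
      proof (cases "\<forall>i<l. R ((F ^^ i) x) \<le> T")
        case T: True
        consider "Y x \<le> 0" | "0 < Y x" "\<theta> * Y x \<le> 1" | "\<theta> * Y x > 1" by linarith
        then have "ennreal (exp (\<theta> * Y x) - 1) \<le> ennreal (2 * \<theta>) * ennreal (Y x) + ennreal c * indicator E x"
        proof cases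
          case 1
          then have "exp (\<theta> * Y x) - 1 \<le> 0" using \<theta> by (simp add: mult_nonneg_nonpos)
          then show ?thesis by (simp add: ennreal_neg)
        next
          case 2
          then have "exp (\<theta> * Y x) \<le> 1 + \<theta> * Y x + (\<theta> * Y x)\<^sup>2" using \<theta> by (intro exp_bound) auto
          also have "(\<theta> * Y x)\<^sup>2 \<le> \<theta> * Y x" using 2 \<theta> by (simp add: power2_eq_square mult_left_le)
          finally have "ennreal (exp (\<theta> * Y x) - 1) \<le> ennreal (2 * \<theta> * Y x)" by (intro ennreal_leI) simp
          also have "\<dots> = ennreal (2 * \<theta>) * ennreal (Y x)" using \<theta> 2 by (intro ennreal_mult) auto
          finally show ?thesis by (rule order_trans) simp
        next
          case 3
          have rt: "real (return_time l x) \<le> real l * real T"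
          proof -
            have "real (return_time l x) \<le> (\<Sum>i<l. real T)"
              unfolding return_time_real using T by (intro sum_mono) auto
            then show ?thesis by simp
          qed
          have YD: "\<theta> * Y x \<le> \<theta> * (D * real (return_time l x))" using Y_le[OF elim] \<theta> by (intro mult_left_mono) auto
          have "x \<in> E"
          proof (rule ccontr)
            assume "x \<notin> E"
            moreover have "x \<in> \<Delta>" using elim by (simp add: \<Omega>_def)
            ultimately have "\<not> real (R ((F ^^ i) x)) > s" if "i < l" for i
              using that unfolding E_def by blast
            then have "real (R ((F ^^ i) x)) \<le> s" if "i < l" for i
              using that by (simp add: not_less)
            then have "real (return_time l x) \<le> (\<Sum>i<l. s)" unfolding return_time_real by (intro sum_mono) auto
            then have "\<theta> * (D * real (return_time l x)) \<le> \<theta> * (D * (real l * s))"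
              using \<theta> D by (intro mult_left_mono) auto
            also have "\<dots> = 1" using \<theta> D l by (simp add: s_def)
            finally show False using 3 YD by simp
          qed
          have "\<theta> * (D * real (return_time l x)) \<le> \<theta> * (D * (real l * real T))"
            using rt \<theta> D by (intro mult_left_mono) auto
          then have "exp (\<theta> * Y x) \<le> c" using YD by (simp add: c_def mult.assoc)
          then have "ennreal (exp (\<theta> * Y x) - 1) \<le> ennreal c" by (intro ennreal_leI) simp
          then show ?thesis using \<open>x \<in> E\<close> by (simp add: add_increasing)
        qed
        then show ?thesis using T by simp
      next
        case False
        then show ?thesis by (simp only: if_False zero_le)
      qed
    qed
  qed
  also have "\<dots> = ennreal (2 * \<theta>) * (\<integral>\<^sup>+x. ennreal (Y x) \<partial>N) + ennreal c * emeasure N E"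
    by (simp add: nn_integral_add nn_integral_cmult nn_integral_cmult_indicator)
  also have "\<dots> \<le> ennreal (2 * \<theta>) * ennreal (\<eta> * real l) + ennreal c * ennreal (real l * K1 * tail s)"
    using emeasure_iterate_tail[of l s] int_Y unfolding E_def by (intro add_mono mult_left_mono) auto
  also have "\<dots> = ennreal (2 * \<theta> * (\<eta> * real l) + c * (real l * K1 * tail s))"
    using \<theta> \<eta> K1_pos tail_nonneg[of s] by (simp only: ennreal_mult[symmetric] ennreal_plus[symmetric] c_def exp_ge_zero mult_nonneg_nonneg less_imp_le of_nat_0_le_iff zero_le_numeral)
  finally show ?thesis by (simp add: c_def s_def mult.assoc)
qed

end

section \<open>Chernoff bound over blocks\<close>

context uniformly_continuous_observable
begin

text \<open>Time \<open>k\<close> consists of whole blocks and an incomplete one, which costs at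
  most \<open>b * l * T\<close>. On the event all returns are at most \<open>T\<close>, so no factor
  \<open>g\<close> is cut off and their product is the exponential of \<theta> times the sum of the
  majorants. Markov's inequality and a union over the block ends conclude.\<close>

lemma block_deviation:
  assumes l: "l \<ge> 1" and Y [measurable]: "Y \<in> borel_measurable N" and Y_const: "cylinder_constant l Y"
    and Y_ge: "\<And>x. x \<in> \<Omega> \<Longrightarrow> birkhoff_sum F (induced_sum \<psi>) l x \<le> Y x"
    and \<theta>: "\<theta> > 0" and q: "q \<ge> 0"
    and int: "(\<integral>\<^sup>+x. (if \<forall>i<l. R ((F ^^ i) x) \<le> T then ennreal (exp (\<theta> * Y x) - 1) else 0) \<partial>N) \<le> ennreal q"
  shows "emeasure N {x \<in> \<Omega>. (\<forall>i\<le>n. R ((F ^^ i) x) \<le> T) \<and> (\<exists>k\<le>n. birkhoff_sum F (induced_sum \<psi>) k x > s + b * real l * real T)}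
    \<le> ennreal (real (n + 1) * exp (- \<theta> * s + K * q * real n / real l) * measure N (space N))"
    (is "emeasure N ?E \<le> _")
proof -
  define g where "g x = (if \<forall>i<l. R ((F ^^ i) x) \<le> T then ennreal (exp (\<theta> * Y x)) else 0)" for x
  define g' where "g' x = (if \<forall>i<l. R ((F ^^ i) x) \<le> T then ennreal (exp (\<theta> * Y x) - 1) else 0)" for x
  have g_meas [measurable]: "g \<in> borel_measurable N" "g' \<in> borel_measurable N"
    unfolding g_def g'_def by measurable
  have g_le: "g x \<le> 1 + g' x" for x
  proof -
    have "ennreal (exp (\<theta> * Y x)) \<le> ennreal (1 + max 0 (exp (\<theta> * Y x) - 1))" by (intro ennreal_leI) auto
    also have "\<dots> = 1 + ennreal (exp (\<theta> * Y x) - 1)" by (subst ennreal_plus) (auto simp: max_def ennreal_neg)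
    finally show ?thesis by (simp add: g_def g'_def)
  qed
  have g_const: "cylinder_constant l g"
  proof (rule cylinder_constantI)
    fix w x y assume w: "\<And>i. i < l \<Longrightarrow> w i \<in> P" and xy: "x \<in> cylinder l w" "y \<in> cylinder l w"
    have "R ((F ^^ i) x) = R ((F ^^ i) y)" if "i < l" for i
      using xy that by (intro R_const[OF w[OF that]]) (simp_all add: cylinder_def)
    moreover have "Y x = Y y" by (rule cylinder_constantD[OF Y_const w xy])
    ultimately show "g x = g y" by (simp add: g_def)
  qed
  define u where "u j x = (\<Prod>i<j. g ((F ^^ (i * l)) x))" for j x
  have [measurable]: "u j \<in> borel_measurable N" for j unfolding u_def by measurable
  have W: "1 + ennreal K * (\<integral>\<^sup>+x. g' x \<partial>N) \<le> ennreal (exp (K * q))"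
  proof -
    have "1 + ennreal K * (\<integral>\<^sup>+x. g' x \<partial>N) \<le> 1 + ennreal K * ennreal q"
      using int unfolding g'_def by (intro add_left_mono mult_left_mono) auto
    also have "\<dots> = ennreal (1 + K * q)" using K_pos q by (simp add: ennreal_plus ennreal_mult)
    also have "\<dots> \<le> ennreal (exp (K * q))" by (intro ennreal_leI exp_ge_add_one_self)
    finally show ?thesis .
  qed
  have int_u: "(\<integral>\<^sup>+x. u j x \<partial>N) \<le> ennreal (exp (K * q * real n / real l) * measure N (space N))" if "j * l \<le> n" for j
  proof -
    have "(\<integral>\<^sup>+x. u j x \<partial>N) \<le> (1 + ennreal K * (\<integral>\<^sup>+x. g' x \<partial>N)) ^ j * emeasure N (space N)"
      unfolding u_def by (rule nn_integral_prod_blocks[OF g_meas g_const g_le])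
    also have "\<dots> \<le> ennreal (exp (K * q)) ^ j * emeasure N (space N)"
      by (intro mult_right_mono power_mono W) auto
    also have "\<dots> = ennreal (exp (K * q) ^ j * measure N (space N))"
      by (simp add: emeasure_eq_measure ennreal_mult ennreal_power)
    also have "\<dots> \<le> ennreal (exp (K * q * real n / real l) * measure N (space N))"
    proof (intro ennreal_leI mult_right_mono)
      \<comment> \<open>There are at most \<open>n / l\<close> blocks, each contributing a factor at
        most \<open>exp (K * q)\<close>.\<close>
      have "real j \<le> real n / real l" using that l by (simp add: field_simps flip: of_nat_mult)
      then have "real j * (K * q) \<le> real n / real l * (K * q)" using K_pos q by (intro mult_right_mono) auto
      then show "exp (K * q) ^ j \<le> exp (K * q * real n / real l)"
        by (simp add: exp_of_nat_mult[symmetric] mult_ac)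
    qed simp
    finally show ?thesis .
  qed
  define A where "A j = {x \<in> space N. 1 \<le> ennreal (exp (- \<theta> * s)) * u j x}" for j
  have A [measurable]: "A j \<in> sets N" for j unfolding A_def by measurable
  have sub: "?E \<subseteq> (\<Union>j\<in>{..n div l}. A j)"
  proof
    fix x assume "x \<in> ?E"
    then obtain k where x: "x \<in> \<Omega>" "\<And>i. i \<le> n \<Longrightarrow> R ((F ^^ i) x) \<le> T" and k: "k \<le> n"
      "birkhoff_sum F (induced_sum \<psi>) k x > s + b * real l * real T" by blast
    define j r where "j = k div l" and "r = k mod l"
    have jr: "k = j * l + r" "r < l" using l by (auto simp: j_def r_def)
    have blocks: "birkhoff_sum F (induced_sum \<psi>) (j * l) x \<le> (\<Sum>i<j. Y ((F ^^ (i * l)) x))" for j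
    proof (induction j)
      case (Suc j)
      have "birkhoff_sum F (induced_sum \<psi>) (Suc j * l) x
        = birkhoff_sum F (induced_sum \<psi>) (j * l) x + birkhoff_sum F (induced_sum \<psi>) l ((F ^^ (j * l)) x)"
        using birkhoff_sum_add[of F "induced_sum \<psi>" "j * l" l x] by (simp add: add.commute)
      also have "\<dots> \<le> (\<Sum>i<j. Y ((F ^^ (i * l)) x)) + Y ((F ^^ (j * l)) x)"
        by (intro add_mono Suc Y_ge \<Omega>_funpow x)
      finally show ?case by simp
    qed simp
    have "birkhoff_sum F (induced_sum \<psi>) r ((F ^^ (j * l)) x) \<le> b * real (return_time r ((F ^^ (j * l)) x))"
      using induced_birkhoff_sum_abs_le[of \<psi> b "(F ^^ (j * l)) x" r, OF b \<Omega>_funpow[OF x(1)]] by simp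
    also have "\<dots> \<le> b * (real l * real T)"
    proof (rule mult_left_mono)
      have "real (return_time r ((F ^^ (j * l)) x)) \<le> (\<Sum>i<r. real T)"
        unfolding return_time_real
      proof (rule sum_mono)
        fix i assume "i \<in> {..<r}"
        then have "R ((F ^^ (i + j * l)) x) \<le> T" using jr k(1) by (intro x) auto
        then show "real (R ((F ^^ i) ((F ^^ (j * l)) x))) \<le> real T" by (simp add: funpow_add)
      qed
      also have "\<dots> \<le> real l * real T" using jr(2) by (simp add: mult_right_mono)
      finally show "real (return_time r ((F ^^ (j * l)) x)) \<le> real l * real T" .
    qed (rule b0)
    finally have "birkhoff_sum F (induced_sum \<psi>) k x \<le> (\<Sum>i<j. Y ((F ^^ (i * l)) x)) + b * (real l * real T)"
      using blocks[of j] birkhoff_sum_add[of F "induced_sum \<psi>" "j * l" r x] by (simp add: jr(1))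
    with k(2) have s_le: "s \<le> (\<Sum>i<j. Y ((F ^^ (i * l)) x))" by (simp add: mult.assoc)
    have "u j x = (\<Prod>i<j. ennreal (exp (\<theta> * Y ((F ^^ (i * l)) x))))"
      unfolding u_def
    proof (rule prod.cong[OF refl])
      fix i assume "i \<in> {..<j}"
      then have "Suc i * l \<le> j * l" by (intro mult_right_mono) auto
      then have il: "i * l + l \<le> k" using jr(1) by simp
      have "R ((F ^^ i') ((F ^^ (i * l)) x)) \<le> T" if "i' < l" for i'
      proof -
        have "R ((F ^^ (i' + i * l)) x) \<le> T" using il k(1) that by (intro x) auto
        then show ?thesis by (simp add: funpow_add)
      qed
      then show "g ((F ^^ (i * l)) x) = ennreal (exp (\<theta> * Y ((F ^^ (i * l)) x)))" by (simp add: g_def)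
    qed
    also have "\<dots> = ennreal (exp (\<theta> * (\<Sum>i<j. Y ((F ^^ (i * l)) x))))"
      by (simp add: prod_ennreal exp_sum sum_distrib_left)
    finally have u: "u j x = ennreal (exp (\<theta> * (\<Sum>i<j. Y ((F ^^ (i * l)) x))))" .
    have "1 \<le> exp (- \<theta> * s) * exp (\<theta> * (\<Sum>i<j. Y ((F ^^ (i * l)) x)))"
      using s_le \<theta> by (simp add: exp_add[symmetric])
    then have "ennreal 1 \<le> ennreal (exp (- \<theta> * s) * exp (\<theta> * (\<Sum>i<j. Y ((F ^^ (i * l)) x))))" by (rule ennreal_leI)
    then have "x \<in> A j" using x(1) u by (simp add: A_def ennreal_mult \<Omega>_def space_N)
    moreover have "j \<le> n div l" unfolding j_def using k(1) by (rule div_le_mono)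
    ultimately show "x \<in> (\<Union>j\<in>{..n div l}. A j)" by blast
  qed
  have "emeasure N ?E \<le> emeasure N (\<Union>j\<in>{..n div l}. A j)"
    using sub by (rule emeasure_mono) auto
  also have "\<dots> \<le> (\<Sum>j\<in>{..n div l}. emeasure N (A j))"
    by (rule emeasure_subadditive_finite) auto
  also have "\<dots> \<le> (\<Sum>j\<in>{..n div l}. ennreal (exp (- \<theta> * s + K * q * real n / real l) * measure N (space N)))"
  proof (rule sum_mono)
    fix j assume "j \<in> {..n div l}"
    then have "j * l \<le> n div l * l" by (intro mult_right_mono) auto
    also have "\<dots> \<le> n" by simp
    finally have jl: "j * l \<le> n" .
    have "emeasure N (A j) \<le> ennreal (exp (- \<theta> * s)) * (\<integral>\<^sup>+x. u j x * indicator (space N) x \<partial>N)"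
      unfolding A_def by (rule nn_integral_Markov_inequality) measurable
    also have "(\<integral>\<^sup>+x. u j x * indicator (space N) x \<partial>N) = (\<integral>\<^sup>+x. u j x \<partial>N)"
      by (intro nn_integral_cong) simp
    also have "ennreal (exp (- \<theta> * s)) * \<dots> \<le> ennreal (exp (- \<theta> * s)) * ennreal (exp (K * q * real n / real l) * measure N (space N))"
      by (intro mult_left_mono int_u jl) simp
    also have "\<dots> = ennreal (exp (- \<theta> * s + K * q * real n / real l) * measure N (space N))"
      by (subst ennreal_mult[symmetric]) (simp_all only: exp_add mult.assoc exp_ge_zero measure_nonneg mult_nonneg_nonneg)
    finally show "emeasure N (A j) \<le> ennreal (exp (- \<theta> * s + K * q * real n / real l) * measure N (space N))" .
  qed
  also have "\<dots> = ennreal (real (n div l + 1) * (exp (- \<theta> * s + K * q * real n / real l) * measure N (space N)))"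
    by (simp add: ennreal_mult ennreal_of_nat_eq_real_of_nat add.commute)
  also have "\<dots> \<le> ennreal (real (n + 1) * (exp (- \<theta> * s + K * q * real n / real l) * measure N (space N)))"
    by (intro ennreal_leI mult_right_mono) auto
  finally show ?thesis by (simp add: mult.assoc)
qed

end

section \<open>From returns to orbits of the original map\<close>

context expanding_induced_map
begin

lemma return_time_bracket:
  assumes "x \<in> \<Omega>"
  obtains k where "k \<le> t" "return_time k x \<le> t" "t < return_time (Suc k) x"
proof -
  define k where "k = (LEAST k. t < return_time (Suc k) x)"
  have "t < return_time (Suc t) x" using return_time_ge[OF assms, of "Suc t"] by simp
  then have k: "t < return_time (Suc k) x" unfolding k_def by (rule LeastI)
  have le: "return_time k x \<le> t"
  proof (cases k)
    case (Suc k')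
    then have "\<not> t < return_time (Suc k') x" unfolding k_def by (intro not_less_Least) simp
    then show ?thesis using Suc by simp
  qed simp
  moreover have "k \<le> t" using return_time_ge[OF assms, of k] le by simp
  ultimately show ?thesis using k that by blast
qed

definition tail_mean :: "nat \<Rightarrow> ennreal" where
  "tail_mean T = (\<integral>\<^sup>+x. ennreal (real (R x)) * indicator {x \<in> \<Delta>. real (R x) > real T} x \<partial>N)"

text \<open>The Chernoff exponent with all constants merged into \<open>D\<close>. One half of
  \<open>\<epsilon> * n\<close> has been spent on the block means; \<open>D * T\<close> pays for
  incomplete blocks and excursions, and the last term for blocks with
  \<open>\<theta> * Y > 1\<close>.\<close>

definition deviation_exponent :: "real \<Rightarrow> real \<Rightarrow> nat \<Rightarrow> nat \<Rightarrow> real \<Rightarrow> real" where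
  "deviation_exponent \<epsilon> D n T \<theta> =
     - \<theta> * (\<epsilon> * real n / 2 - D * real T) + D * real n * exp (D * \<theta> * real T) * tail (1 / (D * \<theta>))"

end

context uniformly_continuous_observable
begin

text \<open>A point of the tower is a base point \<open>x\<close> with a height
  \<open>j < R x\<close>. Its orbit segment of length \<open>n\<close> is the rest of that
  excursion, then complete excursions from \<open>F x\<close>, then an unfinished one. The three
  terms stand for a long first excursion, a long one among the next \<open>n + 1\<close>, and a
  large sum over the complete ones.\<close>

lemma large_deviation_master_bound:
  assumes \<epsilon>: "\<epsilon> > 0"
  obtains D where "D \<ge> 1"
    "\<And>n T \<theta>. n \<ge> 1 \<Longrightarrow> \<theta> > 0 \<Longrightarrow>
      emeasure \<mu> {x \<in> space m. birkhoff_sum f \<psi> n x > \<epsilon> * real n} \<le>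
        ennreal D * (tail_mean T + ennreal (real n * tail T +
          real n * exp (deviation_exponent \<epsilon> D n T \<theta>)))"
proof -
  obtain K2 where K2: "K2 > 0"
    "\<And>A. A \<in> sets m \<Longrightarrow> emeasure \<mu> A \<le> ennreal K2 * (\<integral>\<^sup>+x. induced_sum (indicator A) x \<partial>N)"
    using \<mu>_le_tower by blast
  \<comment> \<open>With this level the block means cost \<open>2 * K * \<theta> * \<eta> * n =
    \<theta> * \<epsilon> * n / 2\<close> in the exponent, half of the available deviation.\<close>
  define \<eta> where "\<eta> = \<epsilon> / (4 * K)"
  have \<eta>: "\<eta> > 0" using \<epsilon> K_pos by (simp add: \<eta>_def)
  obtain l Y D where l: "l \<ge> 1" and D: "D > 0" and Y: "Y \<in> borel_measurable N" "cylinder_constant l Y"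
    "\<And>x. x \<in> \<Omega> \<Longrightarrow> birkhoff_sum F (induced_sum \<psi>) l x \<le> Y x"
    "\<And>x. x \<in> \<Omega> \<Longrightarrow> Y x \<le> D * real (return_time l x)"
    "(\<integral>\<^sup>+x. ennreal (Y x) \<partial>N) \<le> ennreal (\<eta> * real l)"
    using block_majorant[OF \<eta>] by metis
  define \<rho> where "\<rho> = mean_return_time"
  have \<rho>: "\<rho> \<ge> 0" by (simp add: \<rho>_def mean_return_time_nonneg)
  define V where "V = measure N (space N)"
  have V: "V > 0" using measure_space_pos by (simp add: V_def)
  \<comment> \<open>One constant above every coefficient that occurs. Since \<open>tail\<close> is
    antitone, enlarging it only weakens the bound.\<close>
  define D' where "D' = 1 + (2 * b + b * real l) + K * K1 + D * real l + K2 * (1 + K * \<rho> * 2 * (K1 + V))"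
  have terms: "0 \<le> 2 * b + b * real l" "0 \<le> K * K1" "0 \<le> D * real l" "0 \<le> K2 * (1 + K * \<rho> * 2 * (K1 + V))"
    using b0 K_pos K1_pos K2(1) D \<rho> V by simp_all
  then have D': "D' \<ge> 1" "2 * b + b * real l \<le> D'" "K * K1 \<le> D'" "D * real l \<le> D'" "K2 * (1 + K * \<rho> * 2 * (K1 + V)) \<le> D'"
    by (simp_all add: D'_def)
  have Dl: "D * real l > 0" using D l by simp
  show ?thesis
  proof (rule that[OF D'(1)])
    fix n T :: nat and \<theta> :: real assume n: "n \<ge> 1" and \<theta>: "\<theta> > 0"
    define A where "A = {x \<in> space m. birkhoff_sum f \<psi> n x > \<epsilon> * real n}"
    note [measurable] = birkhoff_sum_measurable[OF f_measurable \<psi>]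
    have A [measurable]: "A \<in> sets m" unfolding A_def by measurable
    define q where "q = 2 * \<theta> * \<eta> * real l + exp (\<theta> * D * real l * real T) * (real l * K1 * tail (1 / (\<theta> * D * real l)))"
    have q: "q \<ge> 0" unfolding q_def using \<theta> \<eta> K1_pos tail_nonneg by simp
    have int_q: "(\<integral>\<^sup>+x. (if \<forall>i<l. R ((F ^^ i) x) \<le> T then ennreal (exp (\<theta> * Y x) - 1) else 0) \<partial>N) \<le> ennreal q"
      unfolding q_def by (rule truncated_exponential_bound[OF l D Y(1) Y(4) Y(5) \<eta> \<theta>])
    \<comment> \<open>What is left of the deviation after two incomplete excursions, each at most
      \<open>b * T\<close>, and one incomplete block.\<close>
    define s where "s = \<epsilon> * real n - 2 * b * real T - b * real l * real T"
    define E1 where "E1 = {x \<in> \<Delta>. \<exists>i<n+1. real (R ((F ^^ i) x)) > real T}"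
    define E2 where "E2 = {x \<in> \<Omega>. (\<forall>i\<le>n. R ((F ^^ i) x) \<le> T) \<and> (\<exists>k\<le>n. birkhoff_sum F (induced_sum \<psi>) k x > s + b * real l * real T)}"
    have E1_sets: "E1 \<in> sets N"
    proof -
      have "{x \<in> space N. \<exists>i<n+1. real (R ((F ^^ i) x)) > real T} \<in> sets N" by measurable
      then show ?thesis unfolding E1_def space_N .
    qed
    have E2_sets: "E2 \<in> sets N"
    proof -
      have [measurable]: "birkhoff_sum F (induced_sum \<psi>) k \<in> borel_measurable N" for k
        by (intro birkhoff_sum_measurable F_measurable induced_sum_measurable \<psi>)
      have "{x \<in> space N. (\<forall>i\<le>n. R ((F ^^ i) x) \<le> T) \<and> (\<exists>k\<le>n. birkhoff_sum F (induced_sum \<psi>) k x > s + b * real l * real T)} \<in> sets N"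
        by measurable
      then have "\<Omega> \<inter> {x \<in> space N. (\<forall>i\<le>n. R ((F ^^ i) x) \<le> T) \<and> (\<exists>k\<le>n. birkhoff_sum F (induced_sum \<psi>) k x > s + b * real l * real T)} \<in> sets N"
        by (rule sets.Int[OF \<Omega>_sets])
      also have "\<Omega> \<inter> {x \<in> space N. (\<forall>i\<le>n. R ((F ^^ i) x) \<le> T) \<and> (\<exists>k\<le>n. birkhoff_sum F (induced_sum \<psi>) k x > s + b * real l * real T)} = E2"
        unfolding E2_def using sets.sets_into_space[OF \<Omega>_sets] by blast
      finally show ?thesis .
    qed
    define U where "U = E1 \<union> E2"
    have U [measurable]: "U \<in> sets N" unfolding U_def using E1_sets E2_sets by blast
    define e where "e = exp (deviation_exponent \<epsilon> D' n T \<theta>)"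
    have exponent_le: "- \<theta> * s + K * q * real n / real l
        \<le> deviation_exponent \<epsilon> D' n T \<theta>"
    proof -
      have "K * q * real n / real l = K * (2 * \<theta> * \<eta>) * real n
          + K * K1 * real n * exp (\<theta> * D * real l * real T) * tail (1 / (\<theta> * D * real l))"
        unfolding q_def using l by (simp add: field_simps)
      also have "K * (2 * \<theta> * \<eta>) * real n = \<theta> * (\<epsilon> * real n / 2)"
        using K_pos by (simp add: \<eta>_def)
      also have "K * K1 * real n * exp (\<theta> * D * real l * real T) * tail (1 / (\<theta> * D * real l))
          \<le> D' * real n * exp (D' * \<theta> * real T) * tail (1 / (D' * \<theta>))"
      proof (intro mult_mono)
        have "\<theta> * (D * real l) \<le> \<theta> * D'" using D'(4) \<theta> by (intro mult_left_mono) auto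
        then have le: "\<theta> * D * real l \<le> D' * \<theta>" by (simp add: mult_ac)
        then show "exp (\<theta> * D * real l * real T) \<le> exp (D' * \<theta> * real T)"
          by (simp add: mult_right_mono)
        have "0 < \<theta> * D * real l" using Dl \<theta> by (simp add: mult.assoc)
        then show "tail (1 / (\<theta> * D * real l)) \<le> tail (1 / (D' * \<theta>))"
          using le by (intro tail_antimono divide_left_mono) auto
      qed (use D' terms tail_nonneg in auto)
      moreover have "\<theta> * ((2 * b + b * real l) * real T) \<le> \<theta> * (D' * real T)"
        using D'(2) \<theta> by (intro mult_left_mono mult_right_mono) auto
      ultimately show ?thesis unfolding s_def deviation_exponent_def by (simp add: algebra_simps)
    qed
    have U_bound: "emeasure N U \<le> ennreal (2 * (K1 + V) * (real n * tail T + real n * e))"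
    proof -
      have "emeasure N U \<le> emeasure N E1 + emeasure N E2"
        unfolding U_def by (rule emeasure_subadditive[OF E1_sets E2_sets])
      also have "\<dots> \<le> ennreal (real (n + 1) * K1 * tail T) + ennreal (real (n + 1) * exp (- \<theta> * s + K * q * real n / real l) * V)"
        unfolding E1_def E2_def V_def
        by (intro add_mono emeasure_iterate_tail block_deviation[OF l Y(1-3) \<theta> q int_q])
      also have "\<dots> = ennreal (real (n + 1) * K1 * tail T + real (n + 1) * exp (- \<theta> * s + K * q * real n / real l) * V)"
        using K1_pos V tail_nonneg by (intro ennreal_plus[symmetric]) auto
      also have "\<dots> \<le> ennreal (2 * (K1 + V) * (real n * tail T + real n * e))"
      proof (rule ennreal_leI)
        have n1: "real (n + 1) \<le> 2 * real n" using n by simp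
        have "exp (- \<theta> * s + K * q * real n / real l) \<le> e"
          unfolding e_def using exponent_le by simp
        then have "real (n + 1) * exp (- \<theta> * s + K * q * real n / real l) * V \<le> (2 * real n) * e * V"
          using n1 V by (intro mult_right_mono mult_mono) auto
        moreover have "real (n + 1) * K1 * tail T \<le> (2 * real n) * K1 * tail T"
          using n1 K1_pos tail_nonneg by (intro mult_right_mono) auto
        moreover have "0 \<le> V * (real n * tail T)" "0 \<le> K1 * (real n * e)"
          using V K1_pos tail_nonneg by (simp_all add: e_def)
        ultimately show "real (n + 1) * K1 * tail T + real (n + 1) * exp (- \<theta> * s + K * q * real n / real l) * V
            \<le> 2 * (K1 + V) * (real n * tail T + real n * e)"
          by (simp add: algebra_simps)
      qed
      finally show ?thesis .
    qed
    have no_deviation: "birkhoff_sum f \<psi> n ((f ^^ j) x) \<le> \<epsilon> * real n"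
      if x: "x \<in> \<Omega>" and RT: "R x \<le> T" and FU: "F x \<notin> U" and j: "j < R x" for x j
    proof -
      define y where "y = F x"
      have y: "y \<in> \<Omega>" unfolding y_def by (rule \<Omega>_F[OF x])
      have yR: "R ((F ^^ i) y) \<le> T" if "i \<le> n" for i
      proof -
        have "y \<notin> E1" using FU by (simp add: U_def y_def)
        moreover have "y \<in> \<Delta>" using y by (simp add: \<Omega>_def)
        ultimately have "\<not> real (R ((F ^^ i) y)) > real T" using that unfolding E1_def by auto
        then show ?thesis by simp
      qed
      have yS: "birkhoff_sum F (induced_sum \<psi>) k y \<le> \<epsilon> * real n - 2 * b * real T" if "k \<le> n" for k
      proof -
        have "y \<notin> E2" using FU by (simp add: U_def y_def)
        then have "\<not> birkhoff_sum F (induced_sum \<psi>) k y > s + b * real l * real T"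
          using y yR that unfolding E2_def by blast
        then show ?thesis by (simp add: s_def)
      qed
      have xs: "(f ^^ j) x \<in> space m" by (intro f_funpow_space \<Omega>_space x)
      have short: "birkhoff_sum f \<psi> i z \<le> b * real T" if "i \<le> T" "z \<in> space m" for i z
      proof -
        have "birkhoff_sum f \<psi> i z \<le> b * real i"
          using abs_birkhoff_sum_le[of \<psi> b z i, OF b that(2)] by simp
        also have "\<dots> \<le> b * real T" using that(1) b0 by (intro mult_left_mono) auto
        finally show ?thesis .
      qed
      show ?thesis
      proof (cases "n \<le> R x - j")
        case True
        have "birkhoff_sum f \<psi> n ((f ^^ j) x) \<le> b * real T" using True RT xs by (intro short) auto
        moreover have "0 \<le> \<epsilon> * real n - 2 * b * real T" using yS[of 0] by simp
        moreover have "0 \<le> b * real T" using b0 by simp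
        ultimately show ?thesis by simp
      next
        case False
        define t where "t = n - (R x - j)"
        have nt: "n = (R x - j) + t" "t \<le> n" using False by (auto simp: t_def)
        have "(f ^^ (R x - j)) ((f ^^ j) x) = (f ^^ (R x - j + j)) x" by (simp add: funpow_add)
        also have "\<dots> = y" using j \<Omega>_F_eq[OF x] by (simp add: y_def)
        finally have to_y: "(f ^^ (R x - j)) ((f ^^ j) x) = y" .
        obtain k where k: "k \<le> t" "return_time k y \<le> t" "t < return_time (Suc k) y"
          using return_time_bracket[OF y] .
        have kn: "k \<le> n" using k nt by simp
        have rest: "t - return_time k y \<le> T"
          using k yR[OF kn] by (simp add: return_time_Suc)
        have "birkhoff_sum f \<psi> n ((f ^^ j) x) = birkhoff_sum f \<psi> (R x - j) ((f ^^ j) x) + birkhoff_sum f \<psi> t y"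
          by (subst nt(1)) (simp add: birkhoff_sum_add to_y)
        also have "birkhoff_sum f \<psi> t y = birkhoff_sum f \<psi> (return_time k y) y
            + birkhoff_sum f \<psi> (t - return_time k y) ((f ^^ return_time k y) y)"
          using birkhoff_sum_add[of f \<psi> "return_time k y" "t - return_time k y" y] k(2) by simp
        also have "birkhoff_sum f \<psi> (return_time k y) y = birkhoff_sum F (induced_sum \<psi>) k y"
          by (rule birkhoff_sum_return_time[OF y])
        finally have "birkhoff_sum f \<psi> n ((f ^^ j) x) = birkhoff_sum f \<psi> (R x - j) ((f ^^ j) x)
            + (birkhoff_sum F (induced_sum \<psi>) k y + birkhoff_sum f \<psi> (t - return_time k y) ((f ^^ return_time k y) y))" .
        moreover have "birkhoff_sum f \<psi> (R x - j) ((f ^^ j) x) \<le> b * real T" using RT xs by (intro short) auto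
        moreover have "birkhoff_sum f \<psi> (t - return_time k y) ((f ^^ return_time k y) y) \<le> b * real T"
          by (intro short rest f_funpow_space \<Omega>_space y)
        ultimately show ?thesis using yS[OF kn] by simp
      qed
    qed
    have "emeasure \<mu> A \<le> ennreal K2 * (\<integral>\<^sup>+x. induced_sum (indicator A) x \<partial>N)"
      by (rule K2(2)[OF A])
    also have "(\<integral>\<^sup>+x. induced_sum (indicator A) x \<partial>N)
      \<le> (\<integral>\<^sup>+x. ennreal (real (R x)) * indicator {x \<in> \<Delta>. real (R x) > real T} x + ennreal (real (R x)) * indicator U ((F ^^ 1) x) \<partial>N)"
    proof (rule nn_integral_mono_AE)
      show "AE x in N. induced_sum (indicator A) x \<le> ennreal (real (R x)) * indicator {x \<in> \<Delta>. real (R x) > real T} x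
          + ennreal (real (R x)) * indicator U ((F ^^ 1) x)"
        using AE_\<Omega>
      proof eventually_elim
        case (elim x)
        have all: "induced_sum (indicator A) x \<le> ennreal (real (R x))"
        proof -
          have "induced_sum (indicator A) x \<le> (\<Sum>j<R x. 1::ennreal)"
            unfolding induced_sum_def birkhoff_sum_def by (intro sum_mono) (simp add: indicator_def)
          then show ?thesis by (simp add: ennreal_of_nat_eq_real_of_nat)
        qed
        consider "R x > T" | "F x \<in> U" | "R x \<le> T" "F x \<notin> U" by linarith
        then show ?case
        proof cases
          case 1
          then show ?thesis using all elim by (simp add: \<Omega>_def add_increasing2)
        next
          case 2
          then show ?thesis using all by (simp add: add_increasing)
        next
          case 3
          have "indicator A ((f ^^ j) x) = (0::ennreal)" if "j < R x" for j
            using no_deviation[OF elim 3 that] by (simp add: A_def indicator_def not_less)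
          then have "induced_sum (indicator A) x = (0::ennreal)"
            unfolding induced_sum_def birkhoff_sum_def by simp
          then show ?thesis by simp
        qed
      qed
    qed
    also have "\<dots> = tail_mean T + (\<integral>\<^sup>+x. ennreal (real (R x)) * indicator U ((F ^^ 1) x) \<partial>N)"
      unfolding tail_mean_def by (rule nn_integral_add) measurable
    \<comment> \<open>The bad event is formulated at \<open>F x\<close>, and \<open>R\<close> is
      constant on members, so the weight \<open>R x\<close> of the first excursion decouples from
      it.\<close>
    also have "(\<integral>\<^sup>+x. ennreal (real (R x)) * indicator U ((F ^^ 1) x) \<partial>N)
        \<le> ennreal K * (\<integral>\<^sup>+x. ennreal (real (R x)) \<partial>N) * (\<integral>\<^sup>+x. indicator U x \<partial>N)"
    proof (rule quasi_independence)
      show "cylinder_constant 1 (\<lambda>x. ennreal (real (R x)))"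
      proof (rule cylinder_constantI)
        fix w x y assume "\<And>i. i < 1 \<Longrightarrow> w i \<in> P" "x \<in> cylinder 1 w" "y \<in> cylinder 1 w"
        then have "R x = R y" by (rule cylinder_constantD[OF R_cylinder_constant])
        then show "ennreal (real (R x)) = ennreal (real (R y))" by simp
      qed
    qed measurable
    also have "\<dots> = ennreal (K * \<rho>) * emeasure N U"
      using K_pos \<rho> by (simp add: nn_integral_R \<rho>_def ennreal_mult)
    also have "\<dots> \<le> ennreal (K * \<rho>) * ennreal (2 * (K1 + V) * (real n * tail T + real n * e))"
      by (intro mult_left_mono U_bound) simp
    finally have "emeasure \<mu> A \<le> ennreal K2 * (tail_mean T + ennreal (K * \<rho>) * ennreal (2 * (K1 + V) * (real n * tail T + real n * e)))"
      by (simp add: add_left_mono mult_left_mono)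
    also have "\<dots> \<le> ennreal D' * (tail_mean T + ennreal (real n * tail T + real n * e))"
    proof -
      define r where "r = real n * tail T + real n * e"
      define c where "c = K * \<rho> * (2 * (K1 + V))"
      have r: "r \<ge> 0" unfolding r_def e_def using tail_nonneg by simp
      have c: "c \<ge> 0" unfolding c_def using K_pos \<rho> K1_pos V by simp
      have "ennreal K2 * (tail_mean T + ennreal (K * \<rho>) * ennreal (2 * (K1 + V) * r)) = ennreal K2 * (tail_mean T + ennreal c * ennreal r)"
        using K_pos \<rho> K1_pos V r by (simp add: c_def ennreal_mult[symmetric] mult.assoc)
      also have "\<dots> \<le> ennreal K2 * (ennreal (1 + c) * tail_mean T + ennreal (1 + c) * ennreal r)"
      proof (intro mult_left_mono add_mono mult_right_mono)
        have "1 * tail_mean T \<le> ennreal (1 + c) * tail_mean T"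
          using c by (intro mult_right_mono) (simp_all add: ennreal_leI flip: ennreal_1)
        then show "tail_mean T \<le> ennreal (1 + c) * tail_mean T" by simp
      qed (auto intro: ennreal_leI)
      also have "\<dots> = ennreal (K2 * (1 + c)) * (tail_mean T + ennreal r)"
      proof -
        have "ennreal (K2 * (1 + c)) = ennreal K2 * ennreal (1 + c)" using K2(1) c by (intro ennreal_mult) auto
        then show ?thesis by (simp only: distrib_left mult.assoc)
      qed
      also have "\<dots> \<le> ennreal D' * (tail_mean T + ennreal r)"
        proof -
        have "K2 * (1 + c) \<le> D'" using D'(5) by (simp only: c_def mult.assoc)
        then show ?thesis by (intro mult_right_mono ennreal_leI) auto
      qed
      finally show ?thesis by (simp add: r_def)
    qed
    finally show "emeasure \<mu> {x \<in> space m. birkhoff_sum f \<psi> n x > \<epsilon> * real n} \<le>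
        ennreal D' * (tail_mean T + ennreal (real n * tail T +
          real n * exp (deviation_exponent \<epsilon> D' n T \<theta>)))"
      by (simp add: A_def e_def)
  qed
qed

end

section \<open>Rates of large deviations\<close>

lemma osc_tendsto_0_imp_uniformly_continuous:
  assumes bdd: "bounded (\<phi> ` X)" and lim: "(osc X d \<phi> \<longlongrightarrow> 0) (at_right 0)" and "e > 0"
  shows "\<exists>r>0. \<forall>x\<in>X. \<forall>y\<in>X. d x y \<le> r \<longrightarrow> \<bar>\<phi> x - \<phi> y\<bar> \<le> e"
proof -
  have "eventually (\<lambda>r. osc X d \<phi> r < e) (at_right 0)"
    using lim \<open>e > 0\<close> by (intro order_tendstoD) auto
  then obtain b where b: "b > 0" "\<And>r. 0 < r \<Longrightarrow> r < b \<Longrightarrow> osc X d \<phi> r < e"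
    unfolding eventually_at_right_field by blast
  obtain B where B: "\<And>x. x \<in> X \<Longrightarrow> \<bar>\<phi> x\<bar> \<le> B"
    using bdd by (auto simp: bounded_iff)
  have "\<bar>\<phi> x - \<phi> y\<bar> \<le> e" if "x \<in> X" "y \<in> X" "d x y \<le> b / 2" for x y
  proof -
    have "\<bar>\<phi> x - \<phi> y\<bar> \<le> osc X d \<phi> (b / 2)"
      unfolding osc_def
    proof (rule cSup_upper)
      \<comment> \<open>Boundedness of the observable makes the real-valued supremum in
        \<open>osc\<close> an upper bound.\<close>
      have "\<bar>\<phi> x' - \<phi> y'\<bar> \<le> 2 * B" if "x' \<in> X" "y' \<in> X" for x' y'
        using B[OF that(1)] B[OF that(2)] by linarith
      then show "bdd_above {\<bar>\<phi> x - \<phi> y\<bar> |x y. x \<in> X \<and> y \<in> X \<and> d x y \<le> b / 2}"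
        by (intro bdd_aboveI[where M = "2 * B"]) blast
    qed (use that in blast)
    also have "\<dots> < e" using b by simp
    finally show ?thesis by simp
  qed
  then show ?thesis using b(1) by (intro exI[of _ "b / 2"]) simp
qed

text \<open>The left-hand side never exceeds 1, so the finitely many early \<open>n\<close> are
  absorbed by the sum of the values \<open>1 / g k\<close>.\<close>

lemma extend_eventual_bound:
  fixes L g :: "nat \<Rightarrow> real"
  assumes "\<And>n. n \<ge> n\<^sub>0 \<Longrightarrow> n \<ge> 1 \<Longrightarrow> L n \<le> C * g n" "\<And>n. L n \<le> 1" "\<And>n. n \<ge> 1 \<Longrightarrow> g n > 0"
  shows "\<exists>C'>0. \<forall>n\<ge>1. L n \<le> C' * g n"
proof (intro exI conjI allI impI)
  define C' where "C' = \<bar>C\<bar> + 1 + (\<Sum>k\<in>{1..<n\<^sub>0}. 1 / g k)"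
  have s: "0 \<le> (\<Sum>k\<in>{1..<n\<^sub>0}. 1 / g k)"
    using assms(3) by (intro sum_nonneg) (auto intro: less_imp_le)
  then show "C' > 0" by (simp add: C'_def)
  fix n :: nat assume n: "n \<ge> 1"
  show "L n \<le> C' * g n"
  proof (cases "n \<ge> n\<^sub>0")
    case True
    have "L n \<le> C * g n" using assms(1)[OF True n] .
    also have "\<dots> \<le> C' * g n"
      using assms(3)[OF n] s by (intro mult_right_mono) (auto simp: C'_def)
    finally show ?thesis .
  next
    case False
    have "1 / g n \<le> (\<Sum>k\<in>{1..<n\<^sub>0}. 1 / g k)"
      using False n assms(3) by (intro member_le_sum) (auto intro: less_imp_le)
    then have "1 / g n \<le> C'" by (simp add: C'_def)
    then have "1 \<le> C' * g n" using assms(3)[OF n] by (simp add: field_simps)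
    then show ?thesis using assms(2)[of n] by simp
  qed
qed

text \<open>Serves to absorb a factor \<open>n = u^2\<close> at the price of half of an exponential
  rate in \<open>u\<close>.\<close>

lemma square_le_exp:
  fixes c u :: real
  assumes "c > 0" "u \<ge> 0"
  shows "u\<^sup>2 \<le> 8 / c\<^sup>2 * exp (c * u / 2)"
proof -
  have "(c * u / 2)\<^sup>2 / 2 \<le> exp (c * u / 2)"
  proof -
    have "0 \<le> c * u / 2" using assms by simp
    then show ?thesis using exp_lower_Taylor_quadratic[of "c * u / 2"] by linarith
  qed
  then show ?thesis using assms by (simp add: field_simps power2_eq_square)
qed

section \<open>Choice of the truncation for polynomial and exponential tails\<close>

context expanding_induced_map
begin

text \<open>Dyadic decomposition: where \<open>R\<close> lies between \<open>2^j T\<close> and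
  \<open>2^(j+1) T\<close>, the weight is at most \<open>2^(j+1) T\<close>, and the tail at
  \<open>2^j T\<close> makes the series geometric with ratio \<open>2^(1 - a) < 1\<close>.\<close>

lemma tail_mean_le:
  assumes a: "a > 1" and B: "B \<ge> 0" and T: "T \<ge> 1"
    and tail: "\<And>k. k \<ge> T \<Longrightarrow> tail (real k) \<le> B * real k powr (- a)"
  shows "tail_mean T \<le> ennreal (2 * B / (1 - 2 powr (1 - a)) * real T powr (1 - a))"
proof -
  define g where "g j = {x \<in> \<Delta>. real (R x) > real (2 ^ j * T)}" for j
  have g [measurable]: "g j \<in> sets N" for j unfolding g_def by measurable
  have "tail_mean T \<le> (\<integral>\<^sup>+x. (\<Sum>j. ennreal (2 ^ Suc j * real T) * indicator (g j) x) \<partial>N)"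
    unfolding tail_mean_def
  proof (rule nn_integral_mono)
    fix x assume x: "x \<in> space N"
    show "ennreal (real (R x)) * indicator {x \<in> \<Delta>. real T < real (R x)} x \<le> (\<Sum>j. ennreal (2 ^ Suc j * real T) * indicator (g j) x)"
    proof (cases "R x > T")
      case True
      have "R x \<le> 2 ^ Suc (R x) * T"
      proof -
        have "R x * 1 \<le> 2 ^ Suc (R x) * T"
          using T less_exp[of "Suc (R x)"] by (intro mult_mono) auto
        then show ?thesis by simp
      qed
      then have ex: "\<exists>j. R x \<le> 2 ^ Suc j * T" by blast
      define j where "j = (LEAST j. R x \<le> 2 ^ Suc j * T)"
      have j: "R x \<le> 2 ^ Suc j * T" unfolding j_def using ex by (rule LeastI_ex)
      have "2 ^ j * T < R x"
      proof (cases j)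
        case (Suc j')
        then have "\<not> R x \<le> 2 ^ Suc j' * T" unfolding j_def by (intro not_less_Least) simp
        then show ?thesis using Suc by simp
      qed (use True in simp)
      then have "x \<in> g j" using x by (simp add: g_def space_N flip: of_nat_mult)
      have "real (R x) \<le> real (2 ^ Suc j * T)" using j by (simp only: of_nat_le_iff)
      then have "ennreal (real (R x)) \<le> ennreal (2 ^ Suc j * real T)" by (intro ennreal_leI) simp
      also have "\<dots> = (\<Sum>j\<in>{j}. ennreal (2 ^ Suc j * real T) * indicator (g j) x)" using \<open>x \<in> g j\<close> by simp
      also have "\<dots> \<le> (\<Sum>j. ennreal (2 ^ Suc j * real T) * indicator (g j) x)"
        by (rule sum_le_suminf) auto
      finally show ?thesis using True x by (simp add: space_N)
    qed simp
  qed
  also have "\<dots> = (\<Sum>j. \<integral>\<^sup>+x. ennreal (2 ^ Suc j * real T) * indicator (g j) x \<partial>N)"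
    by (rule nn_integral_suminf) measurable
  also have "\<dots> = (\<Sum>j. ennreal (2 ^ Suc j * real T * tail (real (2 ^ j * T))))"
    by (intro suminf_cong) (simp add: nn_integral_cmult_indicator emeasure_eq_measure g_def tail_def ennreal_mult)
  also have "\<dots> \<le> (\<Sum>j. ennreal (2 * B * real T powr (1 - a) * (2 powr (1 - a)) ^ j))"
  proof (rule suminf_le)
    fix j
    define u where "u = real (2 ^ j * T)"
    have u: "u > 0" using T by (simp add: u_def)
    have "2 ^ Suc j * real T * tail u = 2 * u * tail u" by (simp add: u_def)
    also have "\<dots> \<le> 2 * u * (B * u powr (- a))"
      using u T unfolding u_def by (intro mult_left_mono tail) auto
    also have "\<dots> = 2 * B * (u * u powr (- a))" by simp
    also have "u * u powr (- a) = u powr (1 - a)" using u by (simp add: powr_diff powr_minus_divide)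
    also have "u powr (1 - a) = real T powr (1 - a) * (2 powr (1 - a)) ^ j"
      using T by (simp add: u_def powr_mult powr_realpow[symmetric] powr_powr mult.commute)
    finally show "ennreal (2 ^ Suc j * real T * tail (real (2 ^ j * T))) \<le> ennreal (2 * B * real T powr (1 - a) * (2 powr (1 - a)) ^ j)"
      by (intro ennreal_leI) (simp add: u_def mult.assoc)
  qed auto
  also have "\<dots> = ennreal (2 * B / (1 - 2 powr (1 - a)) * real T powr (1 - a))"
  proof (rule suminf_ennreal_eq)
    have "2 powr (1 - a) < 2 powr (0::real)" using a by (intro powr_less_mono) auto
    then have "(\<lambda>j. (2 powr (1 - a)) ^ j) sums (1 / (1 - 2 powr (1 - a)))"
      by (intro geometric_sums) auto
    then have "(\<lambda>j. 2 * B * real T powr (1 - a) * (2 powr (1 - a)) ^ j) sums (2 * B * real T powr (1 - a) * (1 / (1 - 2 powr (1 - a))))"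
      by (rule sums_mult)
    then show "(\<lambda>j. 2 * B * real T powr (1 - a) * (2 powr (1 - a)) ^ j) sums (2 * B / (1 - 2 powr (1 - a)) * real T powr (1 - a))"
      by simp
  qed (use B in auto)
  finally show ?thesis .
qed

end

context uniformly_continuous_observable
begin

text \<open>With \<open>T\<close> proportional to \<open>n\<close>, both tail terms have the order
  \<open>n^(1 - a)\<close>. Then \<open>\<theta>\<close> of order \<open>ln n / n\<close> is the
  largest for which the price \<open>exp (D * \<theta> * T)\<close> of truncation is a power of
  \<open>n\<close>; a small proportion \<delta> makes that power small.\<close>

lemma polynomial_large_deviation:
  assumes \<epsilon>: "\<epsilon> > 0"
    and a: "a > 1" and C: "C > 0" and tail: "\<And>n. n \<ge> 1 \<Longrightarrow> tail (real n) \<le> C * real n powr (- a)"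
  shows "\<exists>C'>0. \<forall>n\<ge>1. measure \<mu> {x \<in> space m. birkhoff_sum f \<psi> n x > \<epsilon> * real n} \<le> C' * real n powr (1 - a)"
proof -
  obtain D where D: "D \<ge> 1" and master:
    "\<And>n T \<theta>. n \<ge> 1 \<Longrightarrow> \<theta> > 0 \<Longrightarrow>
      emeasure \<mu> {x \<in> space m. birkhoff_sum f \<psi> n x > \<epsilon> * real n} \<le>
        ennreal D * (tail_mean T + ennreal (real n * tail T +
          real n * exp (deviation_exponent \<epsilon> D n T \<theta>)))"
    by (rule large_deviation_master_bound[OF \<epsilon>]) (rule that, assumption, blast)
  \<comment> \<open>Gives \<open>\<theta> * \<epsilon> * n / 2 = (a + 1) * ln n\<close>, a gain of
    \<open>n^(-a-1)\<close>. One power of \<open>n\<close> pays for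
    \<open>exp (D * \<theta> * T)\<close>, another for the factor \<open>n\<close> in front.\<close>
  define A where "A = 2 * (a + 1) / \<epsilon>"
  have A: "A > 0" using a \<epsilon> by (simp add: A_def)
  \<comment> \<open>In the last term of the exponent one \<open>n^s\<close> pays for the truncation
    and another for \<open>(ln n)^a\<close>; since \<open>1 + 2 * s - a = 0\<close>, what remains is
    bounded.\<close>
  define s where "s = (a - 1) / 2"
  have s: "s > 0" using a by (simp add: s_def)
  define k where "k = min 1 s"
  have k: "0 < k" "k \<le> 1" "k \<le> s" using s by (auto simp: k_def)
  define \<delta> where "\<delta> = k / (A * D)"
  have \<delta>: "\<delta> > 0" using k A D by (simp add: \<delta>_def)
  define c1 where "c1 = 2 * C / (1 - 2 powr (1 - a)) * (\<delta> / 2) powr (1 - a)"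
  define c2 where "c2 = C * (\<delta> / 2) powr (- a)"
  define c3 where "c3 = D * C * (2 * (D * A)) powr a * (a / s) powr a"
  \<comment> \<open>The tail bound is given at integers; rounding down costs at most a factor 2 in
    the argument.\<close>
  have tail': "tail z \<le> C * (z / 2) powr (- a)" if "z \<ge> 2" for z
  proof -
    define n where "n = nat \<lfloor>z\<rfloor>"
    have n: "n \<ge> 1" "real n \<le> z" "real n \<ge> z / 2" using that unfolding n_def by linarith+
    have "tail z \<le> tail (real n)" by (rule tail_antimono[OF n(2)])
    also have "\<dots> \<le> C * real n powr (- a)" by (rule tail[OF n(1)])
    also have "\<dots> \<le> C * (z / 2) powr (- a)"
      using n(3) that a C by (intro mult_left_mono powr_mono2') auto
    finally show ?thesis .
  qed
  \<comment> \<open>The three entries ensure \<open>ln n > 0\<close>, \<open>T \<ge> 1\<close> and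
    that the level \<open>1 / (D * \<theta>)\<close> is at least 2, as \<open>tail'\<close>
    requires.\<close>
  define n\<^sub>0 where "n\<^sub>0 = max 3 (max (nat \<lceil>2 / \<delta>\<rceil>) (nat \<lceil>(4 * (D * A))\<^sup>2\<rceil>))"
  have bound: "measure \<mu> {x \<in> space m. birkhoff_sum f \<psi> n x > \<epsilon> * real n} \<le> D * (c1 + c2 + exp c3) * real n powr (1 - a)"
    if n: "n \<ge> n\<^sub>0" for n
  proof -
    have "nat \<lceil>2 / \<delta>\<rceil> \<le> n" "nat \<lceil>(4 * (D * A))\<^sup>2\<rceil> \<le> n" using n by (auto simp: n\<^sub>0_def)
    then have n': "n \<ge> 3" "2 / \<delta> \<le> real n" "(4 * (D * A))\<^sup>2 \<le> real n"
      using n by (auto simp: n\<^sub>0_def nat_le_iff ceiling_le_iff)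
    have ln: "ln (real n) > 0" using n'(1) by simp
    define T where "T = nat \<lfloor>\<delta> * real n\<rfloor>"
    have \<delta>n: "\<delta> * real n \<ge> 2" using n'(2) \<delta> by (simp add: field_simps)
    then have T: "T \<ge> 1" "real T \<le> \<delta> * real n" "real T \<ge> \<delta> / 2 * real n" unfolding T_def by linarith+
    define \<theta> where "\<theta> = A * ln (real n) / real n"
    have \<theta>: "\<theta> > 0" using A ln n'(1) by (simp add: \<theta>_def)
    have T_powr: "real T powr (- r) \<le> (\<delta> / 2) powr (- r) * real n powr (- r)" if "r \<ge> 0" for r
    proof -
      have "real T powr (- r) \<le> (\<delta> / 2 * real n) powr (- r)"
        using T(3) \<delta> n'(1) that by (intro powr_mono2') auto
      also have "\<dots> = (\<delta> / 2) powr (- r) * real n powr (- r)"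
        by (rule powr_mult)
      finally show ?thesis .
    qed
    have "2 powr (1 - a) < 2 powr (0::real)" using a by (intro powr_less_mono) auto
    then have geo: "1 - 2 powr (1 - a) > 0" by simp
    have "tail_mean T \<le> ennreal (2 * C / (1 - 2 powr (1 - a)) * real T powr (1 - a))"
      by (rule tail_mean_le[OF a less_imp_le[OF C] T(1)]) (use T(1) in \<open>auto intro: tail\<close>)
    also have "\<dots> \<le> ennreal (c1 * real n powr (1 - a))"
    proof (rule ennreal_leI)
      have "2 * C / (1 - 2 powr (1 - a)) * real T powr (1 - a) \<le> 2 * C / (1 - 2 powr (1 - a)) * ((\<delta> / 2) powr (1 - a) * real n powr (1 - a))"
        using T_powr[of "a - 1"] a C geo by (intro mult_left_mono) auto
      then show "2 * C / (1 - 2 powr (1 - a)) * real T powr (1 - a) \<le> c1 * real n powr (1 - a)"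
        by (simp only: c1_def mult.assoc)
    qed
    finally have 1: "tail_mean T \<le> ennreal (c1 * real n powr (1 - a))" .
    have n_powr: "real n * real n powr (- a) = real n powr (1 - a)"
      using n'(1) by (simp add: powr_diff powr_minus_divide)
    have "tail T \<le> C * real T powr (- a)" by (rule tail[OF T(1)])
    also have "\<dots> \<le> C * ((\<delta> / 2) powr (- a) * real n powr (- a))"
      using T_powr[of a] a C by (intro mult_left_mono) auto
    finally have "real n * tail T \<le> real n * (C * ((\<delta> / 2) powr (- a) * real n powr (- a)))"
      by (intro mult_left_mono) auto
    also have "\<dots> = c2 * (real n * real n powr (- a))" by (simp add: c2_def)
    finally have 2: "real n * tail T \<le> c2 * real n powr (1 - a)" by (simp only: n_powr)
    have DT: "D * \<theta> * real T \<le> k * ln (real n)"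
    proof -
      have "D * \<theta> * real T \<le> D * \<theta> * (\<delta> * real n)" using T(2) D \<theta> by (intro mult_left_mono) auto
      also have "\<dots> = k * ln (real n)" using n'(1) A D by (simp add: \<theta>_def \<delta>_def)
      finally show ?thesis .
    qed
    have exp_DT: "exp (D * \<theta> * real T) \<le> real n powr s"
    proof -
      have "k * ln (real n) \<le> s * ln (real n)" using k ln by (intro mult_right_mono) auto
      then have "exp (D * \<theta> * real T) \<le> exp (s * ln (real n))" using DT by simp
      then show ?thesis using n'(1) by (simp add: powr_def)
    qed
    have 3: "D * real n * exp (D * \<theta> * real T) * tail (1 / (D * \<theta>)) \<le> c3"
    proof -
      define z where "z = 1 / (D * \<theta>)"
      have z: "z = real n / (D * A * ln (real n))" by (simp add: z_def \<theta>_def)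
      have "z \<ge> 2"
      proof -
        have "ln (real n) \<le> real n powr (1 / 2) / (1 / 2)" using n'(1) by (intro ln_powr_bound) auto
        then have "ln (real n) \<le> 2 * sqrt (real n)" using n'(1) by (simp add: powr_half_sqrt)
        then have "2 * (D * A) * ln (real n) \<le> 2 * (D * A) * (2 * sqrt (real n))"
          using D A by (intro mult_left_mono) auto
        also have "\<dots> = (4 * (D * A)) * sqrt (real n)" by simp
        also have "\<dots> \<le> sqrt (real n) * sqrt (real n)"
          using n'(3) by (intro mult_right_mono real_le_rsqrt) auto
        finally have "2 * (D * A * ln (real n)) \<le> real n" by (simp add: mult.assoc)
        moreover have "D * A * ln (real n) > 0" using D A ln by simp
        ultimately show ?thesis unfolding z by (simp add: le_divide_eq)
      qed
      then have "tail z \<le> C * (z / 2) powr (- a)" by (rule tail')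
      also have "(z / 2) powr (- a) = (2 * (D * A)) powr a * ln (real n) powr a * real n powr (- a)"
      proof -
        have z2: "z / 2 = real n / (2 * (D * A) * ln (real n))" by (simp add: z mult_ac)
        have "(z / 2) powr (- a) = real n powr (- a) / ((2 * (D * A)) * ln (real n)) powr (- a)"
          unfolding z2 by (rule powr_divide)
        also have "\<dots> = ((2 * (D * A)) * ln (real n)) powr a * real n powr (- a)"
          by (simp only: powr_minus_divide) simp
        finally show ?thesis by (simp only: powr_mult)
      qed
      finally have tz: "tail z \<le> C * ((2 * (D * A)) powr a * ln (real n) powr a * real n powr (- a))" .
      have "(ln (real n powr s)) powr a \<le> a powr a * real n powr s"
        using n'(1) s a by (intro ln_powr_bound2) (auto intro!: gr_one_powr)
      then have "(s * ln (real n)) powr a \<le> a powr a * real n powr s" using n'(1) by (simp add: ln_powr)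
      then have "s powr a * ln (real n) powr a \<le> a powr a * real n powr s" using s ln by (simp add: powr_mult)
      then have ln_a: "ln (real n) powr a \<le> (a / s) powr a * real n powr s"
        using s a by (simp add: powr_divide field_simps)
      have "D * real n * exp (D * \<theta> * real T) * tail z
          \<le> D * real n * real n powr s * (C * ((2 * (D * A)) powr a * ((a / s) powr a * real n powr s) * real n powr (- a)))"
      proof (intro mult_mono exp_DT order_refl)
        show "tail z \<le> C * ((2 * (D * A)) powr a * ((a / s) powr a * real n powr s) * real n powr (- a))"
          using tz by (rule order_trans) (intro mult_left_mono mult_right_mono ln_a, use C in auto)
      qed (use D tail_nonneg in auto)
      also have "\<dots> = c3 * (real n powr 1 * real n powr s * real n powr s * real n powr (- a))"
        using n'(1) by (simp add: c3_def)
      also have "real n powr 1 * real n powr s * real n powr s * real n powr (- a) = 1"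
        using n'(1) by (simp only: powr_add[symmetric]) (simp add: s_def field_simps)
      finally show ?thesis by (simp add: z_def)
    qed
    have 4: "real n * exp (deviation_exponent \<epsilon> D n T \<theta>)
        \<le> exp c3 * real n powr (1 - a)"
    proof -
      have "\<theta> * (\<epsilon> * real n / 2) = (a + 1) * ln (real n)"
        using n'(1) \<epsilon> by (simp add: \<theta>_def A_def)
      moreover have "k * ln (real n) \<le> 1 * ln (real n)" using k ln by (intro mult_right_mono) auto
      moreover have "- \<theta> * (\<epsilon> * real n / 2 - D * real T) = D * \<theta> * real T - \<theta> * (\<epsilon> * real n / 2)"
        by (simp only: right_diff_distrib minus_mult_left[symmetric] mult_ac)
      moreover have "(a + 1) * ln (real n) = a * ln (real n) + ln (real n)" by (simp add: distrib_right)
      ultimately have "- \<theta> * (\<epsilon> * real n / 2 - D * real T) \<le> - a * ln (real n)"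
        using DT by linarith
      then have "real n * exp (deviation_exponent \<epsilon> D n T \<theta>)
          \<le> real n * exp (- a * ln (real n) + c3)"
        unfolding deviation_exponent_def using 3 by (intro mult_left_mono) auto
      also have "exp (- a * ln (real n) + c3) = exp c3 * real n powr (- a)"
        using n'(1) by (simp add: powr_def exp_add[symmetric])
      also have "real n * (exp c3 * real n powr (- a)) = exp c3 * (real n * real n powr (- a))" by simp
      finally show ?thesis by (simp only: n_powr)
    qed
    have nonneg: "0 \<le> c1 * real n powr (1 - a)" using C geo by (simp add: c1_def)
    have c2: "0 \<le> c2" using C by (simp add: c2_def)
    have "emeasure \<mu> {x \<in> space m. birkhoff_sum f \<psi> n x > \<epsilon> * real n}
        \<le> ennreal D * (ennreal (c1 * real n powr (1 - a)) + ennreal (c2 * real n powr (1 - a) + exp c3 * real n powr (1 - a)))"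
      using n'(1) by (intro order_trans[OF master[OF _ \<theta>, of n T]] mult_left_mono add_mono 1 ennreal_leI 2 4) auto
    also have "\<dots> = ennreal (D * (c1 + c2 + exp c3) * real n powr (1 - a))"
      using D nonneg c2 by (subst ennreal_plus[symmetric]) (auto simp: ennreal_mult[symmetric] algebra_simps)
    finally show ?thesis
    proof -
      assume "emeasure \<mu> {x \<in> space m. birkhoff_sum f \<psi> n x > \<epsilon> * real n} \<le> ennreal (D * (c1 + c2 + exp c3) * real n powr (1 - a))"
      moreover have "0 \<le> D * (c1 + c2 + exp c3) * real n powr (1 - a)"
        using D C geo c2 by (simp add: c1_def)
      ultimately show ?thesis by (simp add: \<mu>.emeasure_eq_measure)
    qed
  qed
  show ?thesis
    by (rule extend_eventual_bound[where n\<^sub>0 = n\<^sub>0 and C = "D * (c1 + c2 + exp c3)"]) (auto intro: bound)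
qed

end

context uniformly_continuous_observable
begin

text \<open>For \<open>u = sqrt n\<close> the choices \<open>T = floor u\<close> and
  \<open>\<theta> = 1 / (D * u)\<close> balance all terms: the gain in the exponent is
  \<open>\<epsilon> * u / (2 * D)\<close>, truncation costs a factor at most \<open>exp 1\<close>,
  and the tails at \<open>T\<close> and at \<open>1 / (D * \<theta>) = u\<close> are both
  exponentially small in \<open>u\<close>.\<close>

lemma exponential_large_deviation:
  assumes \<epsilon>: "\<epsilon> > 0"
    and c: "c > 0" and C: "C > 0" and tail: "\<And>n. n \<ge> 1 \<Longrightarrow> tail (real n) \<le> C * exp (- c * real n)"
  shows "\<exists>C'>0. \<exists>c'>0. \<forall>n\<ge>1. measure \<mu> {x \<in> space m. birkhoff_sum f \<psi> n x > \<epsilon> * real n} \<le> C' * exp (- c' * sqrt (real n))"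
proof -
  obtain D where D: "D \<ge> 1" and master:
    "\<And>n T \<theta>. n \<ge> 1 \<Longrightarrow> \<theta> > 0 \<Longrightarrow>
      emeasure \<mu> {x \<in> space m. birkhoff_sum f \<psi> n x > \<epsilon> * real n} \<le>
        ennreal D * (tail_mean T + ennreal (real n * tail T +
          real n * exp (deviation_exponent \<epsilon> D n T \<theta>)))"
    by (rule large_deviation_master_bound[OF \<epsilon>]) (rule that, assumption, blast)
  define c2 where "c2 = \<epsilon> / (2 * D)"
  have c2: "c2 > 0" using \<epsilon> D by (simp add: c2_def)
  define c3 where "c3 = 1 + D * exp 1 * C * exp c * (8 / c\<^sup>2)"
  \<comment> \<open>Half of each rate is given up to absorb powers of \<open>n\<close>.\<close>
  define c' where "c' = min (c / 2) (c2 / 2)"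
  have c': "c' > 0" "c' \<le> c / 2" "c' \<le> c2 / 2" using c c2 by (auto simp: c'_def)
  define B1 where "B1 = 32 * C / c\<^sup>2 * exp (c / 2)"
  define B2 where "B2 = C * exp c * (8 / c\<^sup>2)"
  define B3 where "B3 = exp c3 * (8 / c2\<^sup>2)"
  have B: "B1 \<ge> 0" "B2 \<ge> 0" "B3 \<ge> 0" using C by (simp_all add: B1_def B2_def B3_def)
  have bound: "measure \<mu> {x \<in> space m. birkhoff_sum f \<psi> n x > \<epsilon> * real n} \<le> D * (B1 + B2 + B3) * exp (- c' * sqrt (real n))"
    if n: "n \<ge> 1" for n
  proof -
    define u where "u = sqrt (real n)"
    have u: "u \<ge> 1" "u\<^sup>2 = real n" using n by (auto simp: u_def)
    define T where "T = nat \<lfloor>u\<rfloor>"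
    have T: "T \<ge> 1" "real T \<le> u" "real T \<ge> u - 1" unfolding T_def using u(1) by linarith+
    have decay: "exp (- r * u) \<le> exp (- c' * u)" if "c' \<le> r" for r
      using that u(1) by (simp add: mult_right_mono)
    have "tail (real T) \<le> C * exp (- c * real T)" by (rule tail[OF T(1)])
    also have "\<dots> \<le> C * exp (c - c * u)"
    proof (intro mult_left_mono)
      have "c * (u - 1) \<le> c * real T" using T(3) c by (intro mult_left_mono) auto
      then show "exp (- c * real T) \<le> exp (c - c * u)" by (simp add: algebra_simps)
    qed (use C in simp)
    also have "\<dots> = C * exp c * exp (- c * u)" by (simp add: exp_diff exp_minus divide_inverse)
    finally have tail_T: "tail T \<le> C * exp c * exp (- c * u)" .
    have square_exp: "u\<^sup>2 * exp (- r * u) \<le> 8 / r\<^sup>2 * exp (- (r / 2) * u)" if "r > 0" for r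
    proof -
      have "u\<^sup>2 * exp (- r * u) \<le> 8 / r\<^sup>2 * exp (r * u / 2) * exp (- r * u)"
        using square_le_exp[OF that, of u] u(1) by (intro mult_right_mono) auto
      also have "\<dots> = 8 / r\<^sup>2 * exp (r * u / 2 + - r * u)" by (simp only: exp_add mult.assoc)
      finally show ?thesis by simp
    qed
    have 1: "tail_mean T \<le> ennreal (B1 * exp (- c' * u))"
    proof -
      \<comment> \<open>The polynomial estimate is reused with exponent 2: one half of the rate is
        kept as a factor at level \<open>T\<close>, the other half is traded for
        \<open>j^(-2)\<close>.\<close>
      define B where "B = C * exp (- (c / 2) * real T) * (8 / c\<^sup>2)"
      have "tail_mean T \<le> ennreal (2 * B / (1 - 2 powr (1 - 2)) * real T powr (1 - 2))"
      proof (rule tail_mean_le)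
        fix j assume j: "j \<ge> T"
        then have j0: "real j > 0" using T(1) by simp
        have "tail (real j) \<le> C * exp (- c * real j)" using j T(1) by (intro tail) simp
        also have "\<dots> = C * (exp (- (c / 2) * real j) * exp (- (c / 2) * real j))"
          by (simp add: exp_add[symmetric])
        also have "\<dots> \<le> C * (exp (- (c / 2) * real T) * (8 / c\<^sup>2 * real j powr (- 2)))"
        proof (intro mult_left_mono mult_mono)
          show "exp (- (c / 2) * real j) \<le> exp (- (c / 2) * real T)" using j c by simp
          have "exp (- (c / 2) * real j) = (real j)\<^sup>2 * exp (- (c / 2) * real j) / (real j)\<^sup>2" using j0 by simp
          also have "\<dots> \<le> 8 / c\<^sup>2 * exp (c * real j / 2) * exp (- (c / 2) * real j) / (real j)\<^sup>2"
            using square_le_exp[OF c, of "real j"] by (intro divide_right_mono mult_right_mono) auto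
          also have "\<dots> = 8 / c\<^sup>2 * exp (c * real j / 2 + - (c / 2) * real j) / (real j)\<^sup>2"
            by (simp only: exp_add mult.assoc)
          also have "\<dots> = 8 / c\<^sup>2 * real j powr (- 2)" using j0 by (simp add: powr_minus_divide)
          finally show "exp (- (c / 2) * real j) \<le> 8 / c\<^sup>2 * real j powr (- 2)" .
        qed (use C in auto)
        finally show "tail (real j) \<le> B * real j powr (- 2)" by (simp add: B_def)
      qed (use T C in \<open>auto simp: B_def\<close>)
      also have "\<dots> \<le> ennreal (B1 * exp (- c' * u))"
      proof (rule ennreal_leI)
        have "(2::real) powr (1 - 2) = 1 / 2" by (simp add: powr_minus_divide)
        moreover have "real T powr (1 - 2) \<le> 1" using T(1) by (simp add: powr_minus_divide)
        ultimately have "2 * B / (1 - 2 powr (1 - 2)) * real T powr (1 - 2) \<le> 4 * B * 1"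
          using C by (intro mult_mono) (auto simp: B_def)
        also have "\<dots> = 32 * C / c\<^sup>2 * exp (- (c / 2) * real T)" by (simp add: B_def)
        also have "\<dots> \<le> 32 * C / c\<^sup>2 * exp (c / 2 + - (c / 2) * u)"
        proof (intro mult_left_mono)
          have "c / 2 * (u - 1) \<le> c / 2 * real T" using T(3) c by (intro mult_left_mono) auto
          then show "exp (- (c / 2) * real T) \<le> exp (c / 2 + - (c / 2) * u)" by (simp add: algebra_simps)
        qed (use C in simp)
        also have "\<dots> = B1 * exp (- (c / 2) * u)" by (simp only: B1_def exp_add mult.assoc)
        also have "\<dots> \<le> B1 * exp (- c' * u)" by (intro mult_left_mono decay c' B)
        finally show "2 * B / (1 - 2 powr (1 - 2)) * real T powr (1 - 2) \<le> B1 * exp (- c' * u)" .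
      qed
      finally show ?thesis .
    qed
    have 2: "real n * tail T \<le> B2 * exp (- c' * u)"
    proof -
      have "real n * tail T \<le> u\<^sup>2 * (C * exp c * exp (- c * u))"
        unfolding u(2) using tail_T by (intro mult_left_mono) auto
      also have "\<dots> = C * exp c * (u\<^sup>2 * exp (- c * u))" by simp
      also have "\<dots> \<le> C * exp c * (8 / c\<^sup>2 * exp (- (c / 2) * u))"
        using C by (intro mult_left_mono square_exp c) auto
      also have "\<dots> = B2 * exp (- (c / 2) * u)" by (simp add: B2_def)
      also have "\<dots> \<le> B2 * exp (- c' * u)" by (intro mult_left_mono decay c' B)
      finally show ?thesis .
    qed
    define \<theta> where "\<theta> = 1 / (D * u)"
    have \<theta>: "\<theta> > 0" using D u(1) by (simp add: \<theta>_def)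
    have DT: "D * \<theta> * real T \<le> 1" using D u(1) T(2) by (simp add: \<theta>_def)
    have 3: "D * real n * exp (D * \<theta> * real T) * tail (1 / (D * \<theta>)) \<le> c3 - 1"
    proof -
      have "1 / (D * \<theta>) = u" using D u(1) by (simp add: \<theta>_def)
      then have "D * real n * exp (D * \<theta> * real T) * tail (1 / (D * \<theta>)) \<le> D * u\<^sup>2 * exp 1 * (C * exp c * exp (- c * u))"
        using DT D tail_T tail_antimono[OF T(2)] tail_nonneg by (intro mult_mono) (auto simp: u(2) intro: order_trans)
      also have "\<dots> = D * exp 1 * C * exp c * (u\<^sup>2 * exp (- c * u))" by simp
      also have "\<dots> \<le> D * exp 1 * C * exp c * (8 / c\<^sup>2)"
      proof (intro mult_left_mono)
        have "u\<^sup>2 * exp (- c * u) \<le> 8 / c\<^sup>2 * exp (- (c / 2) * u)" by (rule square_exp[OF c])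
        also have "\<dots> \<le> 8 / c\<^sup>2 * 1" using c u(1) by (intro mult_left_mono) auto
        finally show "u\<^sup>2 * exp (- c * u) \<le> 8 / c\<^sup>2" by simp
      qed (use D C in auto)
      finally show ?thesis by (simp add: c3_def)
    qed
    have 4: "real n * exp (deviation_exponent \<epsilon> D n T \<theta>)
        \<le> B3 * exp (- c' * u)"
    proof -
      have "\<theta> * (\<epsilon> * u\<^sup>2 / 2) = c2 * u" using D u(1) by (simp add: \<theta>_def c2_def power2_eq_square)
      then have "- \<theta> * (\<epsilon> * real n / 2 - D * real T) \<le> - c2 * u + 1"
        using DT by (simp add: u(2) algebra_simps)
      then have "real n * exp (deviation_exponent \<epsilon> D n T \<theta>)
          \<le> u\<^sup>2 * exp (c3 + - c2 * u)"
        unfolding u(2) deviation_exponent_def using 3 by (intro mult_left_mono) auto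
      also have "\<dots> = exp c3 * (u\<^sup>2 * exp (- c2 * u))" by (simp only: exp_add mult_ac)
      also have "\<dots> \<le> exp c3 * (8 / c2\<^sup>2 * exp (- (c2 / 2) * u))"
        by (intro mult_left_mono square_exp c2) simp
      also have "\<dots> = B3 * exp (- (c2 / 2) * u)" by (simp add: B3_def)
      also have "\<dots> \<le> B3 * exp (- c' * u)" by (intro mult_left_mono decay c' B)
      finally show ?thesis .
    qed
    have "emeasure \<mu> {x \<in> space m. birkhoff_sum f \<psi> n x > \<epsilon> * real n}
        \<le> ennreal D * (ennreal (B1 * exp (- c' * u)) + ennreal (B2 * exp (- c' * u) + B3 * exp (- c' * u)))"
      by (intro order_trans[OF master[OF n \<theta>, of T]] mult_left_mono add_mono 1 ennreal_leI 2 4) auto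
    also have "\<dots> = ennreal (D * (B1 + B2 + B3) * exp (- c' * u))"
      using D B by (subst ennreal_plus[symmetric]) (auto simp: ennreal_mult[symmetric] algebra_simps)
    finally have "emeasure \<mu> {x \<in> space m. birkhoff_sum f \<psi> n x > \<epsilon> * real n} \<le> ennreal (D * (B1 + B2 + B3) * exp (- c' * u))" .
    moreover have "0 \<le> D * (B1 + B2 + B3) * exp (- c' * u)" using D B by simp
    ultimately show ?thesis by (simp add: \<mu>.emeasure_eq_measure u_def)
  qed
  show ?thesis
  proof (intro exI conjI allI impI)
    show "D * (B1 + B2 + B3) + 1 > 0" using D B by (simp add: add_nonneg_pos)
    show "c' > 0" by (rule c'(1))
    fix n :: nat assume "n \<ge> 1"
    from bound[OF this] show "measure \<mu> {x \<in> space m. birkhoff_sum f \<psi> n x > \<epsilon> * real n}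
        \<le> (D * (B1 + B2 + B3) + 1) * exp (- c' * sqrt (real n))"
      by (simp add: distrib_right add_increasing2)
  qed
qed

end

section \<open>Two-sided deviations of an observable\<close>

context expanding_induced_map
begin

text \<open>The sign \<open>\<sigma>\<close> selects upper or lower deviations. Centring gives mean
  0, and neither operation changes the absolute value of differences, so uniform continuity is
  inherited.\<close>

lemma centered_observable:
  assumes \<phi>: "\<phi> \<in> observables m" and lim: "(osc (space m) d \<phi> \<longlongrightarrow> 0) (at_right 0)" and \<sigma>: "\<bar>\<sigma>\<bar> = (1::real)"
  defines "\<psi> \<equiv> \<lambda>x. \<sigma> * (\<phi> x - (\<integral>x. \<phi> x \<partial>\<mu>))"
  shows "\<exists>b. uniformly_continuous_observable m \<Delta> F P \<mu> d f R \<psi> b"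
proof -
  have [measurable]: "\<phi> \<in> borel_measurable m" and bdd: "bounded (\<phi> ` space m)"
    using \<phi> by (auto simp: observables_def)
  obtain B where B: "\<And>x. x \<in> space m \<Longrightarrow> \<bar>\<phi> x\<bar> \<le> B"
    using bdd by (auto simp: bounded_iff)
  define I where "I = (\<integral>x. \<phi> x \<partial>\<mu>)"
  have meas: "\<phi> \<in> borel_measurable \<mu>" using sets_\<mu> by (simp cong: measurable_cong_sets)
  have int: "integrable \<mu> \<phi>"
    by (rule \<mu>.integrable_const_bound[where B = B, OF AE_I2 meas]) (simp add: space_\<mu> B)
  have 1: "\<psi> \<in> borel_measurable m" unfolding \<psi>_def by measurable
  have \<psi>_abs: "\<bar>\<psi> x\<bar> = \<bar>\<phi> x - I\<bar>" for x using \<sigma> by (simp add: \<psi>_def I_def abs_mult)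
  have 2: "\<bar>\<psi> x\<bar> \<le> \<bar>B\<bar> + \<bar>I\<bar>" if "x \<in> space m" for x
    using B[OF that] by (simp add: \<psi>_abs)
  have \<psi>_diff: "\<bar>\<psi> x - \<psi> y\<bar> = \<bar>\<phi> x - \<phi> y\<bar>" for x y
  proof -
    have "\<psi> x - \<psi> y = \<sigma> * (\<phi> x - \<phi> y)" by (simp add: \<psi>_def algebra_simps)
    then show ?thesis using \<sigma> by (simp add: abs_mult)
  qed
  have 4: "\<exists>r>0. \<forall>x\<in>space m. \<forall>y\<in>space m. d x y \<le> r \<longrightarrow> \<bar>\<psi> x - \<psi> y\<bar> \<le> e" if "e > 0" for e
    unfolding \<psi>_diff by (rule osc_tendsto_0_imp_uniformly_continuous[OF bdd lim that])
  have "(\<integral>x. \<psi> x \<partial>\<mu>) = \<sigma> * (I - I)"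
    unfolding \<psi>_def I_def using int by (simp add: \<mu>.prob_space)
  then have 5: "(\<integral>x. \<psi> x \<partial>\<mu>) \<le> 0" by simp
  have "uniformly_continuous_observable m \<Delta> F P \<mu> d f R \<psi> (\<bar>B\<bar> + \<bar>I\<bar>)"
    by unfold_locales (use 1 2 4 5 in auto)
  then show ?thesis ..
qed

lemma large_deviation_le_one_sided:
  assumes \<phi>: "\<phi> \<in> observables m" and n: "n \<ge> 1"
  shows "large_deviation \<mu> f \<phi> \<epsilon> n
    \<le> measure \<mu> {x \<in> space m. birkhoff_sum f (\<lambda>x. 1 * (\<phi> x - (\<integral>x. \<phi> x \<partial>\<mu>))) n x > \<epsilon> * real n}
      + measure \<mu> {x \<in> space m. birkhoff_sum f (\<lambda>x. (-1) * (\<phi> x - (\<integral>x. \<phi> x \<partial>\<mu>))) n x > \<epsilon> * real n}"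
    (is "_ \<le> measure \<mu> ?A + measure \<mu> ?B")
proof -
  have [measurable]: "\<phi> \<in> borel_measurable m" using \<phi> by (auto simp: observables_def)
  define I where "I = (\<integral>x. \<phi> x \<partial>\<mu>)"
  have sets: "?A \<in> sets \<mu>" "?B \<in> sets \<mu>"
  proof -
    have [measurable]: "birkhoff_sum f (\<lambda>x. \<sigma> * (\<phi> x - (\<integral>x. \<phi> x \<partial>\<mu>))) n \<in> borel_measurable m" for \<sigma>
      by (intro birkhoff_sum_measurable f_measurable) measurable
    show "?A \<in> sets \<mu>" "?B \<in> sets \<mu>" unfolding sets_\<mu> by measurable
  qed
  have "large_deviation \<mu> f \<phi> \<epsilon> n \<le> measure \<mu> (?A \<union> ?B)"
    unfolding large_deviation_def
  proof (intro \<mu>.finite_measure_mono sets.Un sets subsetI)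
    fix x assume "x \<in> {x \<in> space \<mu>. \<bar>1 / real n * (\<Sum>i<n. \<phi> ((f ^^ i) x)) - (\<integral>x. \<phi> x \<partial>\<mu>)\<bar> > \<epsilon>}"
    then have x: "x \<in> space m" and gt: "\<bar>(\<Sum>i<n. \<phi> ((f ^^ i) x)) / real n - I\<bar> > \<epsilon>"
      by (auto simp: space_\<mu> I_def)
    have "\<epsilon> * real n < \<bar>(\<Sum>i<n. \<phi> ((f ^^ i) x)) / real n - I\<bar> * real n"
      using gt n by (intro mult_strict_right_mono) auto
    also have "\<dots> = \<bar>((\<Sum>i<n. \<phi> ((f ^^ i) x)) / real n - I) * real n\<bar>"
      by (simp add: abs_mult)
    also have "(s / real n - I) * real n = s - real n * I" for s
      using n by (simp add: field_simps)
    finally have "\<epsilon> * real n < (\<Sum>i<n. \<phi> ((f ^^ i) x)) - real n * I \<or> \<epsilon> * real n < - ((\<Sum>i<n. \<phi> ((f ^^ i) x)) - real n * I)"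
      by linarith
    moreover have bs: "birkhoff_sum f (\<lambda>x. \<sigma> * (\<phi> x - (\<integral>x. \<phi> x \<partial>\<mu>))) n x = \<sigma> * ((\<Sum>i<n. \<phi> ((f ^^ i) x)) - real n * I)" for \<sigma>
      by (simp add: birkhoff_sum_def sum_distrib_left[symmetric] sum_subtractf I_def)
    ultimately show "x \<in> ?A \<union> ?B"
      using x unfolding Un_iff mem_Collect_eq bs by simp
  qed
  also have "\<dots> \<le> measure \<mu> ?A + measure \<mu> ?B" by (intro measure_Un_le sets)
  finally show ?thesis .
qed

lemma observable_polynomial_large_deviation:
  assumes \<phi>: "\<phi> \<in> observables m" and lim: "(osc (space m) d \<phi> \<longlongrightarrow> 0) (at_right 0)" and \<epsilon>: "\<epsilon> > 0"
    and a: "a > 1" and C: "C > 0" and tail: "\<And>n. n \<ge> 1 \<Longrightarrow> tail (real n) \<le> C * real n powr (- a)"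
  shows "\<exists>C'>0. \<forall>n\<ge>1. large_deviation \<mu> f \<phi> \<epsilon> n \<le> C' * real n powr (1 - a)"
proof -
  have one_sided: "\<exists>C'>0. \<forall>n\<ge>1. measure \<mu> {x \<in> space m. birkhoff_sum f (\<lambda>x. \<sigma> * (\<phi> x - (\<integral>x. \<phi> x \<partial>\<mu>))) n x > \<epsilon> * real n} \<le> C' * real n powr (1 - a)"
    if \<sigma>: "\<bar>\<sigma>\<bar> = 1" for \<sigma>
  proof -
    obtain b where "uniformly_continuous_observable m \<Delta> F P \<mu> d f R (\<lambda>x. \<sigma> * (\<phi> x - (\<integral>x. \<phi> x \<partial>\<mu>))) b"
      using centered_observable[OF \<phi> lim \<sigma>] ..
    then show ?thesis
      by (rule uniformly_continuous_observable.polynomial_large_deviation[OF _ \<epsilon> a C tail])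
  qed
  obtain C1 where C1: "C1 > 0" "\<And>n. n \<ge> 1 \<Longrightarrow> measure \<mu> {x \<in> space m. birkhoff_sum f (\<lambda>x. 1 * (\<phi> x - (\<integral>x. \<phi> x \<partial>\<mu>))) n x > \<epsilon> * real n} \<le> C1 * real n powr (1 - a)"
    using one_sided[of 1] by auto
  obtain C2 where C2: "C2 > 0" "\<And>n. n \<ge> 1 \<Longrightarrow> measure \<mu> {x \<in> space m. birkhoff_sum f (\<lambda>x. (-1) * (\<phi> x - (\<integral>x. \<phi> x \<partial>\<mu>))) n x > \<epsilon> * real n} \<le> C2 * real n powr (1 - a)"
    using one_sided[of "-1"] by auto
  show ?thesis
  proof (intro exI conjI allI impI)
    show "C1 + C2 > 0" using C1 C2 by simp
    fix n :: nat assume n: "n \<ge> 1"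
    show "large_deviation \<mu> f \<phi> \<epsilon> n \<le> (C1 + C2) * real n powr (1 - a)"
      using large_deviation_le_one_sided[OF \<phi> n, of \<epsilon>] C1(2)[OF n] C2(2)[OF n] by (simp add: distrib_right)
  qed
qed

lemma observable_exponential_large_deviation:
  assumes \<phi>: "\<phi> \<in> observables m" and lim: "(osc (space m) d \<phi> \<longlongrightarrow> 0) (at_right 0)" and \<epsilon>: "\<epsilon> > 0"
    and c: "c > 0" and C: "C > 0" and tail: "\<And>n. n \<ge> 1 \<Longrightarrow> tail (real n) \<le> C * exp (- c * real n)"
  shows "\<exists>C'>0. \<exists>c'>0. \<forall>n\<ge>1. large_deviation \<mu> f \<phi> \<epsilon> n \<le> C' * exp (- c' * sqrt (real n))"
proof -
  have one_sided: "\<exists>C'>0. \<exists>c'>0. \<forall>n\<ge>1. measure \<mu> {x \<in> space m. birkhoff_sum f (\<lambda>x. \<sigma> * (\<phi> x - (\<integral>x. \<phi> x \<partial>\<mu>))) n x > \<epsilon> * real n} \<le> C' * exp (- c' * sqrt (real n))"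
    if \<sigma>: "\<bar>\<sigma>\<bar> = 1" for \<sigma>
  proof -
    obtain b where "uniformly_continuous_observable m \<Delta> F P \<mu> d f R (\<lambda>x. \<sigma> * (\<phi> x - (\<integral>x. \<phi> x \<partial>\<mu>))) b"
      using centered_observable[OF \<phi> lim \<sigma>] ..
    then show ?thesis
      by (rule uniformly_continuous_observable.exponential_large_deviation[OF _ \<epsilon> c C tail])
  qed
  obtain C1 c1 where C1: "C1 > 0" "c1 > 0" "\<And>n. n \<ge> 1 \<Longrightarrow> measure \<mu> {x \<in> space m. birkhoff_sum f (\<lambda>x. 1 * (\<phi> x - (\<integral>x. \<phi> x \<partial>\<mu>))) n x > \<epsilon> * real n} \<le> C1 * exp (- c1 * sqrt (real n))"
    using one_sided[of 1] by auto
  obtain C2 c2 where C2: "C2 > 0" "c2 > 0" "\<And>n. n \<ge> 1 \<Longrightarrow> measure \<mu> {x \<in> space m. birkhoff_sum f (\<lambda>x. (-1) * (\<phi> x - (\<integral>x. \<phi> x \<partial>\<mu>))) n x > \<epsilon> * real n} \<le> C2 * exp (- c2 * sqrt (real n))"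
    using one_sided[of "-1"] by auto
  define c' where "c' = min c1 c2"
  show ?thesis
  proof (intro exI conjI allI impI)
    show "C1 + C2 > 0" using C1 C2 by simp
    show "c' > 0" using C1 C2 by (simp add: c'_def)
    fix n :: nat assume n: "n \<ge> 1"
    have "C1 * exp (- c1 * sqrt (real n)) \<le> C1 * exp (- c' * sqrt (real n))"
      "C2 * exp (- c2 * sqrt (real n)) \<le> C2 * exp (- c' * sqrt (real n))"
      using C1 C2 by (auto simp: c'_def intro!: mult_right_mono)
    then show "large_deviation \<mu> f \<phi> \<epsilon> n \<le> (C1 + C2) * exp (- c' * sqrt (real n))"
      using large_deviation_le_one_sided[OF \<phi> n, of \<epsilon>] C1(3)[OF n] C2(3)[OF n] by (simp add: distrib_right)
  qed
qed

lemma tail_eq: "tail (real n) = measure m {x \<in> \<Delta>. R x > n}"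
  unfolding tail_def using \<Delta>_subset by (subst measure_restrict_space) (auto simp: Int_absorb2)

end

section \<open>Vanishing oscillation in the observable classes and comparison of rates\<close>

lemma tendsto_0_if_bigo_tendsto_0:
  fixes g h :: "real \<Rightarrow> real"
  assumes "g \<in> O[F](h)" "(h \<longlongrightarrow> 0) F"
  shows "(g \<longlongrightarrow> 0) F"
proof -
  have "h \<in> o[F](\<lambda>_. 1)" by (intro smalloI_tendsto) (use assms(2) in auto)
  with assms(1) have "g \<in> o[F](\<lambda>_. 1)" by (rule landau_o.big_small_trans)
  from smalloD_tendsto[OF this] show ?thesis by simp
qed

lemma class_R1_osc:
  assumes "\<phi> \<in> class_R1 m d \<tau>" "\<tau> > 0"
  shows "\<phi> \<in> observables m" "(osc (space m) d \<phi> \<longlongrightarrow> 0) (at_right 0)"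
proof -
  have "((\<lambda>\<epsilon>::real. \<epsilon> powr \<tau>) \<longlongrightarrow> 0) (at_right 0)"
    using assms(2) by real_asymp
  then show "(osc (space m) d \<phi> \<longlongrightarrow> 0) (at_right 0)"
    using assms(1) unfolding class_R1_def by (blast intro: tendsto_0_if_bigo_tendsto_0)
qed (use assms(1) in \<open>unfold class_R1_def, blast\<close>)

lemma class_R2_osc:
  assumes "\<phi> \<in> class_R2 m d \<tau>" "\<tau> > 0"
  shows "\<phi> \<in> observables m" "(osc (space m) d \<phi> \<longlongrightarrow> 0) (at_right 0)"
proof -
  have "filterlim (\<lambda>\<epsilon>::real. \<bar>ln \<epsilon>\<bar> powr \<tau>) at_top (at_right 0)"
    using assms(2) by real_asymp
  then have "((\<lambda>\<epsilon>::real. exp (- (\<bar>ln \<epsilon>\<bar> powr \<tau>))) \<longlongrightarrow> 0) (at_right 0)"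
    by (intro filterlim_compose[OF exp_at_bot]) (simp add: filterlim_uminus_at_top)
  then show "(osc (space m) d \<phi> \<longlongrightarrow> 0) (at_right 0)"
    using assms(1) unfolding class_R2_def by (blast intro: tendsto_0_if_bigo_tendsto_0)
qed (use assms(1) in \<open>unfold class_R2_def, blast\<close>)

lemma class_R4_osc:
  assumes "\<phi> \<in> class_R4 m d \<tau>" "\<tau> > 0"
  shows "\<phi> \<in> observables m" "(osc (space m) d \<phi> \<longlongrightarrow> 0) (at_right 0)"
proof -
  have "((\<lambda>\<epsilon>::real. \<bar>ln \<epsilon>\<bar> powr (- \<tau>)) \<longlongrightarrow> 0) (at_right 0)"
    using assms(2) by real_asymp
  then show "(osc (space m) d \<phi> \<longlongrightarrow> 0) (at_right 0)"
    using assms(1) unfolding class_R4_def by (blast intro: tendsto_0_if_bigo_tendsto_0)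
qed (use assms(1) in \<open>unfold class_R4_def, blast\<close>)

text \<open>Decay in \<open>sqrt n\<close> beats every power of \<open>n\<close>; finitely many
  early \<open>n\<close> only affect the constant.\<close>

lemma exp_sqrt_le_powr:
  fixes c r :: real
  assumes "c > 0"
  obtains D where "D > 0" "\<And>n::nat. n \<ge> 1 \<Longrightarrow> exp (- c * sqrt (real n)) \<le> D * real n powr r"
proof -
  have "((\<lambda>n::nat. exp (- c * sqrt (real n)) / real n powr r) \<longlongrightarrow> 0) sequentially"
    using assms by real_asymp
  then have "eventually (\<lambda>n::nat. exp (- c * sqrt (real n)) / real n powr r < 1) sequentially"
    by (intro order_tendstoD) auto
  then obtain n\<^sub>0 :: nat where n\<^sub>0: "\<And>n. n \<ge> n\<^sub>0 \<Longrightarrow> exp (- c * sqrt (real n)) / real n powr r < 1"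
    by (auto simp: eventually_sequentially)
  have "\<exists>D>0. \<forall>n\<ge>1. exp (- c * sqrt (real n)) \<le> D * real n powr r"
  proof (rule extend_eventual_bound[where n\<^sub>0 = n\<^sub>0 and C = 1])
    fix n assume "n \<ge> n\<^sub>0" "(1::nat) \<le> n"
    then show "exp (- c * sqrt (real n)) \<le> 1 * real n powr r"
      using n\<^sub>0[of n] by (simp add: divide_less_eq)
  qed (use assms in auto)
  then show ?thesis using that by blast
qed

theorem corollary3:
  fixes m \<mu> :: "'a measure"
    and d :: "'a \<Rightarrow> 'a \<Rightarrow> real"
    and f F :: "'a \<Rightarrow> 'a"
    and \<Delta> :: "'a set"
    and R :: "'a \<Rightarrow> nat"
    and P :: "'a set set"
  assumes "Metric_space (space m) d"
    and "f \<in> m \<rightarrow>\<^sub>M m"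
    and "absolutely_continuous m (distr m m f)"
    and "induced_map m f \<Delta> R F P"
    and "WGM_map (restrict_space m \<Delta>) F P"
    and "aperiodic m F P"
    and "coprime_block m R F P"
    and "expanding d f R F P"
    and "integrable (restrict_space m \<Delta>) (\<lambda>x. real (R x))"
    and "sets \<mu> = sets m"
    and "ergodic_invariant_prob f \<mu>"
    and "absolutely_continuous m \<mu>"
    and "emeasure \<mu> \<Delta> > 0"
  shows
    "(\<forall>a>1. (\<exists>C>0. \<forall>n\<ge>1. measure m {x \<in> \<Delta>. R x > n} \<le> C * real n powr (- a)) \<longrightarrow>
        (\<forall>\<kappa>>0. \<exists>\<zeta>. 0 < \<zeta> \<and> \<zeta> < 1 \<and>
          (\<forall>\<epsilon>>0. \<forall>\<tau>>1. \<forall>\<phi>\<in>class_R4 m d \<tau>.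
             2 / \<zeta> < \<tau> \<and> \<tau> \<noteq> (a + 1) / \<zeta> \<and> osc_infty (space m) \<phi> < \<kappa> \<longrightarrow>
             (\<exists>C'>0. \<forall>n\<ge>1. large_deviation \<mu> f \<phi> \<epsilon> n
                \<le> C' * max (real n powr (- a + 1)) (real n powr (2 - \<zeta> * \<tau>)))))) \<and>
     (\<forall>c>0. (\<exists>C>0. \<forall>n\<ge>1. measure m {x \<in> \<Delta>. R x > n} \<le> C * exp (- c * real n)) \<longrightarrow>
        (\<forall>\<epsilon>>0. \<forall>\<tau>. 0 < \<tau> \<and> \<tau> < 1 \<longrightarrow> (\<forall>\<phi>\<in>class_R1 m d \<tau>.
           \<exists>C'>0. \<exists>c'>0. \<forall>n\<ge>1. large_deviation \<mu> f \<phi> \<epsilon> n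
             \<le> C' * exp (- c' * real n powr (1 / 3)))) \<and>
        (\<forall>\<epsilon>>0. \<forall>\<tau>. 0 < \<tau> \<and> \<tau> < 1 \<longrightarrow> (\<forall>\<phi>\<in>class_R2 m d \<tau>.
           \<exists>c'>0. \<forall>\<tau>'. 0 < \<tau>' \<and> \<tau>' < \<tau> \<longrightarrow>
             (\<exists>C'>0. \<forall>n\<ge>1. large_deviation \<mu> f \<phi> \<epsilon> n
                \<le> C' * exp (- c' * real n powr (\<tau>' / (\<tau>' + 2)))))) \<and>
        (\<forall>\<kappa>>0. \<exists>\<zeta>. 0 < \<zeta> \<and> \<zeta> < 1 \<and>
          (\<forall>\<epsilon>>0. \<forall>\<tau>>1. \<forall>\<phi>\<in>class_R4 m d \<tau>.
             1 / \<zeta> < \<tau> \<and> osc_infty (space m) \<phi> < \<kappa> \<longrightarrow>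
             (\<exists>C'>0. \<forall>n\<ge>1. large_deviation \<mu> f \<phi> \<epsilon> n
                \<le> C' * real n powr (1 - \<zeta> * \<tau>)))))"
proof -
  interpret WGM_map "restrict_space m \<Delta>" F P by fact
  interpret expanding_induced_map m \<Delta> F P \<mu> d f R
    by unfold_locales fact+
  \<comment> \<open>The rate \<open>n^(1 - a)\<close> is one entry of the maximum, so the bound
    holds whatever the other exponent \<open>r\<close> is.\<close>
  have polynomial: "\<exists>C'>0. \<forall>n\<ge>1. large_deviation \<mu> f \<phi> \<epsilon> n \<le> C' * max (real n powr (- a + 1)) (real n powr r)"
    if a: "a > 1" and tail: "\<exists>C>0. \<forall>n\<ge>1. measure m {x \<in> \<Delta>. R x > n} \<le> C * real n powr (- a)"
      and \<phi>: "\<phi> \<in> class_R4 m d \<tau>" and "\<tau> > 1" and \<epsilon>: "\<epsilon> > 0" for a \<tau> \<phi> \<epsilon> r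
  proof -
    obtain C where C: "C > 0" "\<And>n. n \<ge> 1 \<Longrightarrow> tail (real n) \<le> C * real n powr (- a)"
      using tail unfolding tail_eq by blast
    have "\<tau> > 0" using \<open>\<tau> > 1\<close> by simp
    then obtain C' where C': "C' > 0" "\<And>n. n \<ge> 1 \<Longrightarrow> large_deviation \<mu> f \<phi> \<epsilon> n \<le> C' * real n powr (1 - a)"
      using observable_polynomial_large_deviation[OF class_R4_osc[OF \<phi>] \<epsilon> a C] by blast
    have "large_deviation \<mu> f \<phi> \<epsilon> n \<le> C' * max (real n powr (- a + 1)) (real n powr r)" if "n \<ge> 1" for n
    proof -
      have "C' * real n powr (1 - a) \<le> C' * max (real n powr (- a + 1)) (real n powr r)"
        using C'(1) by (intro mult_left_mono) auto
      then show ?thesis using C'(2)[OF that] by linarith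
    qed
    with C'(1) show ?thesis by blast
  qed
  have exponential: "\<exists>C'>0. \<exists>c'>0. \<forall>n\<ge>1. large_deviation \<mu> f \<phi> \<epsilon> n \<le> C' * exp (- c' * sqrt (real n))"
    if c: "c > 0" and tail: "\<exists>C>0. \<forall>n\<ge>1. measure m {x \<in> \<Delta>. R x > n} \<le> C * exp (- c * real n)"
      and \<phi>: "\<phi> \<in> observables m" "(osc (space m) d \<phi> \<longlongrightarrow> 0) (at_right 0)" and \<epsilon>: "\<epsilon> > 0" for c \<phi> \<epsilon>
  proof -
    obtain C where C: "C > 0" "\<And>n. n \<ge> 1 \<Longrightarrow> tail (real n) \<le> C * exp (- c * real n)"
      using tail unfolding tail_eq by blast
    show ?thesis by (rule observable_exponential_large_deviation[OF \<phi> \<epsilon> c C])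
  qed
  \<comment> \<open>Covers \<open>1 / 3\<close> and also \<open>\<tau>' / (\<tau>' + 2)\<close>,
    which is at most \<open>1 / 2\<close> because \<open>\<tau>' < \<tau> < 1\<close>.\<close>
  have stretched: "C' * exp (- c' * sqrt (real n)) \<le> C' * exp (- c' * real n powr r)"
    if "C' > 0" "c' > 0" "r \<le> 1 / 2" "n \<ge> 1" for C' c' r :: real and n :: nat
  proof -
    have "real n powr r \<le> real n powr (1 / 2)" using that by (intro powr_mono) auto
    then have "real n powr r \<le> sqrt (real n)" using that by (simp add: powr_half_sqrt)
    then show ?thesis using that by simp
  qed
  show ?thesis
  proof (intro conjI allI impI)
    fix a \<kappa> :: real
    assume a: "a > 1" "\<exists>C>0. \<forall>n\<ge>1. measure m {x \<in> \<Delta>. R x > n} \<le> C * real n powr (- a)"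
    show "\<exists>\<zeta>. 0 < \<zeta> \<and> \<zeta> < 1 \<and>
          (\<forall>\<epsilon>>0. \<forall>\<tau>>1. \<forall>\<phi>\<in>class_R4 m d \<tau>.
             2 / \<zeta> < \<tau> \<and> \<tau> \<noteq> (a + 1) / \<zeta> \<and> osc_infty (space m) \<phi> < \<kappa> \<longrightarrow>
             (\<exists>C'>0. \<forall>n\<ge>1. large_deviation \<mu> f \<phi> \<epsilon> n
                \<le> C' * max (real n powr (- a + 1)) (real n powr (2 - \<zeta> * \<tau>))))"
    proof (rule exI[of _ "1 / 2"], intro conjI)
      show "\<forall>\<epsilon>>0. \<forall>\<tau>>1. \<forall>\<phi>\<in>class_R4 m d \<tau>.
             2 / (1 / 2) < \<tau> \<and> \<tau> \<noteq> (a + 1) / (1 / 2) \<and> osc_infty (space m) \<phi> < \<kappa> \<longrightarrow>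
             (\<exists>C'>0. \<forall>n\<ge>1. large_deviation \<mu> f \<phi> \<epsilon> n
                \<le> C' * max (real n powr (- a + 1)) (real n powr (2 - 1 / 2 * \<tau>)))"
        using polynomial[OF a] by blast
    qed simp_all
  next
    fix c \<epsilon> \<tau> :: real
    assume c: "c > 0" "\<exists>C>0. \<forall>n\<ge>1. measure m {x \<in> \<Delta>. R x > n} \<le> C * exp (- c * real n)"
      and "\<epsilon> > 0" "0 < \<tau> \<and> \<tau> < 1"
    show "\<forall>\<phi>\<in>class_R1 m d \<tau>. \<exists>C'>0. \<exists>c'>0. \<forall>n\<ge>1. large_deviation \<mu> f \<phi> \<epsilon> n \<le> C' * exp (- c' * real n powr (1 / 3))"
    proof
      fix \<phi> assume \<phi>: "\<phi> \<in> class_R1 m d \<tau>"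
      have "\<tau> > 0" using \<open>0 < \<tau> \<and> \<tau> < 1\<close> by blast
      then obtain C' c' where C': "C' > 0" "c' > 0"
        "\<And>n. n \<ge> 1 \<Longrightarrow> large_deviation \<mu> f \<phi> \<epsilon> n \<le> C' * exp (- c' * sqrt (real n))"
        using exponential[OF c class_R1_osc[OF \<phi>] \<open>\<epsilon> > 0\<close>] by blast
      have "large_deviation \<mu> f \<phi> \<epsilon> n \<le> C' * exp (- c' * real n powr (1 / 3))" if "n \<ge> 1" for n
        by (rule order_trans[OF C'(3)[OF that] stretched[OF C'(1,2) _ that]]) simp
      with C' show "\<exists>C'>0. \<exists>c'>0. \<forall>n\<ge>1. large_deviation \<mu> f \<phi> \<epsilon> n \<le> C' * exp (- c' * real n powr (1 / 3))"
        by blast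
    qed
  next
    fix c \<epsilon> \<tau> :: real
    assume c: "c > 0" "\<exists>C>0. \<forall>n\<ge>1. measure m {x \<in> \<Delta>. R x > n} \<le> C * exp (- c * real n)"
      and "\<epsilon> > 0" "0 < \<tau> \<and> \<tau> < 1"
    show "\<forall>\<phi>\<in>class_R2 m d \<tau>. \<exists>c'>0. \<forall>\<tau>'. 0 < \<tau>' \<and> \<tau>' < \<tau> \<longrightarrow>
             (\<exists>C'>0. \<forall>n\<ge>1. large_deviation \<mu> f \<phi> \<epsilon> n \<le> C' * exp (- c' * real n powr (\<tau>' / (\<tau>' + 2))))"
    proof
      fix \<phi> assume \<phi>: "\<phi> \<in> class_R2 m d \<tau>"
      have "\<tau> > 0" using \<open>0 < \<tau> \<and> \<tau> < 1\<close> by blast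
      then obtain C' c' where C': "C' > 0" "c' > 0"
        "\<And>n. n \<ge> 1 \<Longrightarrow> large_deviation \<mu> f \<phi> \<epsilon> n \<le> C' * exp (- c' * sqrt (real n))"
        using exponential[OF c class_R2_osc[OF \<phi>] \<open>\<epsilon> > 0\<close>] by blast
      have "large_deviation \<mu> f \<phi> \<epsilon> n \<le> C' * exp (- c' * real n powr (\<tau>' / (\<tau>' + 2)))"
        if "n \<ge> 1" "0 < \<tau>' \<and> \<tau>' < \<tau>" for n \<tau>'
      proof -
        have "\<tau>' / (\<tau>' + 2) \<le> 1 / 2" using that \<open>0 < \<tau> \<and> \<tau> < 1\<close> by (simp add: field_simps)
        from order_trans[OF C'(3)[OF that(1)] stretched[OF C'(1,2) this that(1)]] show ?thesis .
      qed
      with C' show "\<exists>c'>0. \<forall>\<tau>'. 0 < \<tau>' \<and> \<tau>' < \<tau> \<longrightarrow>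
             (\<exists>C'>0. \<forall>n\<ge>1. large_deviation \<mu> f \<phi> \<epsilon> n \<le> C' * exp (- c' * real n powr (\<tau>' / (\<tau>' + 2))))"
        \<comment> \<open>The rate \<open>c'\<close> comes from the bound in \<open>sqrt n\<close>
          and so is chosen before \<open>\<tau>'\<close>, as the order of quantifiers
          demands.\<close>
        by (intro exI[of _ c'] conjI allI impI exI[of _ C']) auto
    qed
  next
    fix c \<kappa> :: real
    assume c: "c > 0" "\<exists>C>0. \<forall>n\<ge>1. measure m {x \<in> \<Delta>. R x > n} \<le> C * exp (- c * real n)"
    have "\<exists>C'>0. \<forall>n\<ge>1. large_deviation \<mu> f \<phi> \<epsilon> n \<le> C' * real n powr (1 - 1 / 2 * \<tau>)"
      if \<epsilon>: "\<epsilon> > 0" and \<tau>: "\<tau> > 1" and \<phi>: "\<phi> \<in> class_R4 m d \<tau>" for \<epsilon> \<tau> \<phi>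
    proof -
      have "\<tau> > 0" using \<tau> by simp
      then obtain C' c' where C': "C' > 0" "c' > 0"
        "\<And>n. n \<ge> 1 \<Longrightarrow> large_deviation \<mu> f \<phi> \<epsilon> n \<le> C' * exp (- c' * sqrt (real n))"
        using exponential[OF c class_R4_osc[OF \<phi>] \<epsilon>] by blast
      obtain D where D: "D > 0" "\<And>n::nat. n \<ge> 1 \<Longrightarrow> exp (- c' * sqrt (real n)) \<le> D * real n powr (1 - 1 / 2 * \<tau>)"
        using exp_sqrt_le_powr[OF C'(2)] by blast
      have "large_deviation \<mu> f \<phi> \<epsilon> n \<le> C' * D * real n powr (1 - 1 / 2 * \<tau>)" if "n \<ge> 1" for n
      proof -
        have "C' * exp (- c' * sqrt (real n)) \<le> C' * (D * real n powr (1 - 1 / 2 * \<tau>))"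
          using D(2)[OF that] C'(1) by (intro mult_left_mono) auto
        with C'(3)[OF that] show ?thesis by (simp only: mult.assoc)
      qed
      moreover have "C' * D > 0" using C'(1) D(1) by simp
      ultimately show ?thesis by blast
    qed
    then show "\<exists>\<zeta>. 0 < \<zeta> \<and> \<zeta> < 1 \<and>
          (\<forall>\<epsilon>>0. \<forall>\<tau>>1. \<forall>\<phi>\<in>class_R4 m d \<tau>.
             1 / \<zeta> < \<tau> \<and> osc_infty (space m) \<phi> < \<kappa> \<longrightarrow>
             (\<exists>C'>0. \<forall>n\<ge>1. large_deviation \<mu> f \<phi> \<epsilon> n \<le> C' * real n powr (1 - \<zeta> * \<tau>)))"
      by (intro exI[of _ "1 / 2 :: real"] conjI) (simp, simp, blast)
  qed
qed

end
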